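(* The number of elements of the group $\Gamma=\rho(\pi_1(\mathcal H^{\bf C}_0,* ))\subset \mathrm{Aut}(\Sigma_2)$ is at least as large as the number of topological conjugacy classes of real mappings $f_{a,b}|_{K^{\bf R}_{a,b}}:K^{\bf R}_{a,b}\to K^{\bf R}_{a,b}$, where $(a,b)$ ranges over ${\bf R}^2\cap\mathcal H^{\bf C}_0$.
   Context: For $(a,b)\in{\bf C}^2$ with $b\ne0$ let $f_{a,b}:{\bf C}^2\to{\bf C}^2$, $f_{a,b}(x,y)=(x^2+a-by,\,x)$ (the complex Hénon family). Let $K_{a,b}=\{p\in{\bf C}^2:\{f_{a,b}^n(p):n\in{\bf Z}\}\text{ is bounded}\}$ and $K^{\bf R}_{a,b}=K_{a,b}\cap{\bf R}^2$. $\Sigma_2=\{0,1\}^{\bf Z}$ with the shift $\sigma$ is the full 2-shift, and $\mathrm{Aut}(\Sigma_2)$ is the group of homeomorphisms of $\Sigma_2$ commuting with $\sigma$. The complex horseshoe locus $\mathcal H^{\bf C}$ is the set of $(a,b)\in{\bf C}^2$, $b\neq 0$, such that $f_{a,b}|_{K_{a,b}}$ is hyperbolic and topologically conjugate to $(\Sigma_2,\sigma)$; it is open by structural stability. It contains $HOV=\{(a,b)\in{\bf C}^2:|a|>2(|b|+1)^2,\ b\neq0\}$, and $\mathcal H^{\bf C}_0$ denotes the connected component of $\mathcal H^{\bf C}$ containing $HOV$. Base point and coding: fix $*=(a_0,b_0)\in HOV\cap{\bf R}^2$ with $a_0<0$. Then $K_*\subset{\bf R}^2$ and $K_*$ does not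 meet $\{x=0\}$; let $c_*:K_*\to\Sigma_2$ be the conjugacy sending $p$ to the sequence whose $n$-th symbol is $0$ if the $x$-coordinate of $f_*^n(p)$ is negative and $1$ if it is positive. Monodromy: for a path $\sigma:[0,1]\to\mathcal H^{\bf C}_0$, structural stability gives a unique continuous family of topological conjugacies $g_t:K_{\sigma(0)}\to K_{\sigma(t)}$ (conjugating $f_{\sigma(0)}$ to $f_{\sigma(t)}$) with $g_0=\mathrm{id}$; put $\alpha(\sigma)=g_1$. For a loop $\sigma$ based at $*$ put $\rho(\sigma)=c_*\circ\alpha(\sigma)\circ c_*^{-1}\in\mathrm{Aut}(\Sigma_2)$. This depends only on the homotopy class and gives an anti-homomorphism $\rho:\pi_1(\mathcal H^{\bf C}_0,* )\to\mathrm{Aut}(\Sigma_2)$, $\rho(\gamma_1\cdot\gamma_2)=\rho(\gamma_2)\rho(\gamma_1)$ ($\gamma_1\cdot\gamma_2$ means first $\gamma_1$, then $\gamma_2$), whose image is the subgroup $\Gamma$. Real mappings $f_{a,b}|_{K^{\bf R}_{a,b}}$ and $f_{a',b'}|_{K^{\bf R}_{a',b'}}$ are in the same conjugacy class if they are topologically conjugate (the case of empty $K^{\bf R}_{a,b}$ counts as one class). *)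

theory Defs
  imports "HOL-Analysis.Analysis"
begin

text \<open>Meaningful when \<open>f\<close> is bijective.\<close>

definition int_iter :: "('a \<Rightarrow> 'a) \<Rightarrow> int \<Rightarrow> 'a \<Rightarrow> 'a" where
  "int_iter f n = (if 0 \<le> n then f ^^ nat n else inv f ^^ nat (- n))"

definition conjugates ::
  "('a::topological_space \<Rightarrow> 'b::topological_space) \<Rightarrow> ('a \<Rightarrow> 'a) \<Rightarrow> 'a set \<Rightarrow> ('b \<Rightarrow> 'b) \<Rightarrow> 'b set \<Rightarrow> bool"
  where
  "conjugates h f K g L \<longleftrightarrow> (\<exists>k. homeomorphism K L h k) \<and> (\<forall>p\<in>K. h (f p) = g (h p))"

definition top_conjugate ::
  "('a::topological_space \<Rightarrow> 'a) \<Rightarrow> 'a set \<Rightarrow> ('b::topological_space \<Rightarrow> 'b) \<Rightarrow> 'b set \<Rightarrow> bool" where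
  "top_conjugate f K g L \<longleftrightarrow> (\<exists>h. conjugates h f K g L)"

text \<open>Meaningful for a diffeomorphism \<open>f\<close>.  Continuity of the splitting is a consequence of
  the uniform estimates and is not required separately.\<close>

definition hyperbolic_set :: "('a::euclidean_space \<Rightarrow> 'a) \<Rightarrow> 'a set \<Rightarrow> bool" where
  "hyperbolic_set f K \<longleftrightarrow>
     compact K \<and> f ` K = K \<and>
     (\<exists>Es Eu C \<mu>. 0 < C \<and> 0 < \<mu> \<and> \<mu> < 1 \<and>
       (\<forall>p\<in>K.
          subspace (Es p) \<and> subspace (Eu p) \<and>
          Es p \<inter> Eu p = {0} \<and> {u + v |u v. u \<in> Es p \<and> v \<in> Eu p} = UNIV \<and>
          frechet_derivative f (at p) ` Es p = Es (f p) \<and>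
          frechet_derivative f (at p) ` Eu p = Eu (f p) \<and>
          (\<forall>n. \<forall>v\<in>Es p. norm (frechet_derivative (f ^^ n) (at p) v) \<le> C * \<mu> ^ n * norm v) \<and>
          (\<forall>n. \<forall>v\<in>Eu p. norm (frechet_derivative (inv f ^^ n) (at p) v) \<le> C * \<mu> ^ n * norm v)))"

text \<open>The full 2-shift: the space is the whole type \<open>int \<Rightarrow> bool\<close> with its product topology
  (\<open>bool\<close> is discrete); \<open>False\<close> stands for the symbol 0 and \<open>True\<close> for the symbol 1.\<close>

type_synonym sigma2 = "int \<Rightarrow> bool"

definition shift :: "sigma2 \<Rightarrow> sigma2" where
  "shift s = (\<lambda>n. s (n + 1))"

text \<open>A parameter is the pair \<open>(a, b)\<close>.  The map is bijective exactly when \<open>b \<noteq> 0\<close>;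
  \<open>henon_K\<close> is only used for such parameters.\<close>

fun henon :: "complex \<times> complex \<Rightarrow> complex \<times> complex \<Rightarrow> complex \<times> complex" where
  "henon (a, b) (x, y) = (x\<^sup>2 + a - b * y, x)"

definition henon_K :: "complex \<times> complex \<Rightarrow> (complex \<times> complex) set" where
  "henon_K z = {p. bounded (range (\<lambda>n. int_iter (henon z) n p))}"

definition real_points :: "(complex \<times> complex) set" where
  "real_points = \<real> \<times> \<real>"

definition henon_KR :: "complex \<times> complex \<Rightarrow> (complex \<times> complex) set" where
  "henon_KR z = henon_K z \<inter> real_points"

definition horseshoe_locus :: "(complex \<times> complex) set" where
  "horseshoe_locus =
     {z. snd z \<noteq> 0 \<and> hyperbolic_set (henon z) (henon_K z) \<and>
         top_conjugate (henon z) (henon_K z) shift (UNIV :: sigma2 set)}"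

definition HOV :: "(complex \<times> complex) set" where
  "HOV = {(a, b). cmod a > 2 * (cmod b + 1)\<^sup>2 \<and> b \<noteq> 0}"

text \<open>The component of the horseshoe locus containing \<open>HOV\<close>.  Components are pairwise disjoint
  and \<open>HOV\<close> is nonempty, so the union is over a single component.\<close>

definition H0 :: "(complex \<times> complex) set" where
  "H0 = \<Union>{C \<in> components horseshoe_locus. HOV \<subseteq> C}"

definition coding :: "complex \<times> complex \<Rightarrow> complex \<times> complex \<Rightarrow> sigma2" where
  "coding z p = (\<lambda>n. 0 < Re (fst (int_iter (henon z) n p)))"

definition conjugacy_family ::
  "(real \<Rightarrow> complex \<times> complex) \<Rightarrow> (real \<Rightarrow> complex \<times> complex \<Rightarrow> complex \<times> complex) \<Rightarrow> bool" where
  "conjugacy_family \<sigma> g \<longleftrightarrow>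
     continuous_on ({0..1} \<times> henon_K (\<sigma> 0)) (\<lambda>(t, p). g t p) \<and>
     (\<forall>t\<in>{0..1}. conjugates (g t) (henon (\<sigma> 0)) (henon_K (\<sigma> 0)) (henon (\<sigma> t)) (henon_K (\<sigma> t))) \<and>
     (\<forall>p\<in>henon_K (\<sigma> 0). g 0 p = p)"

text \<open>Only the values of \<open>g 1\<close> on \<open>henon_K (\<sigma> 0)\<close> are determined by the path, hence the restriction.\<close>

definition transport ::
  "(real \<Rightarrow> complex \<times> complex) \<Rightarrow> complex \<times> complex \<Rightarrow> complex \<times> complex" where
  "transport \<sigma> = (THE h. \<exists>g. conjugacy_family \<sigma> g \<and> h = restrict (g 1) (henon_K (\<sigma> 0)))"

definition loops :: "complex \<times> complex \<Rightarrow> (real \<Rightarrow> complex \<times> complex) set" where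
  "loops z = {\<sigma>. path \<sigma> \<and> path_image \<sigma> \<subseteq> H0 \<and> pathstart \<sigma> = z \<and> pathfinish \<sigma> = z}"

definition monodromy ::
  "complex \<times> complex \<Rightarrow> (real \<Rightarrow> complex \<times> complex) \<Rightarrow> sigma2 \<Rightarrow> sigma2" where
  "monodromy z \<sigma> = coding z \<circ> transport \<sigma> \<circ> inv_into (henon_K z) (coding z)"

text \<open>The image of the fundamental group: the monodromy of a homotopy class is that of any of
  its loops, so the image is the set of monodromies of all loops.\<close>

definition monodromy_group :: "complex \<times> complex \<Rightarrow> (sigma2 \<Rightarrow> sigma2) set" where
  "monodromy_group z = monodromy z ` loops z"

definition real_conj_rel :: "((complex \<times> complex) \<times> (complex \<times> complex)) set" where
  "real_conj_rel =
     {(z, w). z \<in> real_points \<inter> H0 \<and> w \<in> real_points \<inter> H0 \<and>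
              top_conjugate (henon z) (henon_KR z) (henon w) (henon_KR w)}"

definition real_conj_classes :: "(complex \<times> complex) set set" where
  "real_conj_classes = (real_points \<inter> H0) // real_conj_rel"

end

theory Submission
  imports Defs
begin

text \<open>
  For a real parameter \<open>w\<close> in \<open>H0\<close> take a path \<open>\<sigma>\<close> from the base point to \<open>w\<close> and let \<open>g\<close> be the
  induced conjugacy.  The conjugate path induces \<open>cj \<circ> g\<close>, because \<open>henon_K\<close> of the base point
  is real.  The loop that follows \<open>\<sigma>\<close> and returns along the conjugate path therefore acts by
  \<open>p \<mapsto> g\<^sup>-\<^sup>1 (cj (g p))\<close>, whose fixed points are the \<open>p\<close> with \<open>g p\<close> real.  So the monodromy
  of this loop determines the real map up to conjugacy.

  Orbits are bounded bi-infinite solutions of \<open>x (n + 1) = (x n)\<^sup>2 + a - b x (n - 1)\<close>.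
  Hyperbolicity amounts to invertibility of the linearised recurrence on bounded sequences, which
  gives structural stability by a contraction argument; that every nearby orbit arises in this way
  follows from the shadowing property of the full shift.
\<close>

section \<open>Iteration and orbits\<close>

text \<open>\<open>transport\<close> is a definite description, so nothing can be said about a loop
  until conjugacy families are known to exist and to be unique along every path in the locus. This
  forces a full proof of structural stability, including openness of the locus, from which
  path-connectedness of \<open>H0\<close> follows. Splittings are awkward to perturb. The bound on
  the inverse of \<open>lin_op\<close> is uniform over all orbits in \<open>henon_K\<close> and
  survives small changes of the coefficients with a factor 2; a splitting is recovered from it as
  the vectors with bounded half-orbits. Turning fixed points of a monodromy into fixed points in the
  base \<open>henon_K\<close> takes injectivity of the coding. Near the boundary of
  \<open>HOV\<close> the available lower bound on the values under the square root tends to 0, so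
  the Euclidean derivative estimate gives no contraction of the inverse branches; hence the disc
  metric.\<close>

lemma int_iter_0 [simp]: "int_iter f 0 p = p"
  by (simp add: int_iter_def)

lemma int_iter_1 [simp]: "int_iter f 1 = f"
  by (simp add: int_iter_def)

lemma int_iter_Suc:
  assumes "bij f"
  shows "int_iter f (n + 1) p = f (int_iter f n p)"
proof -
  consider "n \<ge> 0" | "n = -1" | "n < -1" by linarith
  then show ?thesis
  proof cases
    case 1
    then have "nat (n + 1) = Suc (nat n)" by simp
    with 1 show ?thesis by (simp add: int_iter_def)
  next
    case 2
    then show ?thesis using assms by (simp add: int_iter_def bij_is_surj surj_f_inv_f)
  next
    case 3
    then have "nat (- n) = Suc (nat (- (n + 1)))" by simp
    with 3 show ?thesis using assms by (simp add: int_iter_def bij_is_surj surj_f_inv_f)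
  qed
qed

lemma int_iter_pred:
  assumes "bij f"
  shows "int_iter f (n - 1) p = inv f (int_iter f n p)"
  using int_iter_Suc[OF assms, of "n - 1" p] assms by (simp add: bij_is_inj)

lemma int_iter_add:
  assumes "bij f"
  shows "int_iter f (m + n) p = int_iter f m (int_iter f n p)"
proof (induction m rule: int_induct[where k = 0])
  case base
  then show ?case by simp
next
  case (step1 i)
  then show ?case
    using int_iter_Suc[OF assms, of "i + n" p] int_iter_Suc[OF assms, of i "int_iter f n p"]
    by (simp add: add.commute add.left_commute)
next
  case (step2 i)
  then show ?case
    using int_iter_pred[OF assms, of "i + n" p] int_iter_pred[OF assms, of i "int_iter f n p"]
    by (simp add: algebra_simps)
qed

lemma int_iter_of_nat: "int_iter f (int n) = f ^^ n"
  by (simp add: int_iter_def)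

lemma int_iter_neg_of_nat: "int_iter f (- int n) = inv f ^^ n"
  by (cases "n = 0") (simp_all add: int_iter_def)

section \<open>The Henon map as a second-order recurrence\<close>

fun henon_inv :: "complex \<times> complex \<Rightarrow> complex \<times> complex \<Rightarrow> complex \<times> complex" where
  "henon_inv (a, b) (x, y) = (y, (y\<^sup>2 + a - x) / b)"

lemma henon_inv_henon:
  assumes "snd z \<noteq> 0"
  shows "henon_inv z (henon z p) = p" "henon z (henon_inv z p) = p"
  using assms by (cases z; cases p; simp add: field_simps)+

lemma bij_henon: "snd z \<noteq> 0 \<Longrightarrow> bij (henon z)"
  by (rule o_bij[of "henon_inv z"]) (auto simp: henon_inv_henon fun_eq_iff)

lemma inv_henon: "snd z \<noteq> 0 \<Longrightarrow> inv (henon z) = henon_inv z"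
  by (rule inv_equality) (auto simp: henon_inv_henon)

lemmas hiter_Suc = int_iter_Suc[OF bij_henon]
  and hiter_pred = int_iter_pred[OF bij_henon]
  and hiter_add = int_iter_add[OF bij_henon]

text \<open>An orbit point consists of two successive terms of one complex sequence, so the first
  coordinates carry the whole orbit, and sup-norm estimates for scalar sequences replace estimates
  in the plane.\<close>

definition orb :: "complex \<times> complex \<Rightarrow> complex \<times> complex \<Rightarrow> int \<Rightarrow> complex" where
  "orb z p n = fst (int_iter (henon z) n p)"

lemma fst_henon: "fst (henon z p) = (fst p)\<^sup>2 + fst z - snd z * snd p"
  by (cases z; cases p) simp

lemma snd_henon [simp]: "snd (henon z p) = fst p"
  by (cases z; cases p) simp

lemma snd_int_iter: 
  assumes "snd z \<noteq> 0"
  shows "snd (int_iter (henon z) n p) = orb z p (n - 1)"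
  using hiter_Suc[OF assms, of "n - 1" p] by (simp add: orb_def)

lemma int_iter_orb:
  "snd z \<noteq> 0 \<Longrightarrow> int_iter (henon z) n p = (orb z p n, orb z p (n - 1))"
  using snd_int_iter[of z n p] by (simp add: orb_def prod_eq_iff)

lemma orb_rec:
  assumes "snd z \<noteq> 0"
  shows "orb z p (n + 1) = (orb z p n)\<^sup>2 + fst z - snd z * orb z p (n - 1)"
  using hiter_Suc[OF assms, of n p] by (simp add: orb_def fst_henon snd_int_iter[OF assms])

lemma orb_0: "snd z \<noteq> 0 \<Longrightarrow> (orb z p 0, orb z p (-1)) = p"
  using int_iter_orb[of z 0 p] by simp

lemma orb_int_iter: "snd z \<noteq> 0 \<Longrightarrow> orb z (int_iter (henon z) m p) n = orb z p (n + m)"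
  by (simp add: orb_def hiter_add)

lemma orb_henon: "snd z \<noteq> 0 \<Longrightarrow> orb z (henon z p) n = orb z p (n + 1)"
  using orb_int_iter[of z 1 p n] by simp

lemma int_iter_of_recurrence:
  assumes "snd z \<noteq> 0" and "\<And>n. x (n + 1) = (x n)\<^sup>2 + fst z - snd z * x (n - 1)"
  shows "int_iter (henon z) n (x 0, x (-1)) = (x n, x (n - 1))"
proof (induction n rule: int_induct[where k = 0])
  case base
  then show ?case by simp
next
  case (step1 i)
  then show ?case using assms by (simp add: hiter_Suc prod_eq_iff fst_henon)
next
  case (step2 i)
  have "henon z (x (i - 1), x (i - 2)) = (x i, x (i - 1))"
    using assms(2)[of "i - 1"] by (simp add: prod_eq_iff fst_henon)
  then have "inv (henon z) (x i, x (i - 1)) = (x (i - 1), x (i - 2))"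
    using bij_henon[OF assms(1)] by (metis bij_inv_eq_iff)
  then show ?case using step2 assms(1) by (simp add: hiter_pred)
qed

text \<open>The way back from sequences to points: a solution produced by a fixed-point argument is
  the orbit of the point formed by its terms at \<open>0\<close> and \<open>-1\<close>.\<close>

lemma orb_of_recurrence:
  assumes "snd z \<noteq> 0" and "\<And>n. x (n + 1) = (x n)\<^sup>2 + fst z - snd z * x (n - 1)"
  shows "orb z (x 0, x (-1)) = x"
  using int_iter_of_recurrence[OF assms] by (simp add: orb_def fun_eq_iff)

section \<open>Bounded orbits and a priori bounds\<close>

lemma in_henon_K_iff_bounded:
  assumes "snd z \<noteq> 0"
  shows "p \<in> henon_K z \<longleftrightarrow> bounded (range (orb z p))"
proof
  assume "p \<in> henon_K z"
  then have "bounded (fst ` range (\<lambda>n. int_iter (henon z) n p))"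
    by (intro bounded_fst) (simp add: henon_K_def)
  then show "bounded (range (orb z p))" by (simp add: orb_def image_image)
next
  assume b: "bounded (range (orb z p))"
  have "bounded (range (orb z p) \<times> range (orb z p))" using b by (intro bounded_Times)
  then show "p \<in> henon_K z" unfolding henon_K_def mem_Collect_eq
    by (rule bounded_subset) (auto simp: int_iter_orb[OF assms])
qed

text \<open>No \<open>S\<close> above this value satisfies
  \<open>S\<^sup>2 \<le> cmod a + (1 + cmod b) * S\<close>. As an explicit continuous function of
  the parameter it bounds \<open>henon_K\<close> for all nearby parameters at once.\<close>

definition escape_radius :: "complex \<times> complex \<Rightarrow> real" where
  "escape_radius z = 1 + cmod (fst z) + cmod (snd z)"

lemma escape_radius_ge_1: "escape_radius z \<ge> 1"
  by (simp add: escape_radius_def)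

text \<open>Solving the recurrence for \<open>(x n)\<^sup>2\<close> bounds it by the neighbouring
  terms, and the supremum inherits a quadratic inequality. Both the crude
  \<open>escape_radius\<close> and the sharper bound on \<open>HOV\<close> are read off from
  it.\<close>

lemma bounded_recurrence_sup:
  fixes x :: "int \<Rightarrow> complex"
  assumes "\<And>n. x (n + 1) = (x n)\<^sup>2 + a - b * x (n - 1)" and "bounded (range x)"
  obtains S where "\<And>n. cmod (x n) \<le> S" "S\<^sup>2 \<le> cmod a + (1 + cmod b) * S" "0 \<le> S"
proof
  define S where "S = (SUP n. cmod (x n))"
  have bd: "bdd_above (range (\<lambda>n. cmod (x n)))"
    using assms(2) by (auto simp: bounded_iff bdd_above_def)
  show le: "cmod (x n) \<le> S" for n
    unfolding S_def by (intro cSUP_upper bd) simp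
  show S0: "0 \<le> S" using le[of 0] norm_ge_zero order_trans by blast
  have "(cmod (x n))\<^sup>2 \<le> cmod a + (1 + cmod b) * S" for n
  proof -
    have "(cmod (x n))\<^sup>2 = cmod (x (n + 1) - a + b * x (n - 1))"
      using assms(1)[of n] by (simp flip: norm_power)
    also have "\<dots> \<le> cmod (x (n + 1)) + cmod a + cmod b * cmod (x (n - 1))"
      by (metis (no_types) add_mono_thms_linordered_semiring(3) norm_mult norm_triangle_ineq norm_triangle_ineq4 order_trans)
    also have "\<dots> \<le> S + cmod a + cmod b * S"
      by (intro add_mono mult_left_mono le) auto
    finally show ?thesis by (simp add: algebra_simps)
  qed
  then have "cmod (x n) \<le> sqrt (cmod a + (1 + cmod b) * S)" for n
    by (simp add: real_le_rsqrt)
  then have "S \<le> sqrt (cmod a + (1 + cmod b) * S)"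
    unfolding S_def by (intro cSUP_least) auto
  then have "S\<^sup>2 \<le> (sqrt (cmod a + (1 + cmod b) * S))\<^sup>2"
    using S0 by (intro power_mono)
  then show "S\<^sup>2 \<le> cmod a + (1 + cmod b) * S"
    using S0 by simp
qed

lemma orb_le_escape_radius:
  assumes "snd z \<noteq> 0" "p \<in> henon_K z"
  shows "cmod (orb z p n) \<le> escape_radius z"
proof -
  obtain S where S: "\<And>n. cmod (orb z p n) \<le> S" "S\<^sup>2 \<le> cmod (fst z) + (1 + cmod (snd z)) * S" "0 \<le> S"
    using bounded_recurrence_sup[of "orb z p" "fst z" "snd z"] orb_rec assms in_henon_K_iff_bounded
    by metis
  have "S \<le> escape_radius z"
  proof (rule ccontr)
    assume "\<not> ?thesis"
    then have g: "S > escape_radius z" by simp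
    then have "S * escape_radius z < S * S"
      using escape_radius_ge_1[of z] by (intro mult_strict_left_mono) auto
    moreover have "cmod (fst z) * 1 \<le> cmod (fst z) * S"
      using g escape_radius_ge_1[of z] by (intro mult_left_mono) auto
    ultimately show False
      using S(2) by (simp add: escape_radius_def power2_eq_square algebra_simps)
  qed
  then show ?thesis using S(1)[of n] by linarith
qed

lemma in_henon_K_iff:
  assumes "snd z \<noteq> 0"
  shows "p \<in> henon_K z \<longleftrightarrow> (\<forall>n. cmod (orb z p n) \<le> escape_radius z)"
  using orb_le_escape_radius[OF assms] in_henon_K_iff_bounded[OF assms, of p]
  unfolding bounded_iff by blast

lemma in_henon_K_le:
  assumes "snd z \<noteq> 0" "\<And>n. cmod (orb z p n) \<le> B"
  shows "p \<in> henon_K z"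
  using assms by (auto simp: in_henon_K_iff_bounded bounded_iff)

lemma int_iter_in_henon_K:
  assumes "snd z \<noteq> 0" "p \<in> henon_K z"
  shows "int_iter (henon z) n p \<in> henon_K z"
  using assms by (simp add: in_henon_K_iff orb_int_iter)

lemma henon_in_henon_K: "snd z \<noteq> 0 \<Longrightarrow> p \<in> henon_K z \<Longrightarrow> henon z p \<in> henon_K z"
  using int_iter_in_henon_K[of z p 1] by simp

lemma henon_image_henon_K:
  assumes "snd z \<noteq> 0"
  shows "henon z ` henon_K z = henon_K z"
proof
  show "henon z ` henon_K z \<subseteq> henon_K z" using henon_in_henon_K[OF assms] by auto
  show "henon_K z \<subseteq> henon z ` henon_K z"
  proof
    fix p assume p: "p \<in> henon_K z"
    have "p = henon z (int_iter (henon z) (-1) p)"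
      using hiter_Suc[OF assms, of "-1" p] by simp
    then show "p \<in> henon z ` henon_K z" using int_iter_in_henon_K[OF assms p] by blast
  qed
qed

section \<open>Dependence on the parameter and compactness\<close>

lemma tendsto_henon:
  assumes "(Z \<longlongrightarrow> z) F" "(P \<longlongrightarrow> p) F"
  shows "((\<lambda>k. henon (Z k) (P k)) \<longlongrightarrow> henon z p) F"
proof -
  have "henon z p = ((fst p)\<^sup>2 + fst z - snd z * snd p, fst p)" for z p
    by (simp add: prod_eq_iff fst_henon)
  then show ?thesis using assms by (simp only:) (intro tendsto_intros)
qed

lemma tendsto_henon_inv:
  assumes "(Z \<longlongrightarrow> z) F" "(P \<longlongrightarrow> p) F" "snd z \<noteq> 0"
  shows "((\<lambda>k. henon_inv (Z k) (P k)) \<longlongrightarrow> henon_inv z p) F"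
proof -
  have "henon_inv z p = (snd p, ((snd p)\<^sup>2 + fst z - fst p) / snd z)" for z p
    by (cases z; cases p) simp
  then show ?thesis using assms by (simp only:) (intro tendsto_intros)
qed

lemma tendsto_int_iter_henon:
  assumes Z: "(Z \<longlongrightarrow> z) F" and P: "(P \<longlongrightarrow> p) F" and z: "snd z \<noteq> 0"
  shows "((\<lambda>k. int_iter (henon (Z k)) n (P k)) \<longlongrightarrow> int_iter (henon z) n p) F"
proof -
  have ev: "\<forall>\<^sub>F k in F. snd (Z k) \<noteq> 0"
    using tendsto_imp_eventually_ne[OF tendsto_snd[OF Z] z] .
  show ?thesis
  proof (induction n rule: int_induct[where k = 0])
    case base
    then show ?case using P by simp
  next
    case (step1 i)
    have "((\<lambda>k. henon (Z k) (int_iter (henon (Z k)) i (P k))) \<longlongrightarrow> int_iter (henon z) (i + 1) p) F"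
      using tendsto_henon[OF Z step1(2)] by (simp add: hiter_Suc[OF z])
    then show ?case
      by (rule Lim_transform_eventually) (use ev in \<open>auto elim!: eventually_mono simp: hiter_Suc\<close>)
  next
    case (step2 i)
    have "((\<lambda>k. henon_inv (Z k) (int_iter (henon (Z k)) i (P k))) \<longlongrightarrow> int_iter (henon z) (i - 1) p) F"
      using tendsto_henon_inv[OF Z step2(2) z] by (simp add: hiter_pred[OF z] inv_henon[OF z])
    then show ?case
      by (rule Lim_transform_eventually) (use ev in \<open>auto elim!: eventually_mono simp: hiter_pred inv_henon\<close>)
  qed
qed

lemma tendsto_orb:
  assumes "(Z \<longlongrightarrow> z) F" "(P \<longlongrightarrow> p) F" "snd z \<noteq> 0"
  shows "((\<lambda>k. orb (Z k) (P k) n) \<longlongrightarrow> orb z p n) F"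
  unfolding orb_def by (intro tendsto_fst tendsto_int_iter_henon assms)

text \<open>Membership is a family of closed conditions, one norm bound for each time, and both
  sides of each vary continuously with parameter and point.\<close>

lemma henon_K_limit:
  assumes Z: "Z \<longlonglongrightarrow> z" and P: "P \<longlonglongrightarrow> p" and z: "snd z \<noteq> 0"
    and K: "\<And>k. P k \<in> henon_K (Z k)"  and Z0: "\<And>k. snd (Z k) \<noteq> 0"
  shows "p \<in> henon_K z"
proof -
  have "cmod (orb z p n) \<le> escape_radius z" for n
  proof (rule LIMSEQ_le)
    show "(\<lambda>k. cmod (orb (Z k) (P k) n)) \<longlonglongrightarrow> cmod (orb z p n)"
      by (intro tendsto_norm tendsto_orb Z P z)
    show "(\<lambda>k. escape_radius (Z k)) \<longlonglongrightarrow> escape_radius z"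
      unfolding escape_radius_def by (intro tendsto_intros Z)
    show "\<exists>N. \<forall>k\<ge>N. cmod (orb (Z k) (P k) n) \<le> escape_radius (Z k)"
      using orb_le_escape_radius[OF Z0 K] by blast
  qed
  then show ?thesis by (simp add: in_henon_K_iff[OF z])
qed

lemma norm_le_escape_radius:
  assumes "snd z \<noteq> 0" "p \<in> henon_K z"
  shows "norm p \<le> 2 * escape_radius z"
proof -
  have "p = (orb z p 0, orb z p (-1))" using orb_0[OF assms(1)] by simp
  then have "norm p \<le> cmod (orb z p 0) + cmod (orb z p (-1))"
    by (metis norm_Pair_le)
  then show ?thesis using orb_le_escape_radius[OF assms, of 0] orb_le_escape_radius[OF assms, of "-1"]
    by linarith
qed

lemma compact_henon_K:
  assumes "snd z \<noteq> 0"
  shows "compact (henon_K z)"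
  unfolding compact_eq_bounded_closed
proof
  show "bounded (henon_K z)" using norm_le_escape_radius[OF assms] unfolding bounded_iff by blast
  show "closed (henon_K z)" unfolding closed_sequential_limits
    using henon_K_limit[OF tendsto_const _ assms] assms by blast
qed

lemma henon_K_seq_compact:
  assumes Z: "Z \<longlonglongrightarrow> z" and z: "snd z \<noteq> 0"
    and K: "\<And>k. P k \<in> henon_K (Z k)"  and Z0: "\<And>k. snd (Z k) \<noteq> 0"
  obtains p r where "strict_mono (r :: nat \<Rightarrow> nat)" "(P \<circ> r) \<longlonglongrightarrow> p" "p \<in> henon_K z"
proof -
  have "(\<lambda>k. escape_radius (Z k)) \<longlonglongrightarrow> escape_radius z"
    unfolding escape_radius_def by (intro tendsto_intros Z)
  then have "Bseq (\<lambda>k. escape_radius (Z k))" by (intro convergent_imp_Bseq convergentI)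
  then obtain B where B: "\<And>k. norm (escape_radius (Z k)) \<le> B" by (auto simp: Bseq_def)
  have "norm (P k) \<le> 2 * B" for k
    using norm_le_escape_radius[OF Z0 K, of k] B[of k] by simp
  then have "bounded (range P)" by (auto simp: bounded_iff)
  then obtain p r where r: "strict_mono (r :: nat \<Rightarrow> nat)" "(P \<circ> r) \<longlonglongrightarrow> p"
    using bounded_imp_convergent_subsequence by blast
  have "p \<in> henon_K z"
    by (rule henon_K_limit[OF LIMSEQ_subseq_LIMSEQ[OF Z r(1)] r(2) z]) (auto simp: K Z0)
  then show ?thesis using that r by blast
qed

section \<open>The linearised recurrence on bounded sequences\<close>

text \<open>The derivative of \<open>x (n + 1) - (x n)\<^sup>2 - a + b * x (n - 1)\<close> at the
  sequence \<open>c\<close> in direction \<open>u\<close>.\<close>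

definition lin_op :: "(int \<Rightarrow> complex) \<Rightarrow> complex \<Rightarrow> (int \<Rightarrow> complex) \<Rightarrow> int \<Rightarrow> complex" where
  "lin_op c b u n = u (n + 1) - 2 * c n * u n + b * u (n - 1)"

text \<open>\<open>lin_op c b\<close> is invertible on bounded sequences with sup norm, the inverse having norm at most \<open>M\<close>.\<close>

definition unif_inv :: "real \<Rightarrow> (int \<Rightarrow> complex) \<Rightarrow> complex \<Rightarrow> bool" where
  "unif_inv M c b \<longleftrightarrow> 0 < M \<and>
     (\<forall>u B. bounded (range u) \<longrightarrow> (\<forall>n. cmod (lin_op c b u n) \<le> B) \<longrightarrow> (\<forall>n. cmod (u n) \<le> M * B)) \<and>
     (\<forall>g. bounded (range g) \<longrightarrow> (\<exists>u. bounded (range u) \<and> lin_op c b u = g))"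

lemma unif_invD:
  assumes "unif_inv M c b"
  shows "0 < M"
    and "\<And>u B n. bounded (range u) \<Longrightarrow> (\<And>n. cmod (lin_op c b u n) \<le> B) \<Longrightarrow> cmod (u n) \<le> M * B"
    and "\<And>g. bounded (range g) \<Longrightarrow> \<exists>u. bounded (range u) \<and> lin_op c b u = g"
  using assms unfolding unif_inv_def by blast+

lemma lin_op_diff: "lin_op c b (\<lambda>n. u n - v n) n = lin_op c b u n - lin_op c b v n"
  by (simp add: lin_op_def algebra_simps)

lemma bounded_range_le: "(\<And>n. norm (u n) \<le> B) \<Longrightarrow> bounded (range u)"
  by (auto simp: bounded_iff)

lemma bounded_range_E:
  assumes "bounded (range u)"
  obtains B where "\<And>n. norm (u n) \<le> B" "0 \<le> B"
  using assms unfolding bounded_iff by (metis norm_ge_zero order_trans rangeI)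

lemma bounded_range_diff:
  fixes u v :: "int \<Rightarrow> 'a::real_normed_vector"
  assumes "bounded (range u)" "bounded (range v)"
  shows "bounded (range (\<lambda>n. u n - v n))"
proof -
  obtain B C where "\<And>n. norm (u n) \<le> B" "\<And>n. norm (v n) \<le> C"
    using assms bounded_range_E by metis
  then have "norm (u n - v n) \<le> B + C" for n
    by (meson add_mono norm_triangle_ineq4 order_trans)
  then show ?thesis by (rule bounded_range_le)
qed

text \<open>Inserting the supremum \<open>X\<close> of \<open>u\<close> gives
  \<open>X \<le> M * B + X / 2\<close>, and the last term is absorbed on the left. With
  \<open>B = 0\<close> this is a uniqueness principle.\<close>

lemma unif_inv_absorb:
  assumes "unif_inv M c b" and bu: "bounded (range u)"
    and step: "\<And>X n. (\<And>n. cmod (u n) \<le> X) \<Longrightarrow> cmod (lin_op c b u n) \<le> B + X / (2 * M)"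
  shows "cmod (u n) \<le> 2 * M * B"
proof -
  note M = unif_invD[OF assms(1)]
  define X where "X = (SUP n. cmod (u n))"
  have le: "cmod (u n) \<le> X" for n
    unfolding X_def by (intro cSUP_upper) (use bu in \<open>auto simp: bounded_iff bdd_above_def\<close>)
  have "cmod (u n) \<le> M * (B + X / (2 * M))" for n
    using M(2)[OF bu step[OF le]] .
  then have "X \<le> M * (B + X / (2 * M))"
    unfolding X_def by (intro cSUP_least) auto
  then have "X \<le> 2 * M * B" using M(1) by (simp add: field_simps)
  then show ?thesis using le[of n] by linarith
qed

text \<open>The library instance of \<open>complete_space\<close> needs a metric on the index type, which \<open>int\<close> lacks.\<close>

lemma complete_bounded_sequences: "complete (UNIV :: (int \<Rightarrow>\<^sub>C complex) set)"
proof (rule completeI)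
  fix f :: "nat \<Rightarrow> int \<Rightarrow>\<^sub>C complex" assume "Cauchy f"
  then have "\<forall>e>0. \<exists>N. \<forall>m n x. N \<le> m \<and> N \<le> n \<and> True \<longrightarrow>
      dist (apply_bcontfun (f m) x) (apply_bcontfun (f n) x) < e"
    unfolding Cauchy_def by (meson dist_fun_lt_imp_dist_val_lt)
  then obtain g where "uniform_limit UNIV (\<lambda>n. apply_bcontfun (f n)) g sequentially"
    using uniformly_convergent_eq_cauchy[of "\<lambda>_. True" "\<lambda>n. apply_bcontfun (f n)"]
    unfolding uniform_limit_sequentially_iff by auto
  from uniform_limit_bcontfunE[OF this sequentially_bot]
  obtain l where "f \<longlonglongrightarrow> l" by metis
  then show "\<exists>l\<in>UNIV. f \<longlonglongrightarrow> l" by blast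
qed

text \<open>Compose \<open>\<Phi>\<close> with a right inverse of norm at most \<open>M\<close>: the
  Lipschitz constant \<open>1 / (2 * M)\<close> becomes \<open>1/2\<close>, and together with the
  bound at 0 it gives values at most \<open>r / M\<close>, so the ball of radius \<open>r\<close> is
  mapped into itself.\<close>

lemma unif_inv_fixed_point:
  assumes inv: "unif_inv M c b" and r: "0 \<le> r"
    and lip: "\<And>u v d n. (\<And>n. cmod (u n) \<le> r) \<Longrightarrow> (\<And>n. cmod (v n) \<le> r) \<Longrightarrow>
               (\<And>n. cmod (u n - v n) \<le> d) \<Longrightarrow> cmod (\<Phi> u n - \<Phi> v n) \<le> d / (2 * M)"
    and zero: "\<And>n. cmod (\<Phi> (\<lambda>_. 0) n) \<le> r / (2 * M)"
  obtains u where "\<And>n. cmod (u n) \<le> r" "lin_op c b u = \<Phi> u"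
proof -
  note M = unif_invD[OF inv]
  obtain R where R: "\<And>g. bounded (range g) \<Longrightarrow> bounded (range (R g))"
      "\<And>g. bounded (range g) \<Longrightarrow> lin_op c b (R g) = g"
    using M(3) by metis
  define S where "S = cball (0 :: int \<Rightarrow>\<^sub>C complex) r"
  define T where "T f = Bcontfun (R (\<Phi> (apply_bcontfun f)))" for f :: "int \<Rightarrow>\<^sub>C complex"
  have Sle: "cmod (apply_bcontfun f n) \<le> r" if "f \<in> S" for f n
    using norm_bounded[of f n] that by (simp add: S_def)
  have \<Phi>le: "cmod (\<Phi> (apply_bcontfun f) n) \<le> r / M" if "f \<in> S" for f n
  proof -
    have "cmod (\<Phi> (apply_bcontfun f) n - \<Phi> (\<lambda>_. 0) n) \<le> r / (2 * M)"
      by (rule lip) (use Sle[OF that] r in auto)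
    then show ?thesis using zero[of n] norm_triangle_sub[of "\<Phi> (apply_bcontfun f) n" "\<Phi> (\<lambda>_. 0) n"]
      by (simp add: field_simps)
  qed
  have \<Phi>b: "bounded (range (\<Phi> (apply_bcontfun f)))" if "f \<in> S" for f
    using \<Phi>le[OF that] by (rule bounded_range_le)
  have T: "apply_bcontfun (T f) = R (\<Phi> (apply_bcontfun f))" if "f \<in> S" for f
    unfolding T_def by (rule Bcontfun_inverse) (simp add: bcontfun_def R(1)[OF \<Phi>b[OF that]])
  have "\<exists>!f\<in>S. T f = f"
  proof (rule Banach_fix)
    show "complete S" unfolding S_def by (rule complete_closed_subset[OF closed_cball subset_UNIV complete_bounded_sequences])
    show "S \<noteq> {}" using r by (auto simp: S_def)
    show "0 \<le> (1/2::real)" "(1/2::real) < 1" by auto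
    show "T ` S \<subseteq> S"
    proof clarify
      fix f assume f: "f \<in> S"
      have "cmod (T f n) \<le> M * (r / M)" for n
        unfolding T[OF f] by (rule M(2)) (simp_all add: R \<Phi>b f \<Phi>le)
      then show "T f \<in> S" using M(1) by (simp add: S_def norm_bound)
    qed
    fix f g assume f: "f \<in> S" and g: "g \<in> S"
    have "cmod (apply_bcontfun (T f) n - apply_bcontfun (T g) n) \<le> M * (dist f g / (2 * M))" for n
      unfolding T[OF f] T[OF g]
    proof (rule M(2))
      show "bounded (range (\<lambda>n. R (\<Phi> (apply_bcontfun f)) n - R (\<Phi> (apply_bcontfun g)) n))"
        by (intro bounded_range_diff R \<Phi>b f g)
      show "cmod (lin_op c b (\<lambda>n. R (\<Phi> (apply_bcontfun f)) n - R (\<Phi> (apply_bcontfun g)) n) n)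
              \<le> dist f g / (2 * M)" for n
        unfolding lin_op_diff R(2)[OF \<Phi>b[OF f]] R(2)[OF \<Phi>b[OF g]]
        by (rule lip) (use Sle f g dist_bounded[of f _ g] in \<open>auto simp: dist_norm\<close>)
    qed
    then have "dist (T f) (T g) \<le> M * (dist f g / (2 * M))"
      by (intro dist_bound) (simp add: dist_norm)
    then show "dist (T f) (T g) \<le> 1/2 * dist f g" using M(1) by simp
  qed
  then obtain f where f: "f \<in> S" "T f = f" by blast
  have "lin_op c b (apply_bcontfun f) = \<Phi> (apply_bcontfun f)"
    using R(2)[OF \<Phi>b[OF f(1)]] T[OF f(1)] f(2) by simp
  then show ?thesis using that Sle[OF f(1)] by blast
qed

text \<open>The 3 is made up of 2 from the coefficient \<open>2 * c n\<close> and 1 from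
  \<open>b\<close>.\<close>

lemma lin_op_perturb:
  assumes "\<And>n. cmod (c n - c' n) \<le> \<delta>" "cmod (b - b') \<le> \<delta>" "\<And>n. cmod (u n) \<le> X"
  shows "cmod (lin_op c b u n - lin_op c' b' u n) \<le> 3 * \<delta> * X"
proof -
  have d: "0 \<le> \<delta>" using assms(2) norm_ge_zero order_trans by blast
  have "lin_op c b u n - lin_op c' b' u n = (b - b') * u (n - 1) - 2 * ((c n - c' n) * u n)"
    by (simp add: lin_op_def algebra_simps)
  also have "cmod \<dots> \<le> cmod ((b - b') * u (n - 1)) + 2 * cmod ((c n - c' n) * u n)"
    by (rule order_trans[OF norm_triangle_ineq4]) (simp add: norm_mult)
  also have "cmod ((b - b') * u (n - 1)) \<le> \<delta> * X"
    unfolding norm_mult using assms d by (intro mult_mono) auto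
  also have "cmod ((c n - c' n) * u n) \<le> \<delta> * X"
    unfolding norm_mult using assms d by (intro mult_mono) auto
  finally show ?thesis by (simp add: algebra_simps)
qed

text \<open>The Neumann series argument: the perturbation has norm at most
  \<open>3 * \<delta>\<close>, which is at most \<open>1 / (2 * M)\<close>, half of what would
  endanger invertibility. Hence the inverse norm at most doubles.\<close>

lemma unif_inv_perturb:
  assumes inv: "unif_inv M c b" and c: "\<And>n. cmod (c n - c' n) \<le> \<delta>" and b: "cmod (b - b') \<le> \<delta>"
    and small: "6 * M * \<delta> \<le> 1"
  shows "unif_inv (2 * M) c' b'"
  unfolding unif_inv_def
proof (intro conjI allI impI)
  note M = unif_invD[OF inv]
  show "0 < 2 * M" using M(1) by simp
  have d: "3 * \<delta> * X \<le> X / (2 * M)" if "0 \<le> X" for X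
    using mult_right_mono[OF small that] M(1) by (simp add: field_simps)
  fix u :: "int \<Rightarrow> complex" and B n
  assume u: "bounded (range u)" and B: "\<forall>n. cmod (lin_op c' b' u n) \<le> B"
  show "cmod (u n) \<le> 2 * M * B"
  proof (rule unif_inv_absorb[OF inv u])
    fix X n assume X: "\<And>n. cmod (u n) \<le> X"
    have "0 \<le> X" using X[of 0] norm_ge_zero order_trans by blast
    moreover have "cmod (lin_op c b u n - lin_op c' b' u n) \<le> 3 * \<delta> * X"
      by (intro lin_op_perturb c b X)
    ultimately have "cmod (lin_op c b u n - lin_op c' b' u n) \<le> X / (2 * M)"
      using d[of X] by linarith
    then show "cmod (lin_op c b u n) \<le> B + X / (2 * M)"
      using spec[OF B, of n] norm_triangle_sub[of "lin_op c b u n" "lin_op c' b' u n"] by linarith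
  qed
next
  note M = unif_invD[OF inv]
  have d: "3 * \<delta> * X \<le> X / (2 * M)" if "0 \<le> X" for X
    using mult_right_mono[OF small that] M(1) by (simp add: field_simps)
  fix g :: "int \<Rightarrow> complex" assume "bounded (range g)"
  then obtain B where B: "\<And>n. cmod (g n) \<le> B" "0 \<le> B" using bounded_range_E by metis
  \<comment> \<open>Moving the perturbation to the right-hand side turns
    \<open>lin_op c' b' u = g\<close> into \<open>lin_op c b u = \<Phi> u\<close>.\<close>
  define \<Phi> where "\<Phi> u n = g n + (lin_op c b u n - lin_op c' b' u n)" for u n
  obtain u where u: "\<And>n. cmod (u n) \<le> 2 * M * B" "lin_op c b u = \<Phi> u"
  proof (rule unif_inv_fixed_point[OF inv])
    show "0 \<le> 2 * M * B" using M(1) B(2) by simp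
    show "cmod (\<Phi> (\<lambda>_. 0) n) \<le> 2 * M * B / (2 * M)" for n
      using M(1) B(1) by (simp add: \<Phi>_def lin_op_def)
    fix u v :: "int \<Rightarrow> complex" and e n assume e: "\<And>n. cmod (u n - v n) \<le> e"
    have "0 \<le> e" using e[of 0] norm_ge_zero order_trans by blast
    moreover have "\<Phi> u n - \<Phi> v n = lin_op c b (\<lambda>n. u n - v n) n - lin_op c' b' (\<lambda>n. u n - v n) n"
      by (simp add: \<Phi>_def lin_op_diff)
    moreover have "cmod (lin_op c b (\<lambda>n. u n - v n) n - lin_op c' b' (\<lambda>n. u n - v n) n) \<le> 3 * \<delta> * e"
      by (intro lin_op_perturb c b e)
    ultimately show "cmod (\<Phi> u n - \<Phi> v n) \<le> e / (2 * M)"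
      using d[of e] by simp
  qed (rule that)
  then show "\<exists>u. bounded (range u) \<and> lin_op c' b' u = g"
    by (intro exI[of _ u] conjI bounded_range_le) (auto simp: \<Phi>_def fun_eq_iff)
qed

text \<open>Conjugating \<open>lin_op\<close> by a slowly varying weight perturbs it slightly.\<close>

lemma unif_inv_weighted:
  assumes inv: "unif_inv M c b" and u: "bounded (range u)"
    and w: "\<And>n. 0 < w n" "bounded (range w)"
    and slow: "\<And>n. w n \<le> (1 + \<epsilon>) * w (n + 1)" "\<And>n. w (n + 1) \<le> (1 + \<epsilon>) * w n"
    and \<epsilon>: "0 \<le> \<epsilon>" "2 * M * (1 + cmod b) * \<epsilon> \<le> 1"
    and B: "\<And>n. w n * cmod (lin_op c b u n) \<le> B"
  shows "w n * cmod (u n) \<le> 2 * M * B"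
proof -
  note M = unif_invD[OF inv]
  define v where "v n = complex_of_real (w n) * u n" for n
  have vw: "cmod (v n) = w n * cmod (u n)" for n using w(1)[of n] by (simp add: v_def norm_mult)
  obtain W U where W: "\<And>n. norm (w n) \<le> W" "0 \<le> W" and U: "\<And>n. cmod (u n) \<le> U"
    using w(2) u bounded_range_E by metis
  have "cmod (v n) \<le> W * U" for n
    unfolding vw using W(1)[of n] W(2) U[of n] by (intro mult_mono) auto
  then have bv: "bounded (range v)" by (rule bounded_range_le)
  have "cmod (v n) \<le> 2 * M * B"
  proof (rule unif_inv_absorb[OF inv bv])
    fix X n assume X: "\<And>n. cmod (v n) \<le> X"
    have X0: "0 \<le> X" using X[of 0] norm_ge_zero order_trans by blast
    have diff: "\<bar>w n - w m\<bar> * cmod (u m) \<le> \<epsilon> * X" if "m = n + 1 \<or> n = m + 1" for m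
    proof -
      have "\<bar>w n - w m\<bar> \<le> \<epsilon> * w m"
      proof -
        have "w n \<le> (1 + \<epsilon>) * w m" "w m \<le> (1 + \<epsilon>) * w n"
          using slow that by auto
        moreover have "w m - w n \<le> \<epsilon> * w m"
        proof (cases "w n \<le> w m")
          case True
          then have "\<epsilon> * w n \<le> \<epsilon> * w m" using \<epsilon> by (simp add: mult_left_mono)
          then show ?thesis using \<open>w m \<le> (1 + \<epsilon>) * w n\<close> by (simp add: algebra_simps)
        next
          case False
          then show ?thesis using \<epsilon> w(1)[of m] by (smt (verit) mult_nonneg_nonneg)
        qed
        ultimately show ?thesis by (simp add: algebra_simps abs_le_iff)
      qed
      then have "\<bar>w n - w m\<bar> * cmod (u m) \<le> \<epsilon> * w m * cmod (u m)" by (simp add: mult_right_mono)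
      also have "\<dots> \<le> \<epsilon> * X" using X[of m] \<epsilon> by (simp add: vw mult.assoc mult_left_mono)
      finally show ?thesis .
    qed
    \<comment> \<open>The subtracted bracket is the commutator of \<open>lin_op\<close> with
      multiplication by the weight; slow variation bounds it by
      \<open>\<epsilon> * (1 + cmod b) * X\<close>.\<close>
    have "lin_op c b v n = of_real (w n) * lin_op c b u n
        - (of_real (w n - w (n + 1)) * u (n + 1) + b * (of_real (w n - w (n - 1)) * u (n - 1)))"
      by (simp add: lin_op_def v_def algebra_simps)
    also have "cmod \<dots> \<le> cmod (of_real (w n) * lin_op c b u n)
        + (cmod (of_real (w n - w (n + 1)) * u (n + 1)) + cmod (b * (of_real (w n - w (n - 1)) * u (n - 1))))"
      by (meson norm_triangle_ineq norm_triangle_ineq4 add_left_mono order_trans)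
    also have "\<dots> \<le> B + (\<epsilon> * X + cmod b * (\<epsilon> * X))"
      unfolding norm_mult norm_of_real
      by (intro add_mono mult_left_mono diff)
        (use B[of n] w(1)[of n] in auto)
    also have "\<epsilon> * X + cmod b * (\<epsilon> * X) \<le> X / (2 * M)"
      using mult_right_mono[OF \<epsilon>(2) X0] M(1) by (simp add: field_simps)
    finally show "cmod (lin_op c b v n) \<le> B + X / (2 * M)" by simp
  qed
  then show ?thesis by (simp add: vw)
qed

section \<open>Continuation of orbits\<close>

definition unif_inv_on :: "real \<Rightarrow> complex \<times> complex \<Rightarrow> bool" where
  "unif_inv_on M z \<longleftrightarrow> (\<forall>p\<in>henon_K z. unif_inv M (orb z p) (snd z))"

text \<open>The difference of two orbits solves the linearised recurrence along \<open>x\<close> up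
  to a factor of size at most \<open>2 * r\<close> times itself, so absorption forces it to vanish.
  Since \<open>x\<close> need not be an orbit of \<open>z'\<close>, the lemma yields both uniqueness
  of the continued orbit and injectivity of continuation.\<close>

lemma orbit_near_unique:
  assumes z': "snd z' \<noteq> 0" and inv: "unif_inv M x (snd z')" and r: "4 * M * r \<le> 1"
    and p: "\<And>n. cmod (x n - orb z' p n) \<le> r" and q: "\<And>n. cmod (x n - orb z' q n) \<le> r"
  shows "p = q"
proof -
  note M = unif_invD[OF inv]
  define w where "w n = orb z' p n - orb z' q n" for n
  have "cmod (w n) \<le> 2 * r" for n
    using norm_triangle_ineq4[of "x n - orb z' q n" "x n - orb z' p n"] p[of n] q[of n]
    by (simp add: w_def)
  then have bw: "bounded (range w)" by (rule bounded_range_le)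
  have "cmod (w n) \<le> 2 * M * 0" for n
  proof (rule unif_inv_absorb[OF inv bw])
    fix X n assume X: "\<And>n. cmod (w n) \<le> X"
    have "0 \<le> X" using X[of 0] norm_ge_zero order_trans by blast
    have "lin_op x (snd z') w n = - w n * ((x n - orb z' p n) + (x n - orb z' q n))"
      unfolding lin_op_def w_def orb_rec[OF z'] by (simp add: algebra_simps power2_eq_square)
    also have "cmod \<dots> \<le> X * (r + r)"
      unfolding norm_mult norm_minus_cancel using \<open>0 \<le> X\<close> X[of n] p[of n] q[of n]
      by (intro mult_mono order_trans[OF norm_triangle_ineq] add_mono) auto
    also have "\<dots> \<le> 0 + X / (2 * M)"
      using mult_left_mono[OF r \<open>0 \<le> X\<close>] M(1) by (simp add: field_simps)
    finally show "cmod (lin_op x (snd z') w n) \<le> 0 + X / (2 * M)" .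
  qed
  then have "orb z' p n = orb z' q n" for n by (simp add: w_def)
  then show ?thesis by (metis orb_0[OF z'])
qed

text \<open>With \<open>x\<close> the old orbit, \<open>x + u\<close> is an orbit of
  \<open>z'\<close> exactly when \<open>lin_op x (snd z') u = u\<^sup>2 + e\<close>, where
  \<open>e\<close> is the defect of \<open>x\<close> in the new recurrence. The inverse now has norm
  \<open>2 * M\<close>, so the contraction needs \<open>2 * r\<close> and
  \<open>cmod (e n) / r\<close> to be at most \<open>1 / (4 * M)\<close>; these are the two
  smallness hypotheses on \<open>r\<close>.\<close>

lemma orbit_continuation:
  assumes z: "snd z \<noteq> 0" and z': "snd z' \<noteq> 0" and p: "p \<in> henon_K z"
    and inv: "unif_inv M (orb z p) (snd z)" and r: "0 \<le> r" "8 * M * r \<le> 1"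
    and b: "6 * M * cmod (snd z - snd z') \<le> 1"
    and ab: "4 * M * (cmod (fst z' - fst z) + cmod (snd z' - snd z) * escape_radius z) \<le> r"
  obtains p' where "p' \<in> henon_K z'" "\<And>n. cmod (orb z p n - orb z' p' n) \<le> r"
proof -
  note M = unif_invD[OF inv]
  define x where "x = orb z p"
  have xle: "cmod (x n) \<le> escape_radius z" for n using orb_le_escape_radius[OF z p] by (simp add: x_def)
  have inv': "unif_inv (2 * M) x (snd z')"
    using unif_inv_perturb[OF inv _ order_refl b] by (simp add: x_def)
  define e where "e n = (fst z' - fst z) - (snd z' - snd z) * x (n - 1)" for n
  have ele: "cmod (e n) \<le> r / (2 * (2 * M))" for n
  proof -
    have "cmod (e n) \<le> cmod (fst z' - fst z) + cmod (snd z' - snd z) * escape_radius z"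
      unfolding e_def by (intro order_trans[OF norm_triangle_ineq4] add_left_mono)
        (simp add: norm_mult mult_left_mono xle)
    then have "4 * M * cmod (e n) \<le> r" using ab M(1) by (smt (verit) mult_left_mono)
    then show ?thesis using M(1) by (simp add: field_simps)
  qed
  obtain u where u: "\<And>n. cmod (u n) \<le> r" "lin_op x (snd z') u = (\<lambda>n. (u n)\<^sup>2 + e n)"
  proof (rule unif_inv_fixed_point[OF inv' r(1), where \<Phi> = "\<lambda>u n. (u n)\<^sup>2 + e n"])
    show "cmod (0\<^sup>2 + e n) \<le> r / (2 * (2 * M))" for n using ele by simp
    fix u v :: "int \<Rightarrow> complex" and d n
    assume u: "\<And>n. cmod (u n) \<le> r" and v: "\<And>n. cmod (v n) \<le> r" and d: "\<And>n. cmod (u n - v n) \<le> d"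
    have "0 \<le> d" using d[of 0] norm_ge_zero order_trans by blast
    have "(u n)\<^sup>2 + e n - ((v n)\<^sup>2 + e n) = (u n - v n) * (u n + v n)"
      by (simp add: power2_eq_square algebra_simps)
    also have "cmod \<dots> \<le> d * (r + r)"
      unfolding norm_mult using \<open>0 \<le> d\<close> u[of n] v[of n] d[of n]
      by (intro mult_mono order_trans[OF norm_triangle_ineq] add_mono) auto
    also have "\<dots> \<le> d / (2 * (2 * M))"
      using mult_left_mono[OF r(2) \<open>0 \<le> d\<close>] M(1) by (simp add: field_simps)
    finally show "cmod ((u n)\<^sup>2 + e n - ((v n)\<^sup>2 + e n)) \<le> d / (2 * (2 * M))" .
  qed (rule that)
  define y where "y n = x n + u n" for n
  have rec: "y (n + 1) = (y n)\<^sup>2 + fst z' - snd z' * y (n - 1)" for n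
  proof -
    have "u (n + 1) = (u n)\<^sup>2 + e n + 2 * x n * u n - snd z' * u (n - 1)"
      using fun_cong[OF u(2), of n] by (simp add: lin_op_def algebra_simps)
    then show ?thesis
      unfolding y_def x_def orb_rec[OF z]
      by (simp add: e_def x_def power2_eq_square algebra_simps)
  qed
  define p' where "p' = (y 0, y (-1))"
  have orb: "orb z' p' = y" unfolding p'_def by (rule orb_of_recurrence[OF z' rec])
  have near: "cmod (orb z p n - orb z' p' n) \<le> r" for n
    using u(1)[of n] by (simp add: orb y_def x_def)
  have "cmod (y n) \<le> escape_radius z + r" for n
    unfolding y_def by (intro order_trans[OF norm_triangle_ineq] add_mono xle u)
  then have "p' \<in> henon_K z'" using in_henon_K_le[OF z'] by (metis orb)
  then show ?thesis using that near by blast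
qed

section \<open>Hyperbolicity and the linearised recurrence\<close>

definition tangent :: "complex \<times> complex \<Rightarrow> int \<Rightarrow> complex \<times> complex \<Rightarrow> complex \<times> complex \<Rightarrow> complex \<times> complex" where
  "tangent z n p = frechet_derivative (int_iter (henon z) n) (at p)"

lemma henon_has_derivative:
  "(henon z has_derivative (\<lambda>v. (2 * fst p * fst v - snd z * snd v, fst v))) (at p)"
proof -
  have eq: "henon z = (\<lambda>p. ((fst p)\<^sup>2 + fst z - snd z * snd p, fst p))"
    by (simp add: fun_eq_iff prod_eq_iff fst_henon)
  show ?thesis unfolding eq
    by (auto intro!: derivative_eq_intros)
qed

lemma henon_inv_differentiable: "henon_inv z differentiable at p"
proof -
  have eq: "henon_inv z = (\<lambda>p. (snd p, ((snd p)\<^sup>2 + fst z - fst p) * inverse (snd z)))"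
    by (cases z) (auto simp: fun_eq_iff divide_inverse)
  have "((\<lambda>p. (snd p, ((snd p)\<^sup>2 + fst z - fst p) * inverse (snd z))) has_derivative
      (\<lambda>v. (snd v, (2 * snd p * snd v - fst v) * inverse (snd z)))) (at p)"
    by (auto intro!: derivative_eq_intros)
  then show ?thesis unfolding eq by (rule differentiableI)
qed

lemma int_iter_henon_differentiable:
  assumes z: "snd z \<noteq> 0"
  shows "int_iter (henon z) n differentiable at p"
proof (induction n rule: int_induct[where k = 0])
  case base
  have "int_iter (henon z) 0 = (\<lambda>p. p)" by (simp add: fun_eq_iff)
  then show ?case by simp
next
  case (step1 i)
  have "int_iter (henon z) (i + 1) = henon z \<circ> int_iter (henon z) i"
    by (simp add: fun_eq_iff hiter_Suc[OF z])
  then show ?case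
    using differentiable_chain_at[OF step1(2)] henon_has_derivative differentiableI by metis
next
  case (step2 i)
  have "int_iter (henon z) (i - 1) = henon_inv z \<circ> int_iter (henon z) i"
    by (simp add: fun_eq_iff hiter_pred[OF z] inv_henon[OF z])
  then show ?case
    using differentiable_chain_at[OF step2(2)] henon_inv_differentiable by metis
qed

lemma tangent_has_derivative:
  "snd z \<noteq> 0 \<Longrightarrow> (int_iter (henon z) n has_derivative tangent z n p) (at p)"
  unfolding tangent_def using int_iter_henon_differentiable frechet_derivative_works by blast

lemma bounded_linear_tangent: "snd z \<noteq> 0 \<Longrightarrow> bounded_linear (tangent z n p)"
  using tangent_has_derivative has_derivative_bounded_linear by blast

lemma linear_tangent: "snd z \<noteq> 0 \<Longrightarrow> linear (tangent z n p)"
  using bounded_linear_tangent bounded_linear.linear by blast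

lemma tangent_0 [simp]: "tangent z 0 p v = v"
proof -
  have "int_iter (henon z) 0 = (\<lambda>p. p)" by (simp add: fun_eq_iff)
  then show ?thesis by (simp add: tangent_def)
qed

lemma tangent_1: "tangent z 1 p v = (2 * fst p * fst v - snd z * snd v, fst v)"
  by (simp add: tangent_def frechet_derivative_at[OF henon_has_derivative[of z p], symmetric])

lemma tangent_add:
  assumes z: "snd z \<noteq> 0"
  shows "tangent z (m + n) p v = tangent z m (int_iter (henon z) n p) (tangent z n p v)"
proof -
  have "int_iter (henon z) (m + n) = int_iter (henon z) m \<circ> int_iter (henon z) n"
    by (simp add: fun_eq_iff hiter_add[OF z])
  moreover have "(int_iter (henon z) m \<circ> int_iter (henon z) n has_derivative
      tangent z m (int_iter (henon z) n p) \<circ> tangent z n p) (at p)"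
    by (intro diff_chain_at tangent_has_derivative z)
  ultimately show ?thesis
    using frechet_derivative_at unfolding tangent_def by (metis comp_apply)
qed

lemma tangent_inverse:
  assumes "snd z \<noteq> 0"
  shows "tangent z (- n) (int_iter (henon z) n p) (tangent z n p v) = v"
  using tangent_add[OF assms, of "- n" n p v] by simp

lemma tangent_inverse':
  assumes "snd z \<noteq> 0"
  shows "tangent z n (int_iter (henon z) (- n) p) (tangent z (- n) p v) = v"
  using tangent_add[OF assms, of n "- n" p v] by simp

lemma tangent_Suc:
  assumes "snd z \<noteq> 0"
  shows "tangent z (n + 1) p v = tangent z 1 (int_iter (henon z) n p) (tangent z n p v)"
  using tangent_add[OF assms, of 1 n p v] by (simp add: add.commute)

definition tseq :: "complex \<times> complex \<Rightarrow> complex \<times> complex \<Rightarrow> complex \<times> complex \<Rightarrow> int \<Rightarrow> complex" where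
  "tseq z p v n = fst (tangent z n p v)"

lemma tangent_tseq:
  assumes "snd z \<noteq> 0"
  shows "tangent z n p v = (tseq z p v n, tseq z p v (n - 1))"
  using tangent_Suc[OF assms, of "n - 1" p v] by (simp add: tseq_def prod_eq_iff tangent_1)

lemma lin_op_tseq:
  assumes "snd z \<noteq> 0"
  shows "lin_op (orb z p) (snd z) (tseq z p v) n = 0"
proof -
  have "tseq z p v (n + 1) = 2 * orb z p n * tseq z p v n - snd z * tseq z p v (n - 1)"
    using tangent_Suc[OF assms, of n p v] unfolding tangent_tseq[OF assms, of "n + 1"] 
    by (simp add: tangent_1 tangent_tseq[OF assms, of n] orb_def)
  then show ?thesis unfolding lin_op_def by simp
qed

text \<open>Converse of \<open>lin_op_tseq\<close>: kernel elements of \<open>lin_op\<close> are the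
  same as tangent orbits, so bounded kernel elements are bounded tangent orbits.\<close>

lemma tangent_of_lin_op:
  assumes z: "snd z \<noteq> 0" and e: "\<And>n. lin_op (orb z p) (snd z) e n = 0"
  shows "tangent z n p (e 0, e (-1)) = (e n, e (n - 1))"
proof -
  have step: "tangent z 1 (int_iter (henon z) n p) (e n, e (n - 1)) = (e (n + 1), e n)" for n
    using e[of n] by (simp add: tangent_1 lin_op_def orb_def[symmetric] algebra_simps)
  show ?thesis
  proof (induction n rule: int_induct[where k = 0])
    case base
    then show ?case by simp
  next
    case (step1 i)
    then show ?case using step[of i] by (simp add: tangent_Suc[OF z])
  next
    case (step2 i)
    have "tangent z i p (e 0, e (-1)) = tangent z 1 (int_iter (henon z) (i - 1) p) (e (i - 1), e (i - 2))"
      using step2 step[of "i - 1"] by simp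
    then have "tangent z (-1) (int_iter (henon z) i p) (tangent z i p (e 0, e (-1))) = (e (i - 1), e (i - 2))"
      using tangent_inverse[OF z, of 1 "int_iter (henon z) (i - 1) p"] hiter_Suc[OF z, of "i - 1" p] by simp
    then show ?case using tangent_add[OF z, of "-1" i p] by simp
  qed
qed

section \<open>Equivalence of a hyperbolic splitting with a uniformly bounded inverse\<close>

lemma hyperbolic_set_henon_iff:
  assumes z: "snd z \<noteq> 0"
  shows "hyperbolic_set (henon z) (henon_K z) \<longleftrightarrow>
     (\<exists>Es Eu C \<mu>. 0 < C \<and> 0 < \<mu> \<and> \<mu> < 1 \<and>
       (\<forall>p\<in>henon_K z.
          subspace (Es p) \<and> subspace (Eu p) \<and>
          Es p \<inter> Eu p = {0} \<and> {u + v |u v. u \<in> Es p \<and> v \<in> Eu p} = UNIV \<and>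
          tangent z 1 p ` Es p = Es (henon z p) \<and> tangent z 1 p ` Eu p = Eu (henon z p) \<and>
          (\<forall>n. \<forall>v\<in>Es p. norm (tangent z (int n) p v) \<le> C * \<mu> ^ n * norm v) \<and>
          (\<forall>n. \<forall>v\<in>Eu p. norm (tangent z (- int n) p v) \<le> C * \<mu> ^ n * norm v)))"
  unfolding hyperbolic_set_def tangent_def int_iter_of_nat int_iter_neg_of_nat int_iter_1
  using compact_henon_K[OF z] henon_image_henon_K[OF z] by simp

text \<open>One half of the Green's function of a dichotomy: \<open>T k n\<close> carries a vector
  from time \<open>n - k\<close> to time \<open>n\<close>, and the forcing \<open>w\<close> is
  summed over the past. It serves the stable part directly and the unstable part in reversed
  time.\<close>

lemma green_sum:
  fixes A :: "int \<Rightarrow> 'a::banach \<Rightarrow> 'a"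
  assumes lin: "\<And>n. bounded_linear (A n)"
    and T: "\<And>n v. T 0 n v = v" "\<And>k n v. T (Suc k) (n + 1) v = A n (T k n v)"
    and le: "\<And>k n. norm (T k n (w (n - int k))) \<le> c * \<mu> ^ k" and \<mu>: "0 \<le> \<mu>" "\<mu> < 1"
  defines "S \<equiv> \<lambda>n. \<Sum>k. T k n (w (n - int k))"
  shows "S (n + 1) = w (n + 1) + A n (S n)" and "norm (S n) \<le> c / (1 - \<mu>)"
proof -
  have geo: "(\<lambda>k. c * \<mu> ^ k) sums (c / (1 - \<mu>))"
    using sums_mult[OF geometric_sums[of \<mu>], of c] \<mu> by simp
  have sn: "summable (\<lambda>k. norm (T k n (w (n - int k))))" for n
    by (rule summable_comparison_test'[OF sums_summable[OF geo]]) (use le in auto)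
  note s = summable_norm_cancel[OF sn]
  have "S (n + 1) = T 0 (n + 1) (w (n + 1)) + (\<Sum>k. T (Suc k) (n + 1) (w (n + 1 - int (Suc k))))"
    unfolding S_def using suminf_split_head[OF s[of "n + 1"]] by (simp add: algebra_simps)
  also have "\<dots> = w (n + 1) + (\<Sum>k. A n (T k n (w (n - int k))))"
    by (simp add: T)
  also have "(\<Sum>k. A n (T k n (w (n - int k)))) = A n (S n)"
    unfolding S_def using bounded_linear.suminf[OF lin s] by simp
  finally show "S (n + 1) = w (n + 1) + A n (S n)" .
  have "norm (S n) \<le> (\<Sum>k. norm (T k n (w (n - int k))))"
    unfolding S_def by (rule summable_norm[OF sn])
  also have "\<dots> \<le> (\<Sum>k. c * \<mu> ^ k)" by (intro suminf_le le sn sums_summable[OF geo])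
  also have "\<dots> = c / (1 - \<mu>)" using geo by (rule sums_unique[symmetric])
  finally show "norm (S n) \<le> c / (1 - \<mu>)" .
qed

lemma norm_tangent_1_le:
  assumes "cmod (fst p) \<le> R"
  shows "norm (tangent z 1 p v) \<le> (2 * R + cmod (snd z) + 1) * norm v"
proof -
  have R: "0 \<le> R" using assms norm_ge_zero order_trans by blast
  have "norm (tangent z 1 p v) \<le> cmod (2 * fst p * fst v - snd z * snd v) + cmod (fst v)"
    unfolding tangent_1 by (rule norm_Pair_le)
  also have "\<dots> \<le> cmod (2 * fst p * fst v) + cmod (snd z * snd v) + cmod (fst v)"
    by (intro add_right_mono norm_triangle_ineq4)
  also have "\<dots> \<le> 2 * R * norm v + cmod (snd z) * norm v + norm v"
    unfolding norm_mult using assms R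
    using norm_fst_le[of "fst v" "snd v"] norm_snd_le[of "snd v" "fst v"]
    by (intro add_mono mult_mono) auto
  finally show ?thesis by (simp add: algebra_simps)
qed

text \<open>In the plane, \<open>lin_op u = g\<close> becomes a first-order equation driven by the
  derivative. Its bounded solution sums the stable part of the forcing over the past and the
  unstable part over the future; it is unique because a bounded tangent orbit is zero.\<close>

lemma hyperbolic_imp_unif_inv_on:
  assumes z: "snd z \<noteq> 0" and hyp: "hyperbolic_set (henon z) (henon_K z)"
  obtains M where "unif_inv_on M z" "0 < M"
proof -
  let ?F = "int_iter (henon z)" and ?K = "henon_K z"
  obtain Es Eu C \<mu> where C: "0 < C" and \<mu>: "0 < \<mu>" "\<mu> < 1"
    and E: "\<forall>p\<in>?K.
          subspace (Es p) \<and> subspace (Eu p) \<and>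
          Es p \<inter> Eu p = {0} \<and> {u + v |u v. u \<in> Es p \<and> v \<in> Eu p} = UNIV \<and>
          tangent z 1 p ` Es p = Es (henon z p) \<and> tangent z 1 p ` Eu p = Eu (henon z p) \<and>
          (\<forall>n. \<forall>v\<in>Es p. norm (tangent z (int n) p v) \<le> C * \<mu> ^ n * norm v) \<and>
          (\<forall>n. \<forall>v\<in>Eu p. norm (tangent z (- int n) p v) \<le> C * \<mu> ^ n * norm v)"
    using hyp unfolding hyperbolic_set_henon_iff[OF z] by (elim exE conjE) (rule that)
  have UN: "{u + v |u v. u \<in> Es p \<and> v \<in> Eu p} = UNIV" if "p \<in> ?K" for p
    using bspec[OF E that] by (elim conjE)
  have inv1: "tangent z 1 p ` Es p = Es (henon z p)" "tangent z 1 p ` Eu p = Eu (henon z p)"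
    if "p \<in> ?K" for p
    using bspec[OF E that] by blast+
  have dec: "v \<in> Es p \<Longrightarrow> norm (tangent z (int n) p v) \<le> C * \<mu> ^ n * norm v"
    "v \<in> Eu p \<Longrightarrow> norm (tangent z (- int n) p v) \<le> C * \<mu> ^ n * norm v" if "p \<in> ?K" for p n v
    using bspec[OF E that] by blast+
  have FK: "?F n p \<in> ?K" if "p \<in> ?K" for n p using int_iter_in_henon_K[OF z that] .
  have inv: "tangent z n p v \<in> E (?F n p)"
    if E: "\<And>p. p \<in> ?K \<Longrightarrow> tangent z 1 p ` E p = E (henon z p)" and p: "p \<in> ?K" "v \<in> E p" for E n p v
  proof (induction n rule: int_induct[where k = 0])
    case base
    then show ?case using p by simp
  next
    case (step1 i)
    then show ?case using E[OF FK[OF p(1)], of i] tangent_Suc[OF z, of i p v] hiter_Suc[OF z, of i p] by auto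
  next
    case (step2 i)
    have F: "?F i p = henon z (?F (i - 1) p)" using hiter_Suc[OF z, of "i - 1" p] by simp
    obtain t where t: "t \<in> E (?F (i - 1) p)" "tangent z i p v = tangent z 1 (?F (i - 1) p) t"
      using step2(2) E[OF FK[OF p(1)], of "i - 1"] unfolding F by (metis imageE)
    have "tangent z (i - 1) p v = tangent z (-1) (?F i p) (tangent z i p v)"
      using tangent_add[OF z, of "-1" i p v] by simp
    also have "\<dots> = t" using tangent_inverse[OF z, of 1 "?F (i - 1) p" t] unfolding t(2) F by simp
    finally show ?case using t(1) by simp
  qed
  have invs: "tangent z n p v \<in> Es (?F n p)" if "p \<in> ?K" "v \<in> Es p" for n p v
    using inv1(1) that by (rule inv)
  have invu: "tangent z n p v \<in> Eu (?F n p)" if "p \<in> ?K" "v \<in> Eu p" for n p v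
    using inv1(2) that by (rule inv)
  define \<Lambda> where "\<Lambda> = 2 * escape_radius z + cmod (snd z) + 1"
  have \<Lambda>1: "1 \<le> \<Lambda>" using escape_radius_ge_1[of z] by (simp add: \<Lambda>_def)
  have t1: "norm (tangent z 1 p v) \<le> \<Lambda> * norm v" if "p \<in> ?K" for p v
    unfolding \<Lambda>_def using orb_le_escape_radius[OF z that, of 0]
    by (intro norm_tangent_1_le) (simp add: orb_def)
  have tn: "norm (tangent z (int n) p v) \<le> \<Lambda> ^ n * norm v" if p: "p \<in> ?K" for n p v
  proof (induction n)
    case (Suc n)
    have "norm (tangent z (int n + 1) p v) \<le> \<Lambda> * norm (tangent z (int n) p v)"
      unfolding tangent_Suc[OF z] by (rule t1[OF FK[OF p]])
    also have "\<dots> \<le> \<Lambda> * (\<Lambda> ^ n * norm v)" using Suc \<Lambda>1 by (intro mult_left_mono) auto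
    finally show ?case by (simp add: add.commute mult.assoc)
  qed simp
  have "(\<lambda>n. C * \<mu> ^ n) \<longlonglongrightarrow> C * 0" using \<mu> by (intro tendsto_intros LIMSEQ_power_zero) auto
  then have "\<forall>\<^sub>F n in sequentially. C * \<mu> ^ n < 1/2" by (rule order_tendstoD) simp
  then obtain m where m: "C * \<mu> ^ m < 1/2" using eventually_happens by fastforce
  define Q where "Q = \<Lambda> ^ m + 2"
  have Q0: "0 \<le> Q" using \<Lambda>1 by (simp add: Q_def)
  \<comment> \<open>\<open>hyperbolic_set\<close> gives no angle bound directly, so it is extracted
    from the estimates: in \<open>m\<close> steps a nonzero unstable vector more than doubles and a
    stable one shrinks to at most half, while the image of the sum grows by at most
    \<open>\<Lambda> ^ m\<close>.\<close>
  have angle: "norm s \<le> Q * norm (s + u) \<and> norm u \<le> Q * norm (s + u)"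
    if p: "p \<in> ?K" and s: "s \<in> Es p" and u: "u \<in> Eu p" for p s u
  proof -
    let ?N = "norm (tangent z (int m) p u)"
    have su: "norm s \<le> norm (s + u) + norm u" using norm_triangle_ineq4[of "s + u" u] by simp
    have "norm u = norm (tangent z (- int m) (?F (int m) p) (tangent z (int m) p u))"
      by (simp add: tangent_inverse[OF z])
    also have "\<dots> \<le> C * \<mu> ^ m * ?N" by (intro dec FK p invu u)
    also have "\<dots> \<le> 1/2 * ?N" using m by (intro mult_right_mono) auto
    also have "?N = norm (tangent z (int m) p (s + u) - tangent z (int m) p s)"
      by (simp add: linear_add[OF linear_tangent[OF z]])
    also have "\<dots> \<le> \<Lambda> ^ m * norm (s + u) + C * \<mu> ^ m * norm s"
      by (intro order_trans[OF norm_triangle_ineq4] add_mono tn dec p s)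
    also have "C * \<mu> ^ m * norm s \<le> 1/2 * norm s" using m by (intro mult_right_mono) auto
    finally have "norm u \<le> 1/2 * (\<Lambda> ^ m * norm (s + u) + 1/2 * norm s)" by simp
    moreover have "0 \<le> \<Lambda> ^ m * norm (s + u)" "0 \<le> norm (s + u)" using \<Lambda>1 by simp_all
    moreover have "x \<le> X + N" if "x \<le> 1/2 * (X + 1/2 * y)" "y \<le> N + x" "0 \<le> X" "0 \<le> N" for x y X N :: real
      using that by (simp add: field_simps)
    ultimately have "norm u \<le> \<Lambda> ^ m * norm (s + u) + norm (s + u)" using su by blast
    then show ?thesis using su norm_ge_zero[of "s + u"] unfolding Q_def ring_distribs
      by (intro conjI) linarith+
  qed
  obtain Ps where Ps: "\<And>p v. p \<in> ?K \<Longrightarrow> Ps p v \<in> Es p \<and> v - Ps p v \<in> Eu p"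
  proof -
    have "\<exists>s. s \<in> Es p \<and> v - s \<in> Eu p" if p: "p \<in> ?K" for p v
    proof -
      have "v \<in> {u + v |u v. u \<in> Es p \<and> v \<in> Eu p}" using UN[OF p] by simp
      then obtain s u where "s \<in> Es p" "u \<in> Eu p" "v = s + u" by blast
      then show ?thesis by (intro exI[of _ s]) simp
    qed
    then show ?thesis using that by metis
  qed
  \<comment> \<open>Two geometric series contribute \<open>C * Q / (1 - \<mu>)\<close> each, the
    separate unstable term contributes \<open>Q\<close>, and the final 1 secures positivity.\<close>
  define M where "M = (2 * C / (1 - \<mu>) + 1) * Q + 1"
  have M0: "0 < M" using C \<mu> Q0 by (simp add: M_def add_nonneg_pos)
  have ex: "\<exists>u. (\<forall>n. cmod (u n) \<le> M * B) \<and> lin_op (orb z p) (snd z) u = g"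
    if p: "p \<in> ?K" and g: "\<And>n. cmod (g n) \<le> B" for p g B
  proof -
    have B0: "0 \<le> B" using g[of 0] norm_ge_zero order_trans by blast
    \<comment> \<open>The forcing \<open>g (n - 1)\<close> enters the tangent orbit at time
      \<open>n\<close>, hence the shift of the index.\<close>
    define ws where "ws n = Ps (?F n p) (g (n - 1), 0)" for n
    define wu where "wu n = (g (n - 1), 0) - ws n" for n
    have ws: "ws n \<in> Es (?F n p)" "wu n \<in> Eu (?F n p)" for n
      using Ps[OF FK[OF p], of n] by (auto simp: ws_def wu_def)
    have wle: "norm (ws n) \<le> Q * B" "norm (wu n) \<le> Q * B" for n
    proof -
      have "norm (ws n + wu n) \<le> B" using g[of "n - 1"] by (simp add: wu_def norm_Pair)
      then have "Q * norm (ws n + wu n) \<le> Q * B" using Q0 by (rule mult_left_mono)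
      then show "norm (ws n) \<le> Q * B" "norm (wu n) \<le> Q * B"
        using angle[OF FK[OF p] ws, of n] by linarith+
    qed
    define S where "S n = (\<Sum>k. tangent z (int k) (?F (n - int k) p) (ws (n - int k)))" for n
    \<comment> \<open>\<open>V n\<close> belongs to time \<open>- n\<close>, so that
      \<open>green_sum\<close> applies to the inverse derivative.\<close>
    define V where "V n = (\<Sum>k. tangent z (- int k) (?F (- (n - int k)) p) (wu (- (n - int k))))" for n
    have "S (n + 1) = ws (n + 1) + tangent z 1 (?F n p) (S n) \<and> norm (S n) \<le> C * (Q * B) / (1 - \<mu>)" for n
    proof -
      have "norm (tangent z (int k) (?F (n - int k) p) (ws (n - int k))) \<le> C * (Q * B) * \<mu> ^ k" for k n
      proof -
        have "norm (tangent z (int k) (?F (n - int k) p) (ws (n - int k))) \<le> C * \<mu> ^ k * norm (ws (n - int k))"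
          by (intro dec FK p ws)
        also have "\<dots> \<le> C * \<mu> ^ k * (Q * B)" using C \<mu> by (intro mult_left_mono wle) auto
        finally show ?thesis by (simp add: mult_ac)
      qed
      moreover have "tangent z (int (Suc k)) (?F (n + 1 - int (Suc k)) p) v
          = tangent z 1 (?F n p) (tangent z (int k) (?F (n - int k) p) v)" for k n v
        using tangent_Suc[OF z, of "int k" "?F (n - int k) p" v]
        by (simp add: add.commute flip: hiter_add[OF z])
      ultimately show ?thesis unfolding S_def
        using green_sum[where A = "\<lambda>n. tangent z 1 (?F n p)" and w = ws and c = "C * (Q * B)" and \<mu> = \<mu>
            and T = "\<lambda>k n. tangent z (int k) (?F (n - int k) p)"] bounded_linear_tangent[OF z] \<mu>
        by simp
    qed
    note S = this
    have "V (n + 1) = wu (- (n + 1)) + tangent z (-1) (?F (- n) p) (V n) \<and> norm (V n) \<le> C * (Q * B) / (1 - \<mu>)" for n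
    proof -
      have "norm (tangent z (- int k) (?F (- (n - int k)) p) (wu (- (n - int k)))) \<le> C * (Q * B) * \<mu> ^ k" for k n
      proof -
        have "norm (tangent z (- int k) (?F (- (n - int k)) p) (wu (- (n - int k)))) \<le> C * \<mu> ^ k * norm (wu (- (n - int k)))"
          by (intro dec FK p ws)
        also have "\<dots> \<le> C * \<mu> ^ k * (Q * B)" using C \<mu> by (intro mult_left_mono wle) auto
        finally show ?thesis by (simp add: mult_ac)
      qed
      moreover have "tangent z (- int (Suc k)) (?F (- (n + 1 - int (Suc k))) p) v
          = tangent z (-1) (?F (- n) p) (tangent z (- int k) (?F (- (n - int k)) p) v)" for k n v
        using tangent_add[OF z, of "-1" "- int k" "?F (- (n - int k)) p" v]
        by (simp add: add.commute flip: hiter_add[OF z])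
      ultimately show ?thesis unfolding V_def
        using green_sum[where A = "\<lambda>n. tangent z (-1) (?F (- n) p)" and w = "\<lambda>n. wu (- n)" and c = "C * (Q * B)" and \<mu> = \<mu>
            and T = "\<lambda>k n. tangent z (- int k) (?F (- (n - int k)) p)"] bounded_linear_tangent[OF z] \<mu>
        by simp
    qed
    note V = this
    \<comment> \<open>The unstable sum must run over the strict future with a minus sign.
      \<open>V (- n)\<close> also contains the present term \<open>wu n\<close>, which is therefore
      added back.\<close>
    define U where "U n = S n + wu n - V (- n)" for n
    have U1: "U (n + 1) = tangent z 1 (?F n p) (U n) + (g n, 0)" for n
    proof -
      have "V (- n) = wu n + tangent z (-1) (?F (n + 1) p) (V (- (n + 1)))"
        using V[of "- (n + 1)"] by (simp add: add.commute)
      then have *: "tangent z 1 (?F n p) (V (- n) - wu n) = V (- (n + 1))"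
        using tangent_inverse'[OF z, of 1 "?F (n + 1) p"] by (simp add: hiter_add[OF z, symmetric])
      have "U n = S n - (V (- n) - wu n)" by (simp add: U_def)
      then have "tangent z 1 (?F n p) (U n) = tangent z 1 (?F n p) (S n) - V (- (n + 1))"
        using linear_diff[OF linear_tangent[OF z], of 1 "?F n p" "S n" "V (- n) - wu n"] * by simp
      then show ?thesis using S[of n] by (simp add: U_def wu_def)
    qed
    have Ule: "norm (U n) \<le> M * B" for n
    proof -
      have "norm (U n) \<le> norm (S n) + norm (wu n) + norm (V (- n))"
        unfolding U_def by (meson norm_triangle_ineq norm_triangle_ineq4 add_right_mono order_trans)
      also have "\<dots> \<le> C * (Q * B) / (1 - \<mu>) + Q * B + C * (Q * B) / (1 - \<mu>)"
        using S V wle by (intro add_mono) auto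
      also have "\<dots> \<le> M * B" using B0 by (simp add: M_def algebra_simps)
      finally show ?thesis .
    qed
    define u where "u n = fst (U n)" for n
    have "snd (U n) = u (n - 1)" for n using U1[of "n - 1"] by (simp add: u_def tangent_1)
    then have "lin_op (orb z p) (snd z) u n = g n" for n
      using U1[of n] by (simp add: lin_op_def u_def tangent_1 orb_def)
    moreover have "cmod (u n) \<le> M * B" for n
      unfolding u_def using Ule[of n] norm_fst_le[of "fst (U n)" "snd (U n)"] by simp
    ultimately show ?thesis by (intro exI[of _ u]) auto
  qed
  \<comment> \<open>For every \<open>n\<close>, each component of \<open>v\<close> is the image
    under \<open>n\<close> contracting steps of a vector of norm at most \<open>Q * B\<close>, so it
    vanishes.\<close>
  have zero: "v = 0" if p: "p \<in> ?K" and B: "\<And>n. norm (tangent z n p v) \<le> B" for p v B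
  proof -
    have B0: "0 \<le> B" using B[of 0] norm_ge_zero order_trans by blast
    define s where "s = Ps p v"
    define u where "u = v - s"
    have s: "s \<in> Es p" and u: "u \<in> Eu p" using Ps[OF p] by (auto simp: s_def u_def)
    have le: "norm (tangent z n p s) \<le> Q * B \<and> norm (tangent z n p u) \<le> Q * B" for n
    proof -
      have "tangent z n p s + tangent z n p u = tangent z n p v"
        by (simp add: u_def flip: linear_add[OF linear_tangent[OF z]])
      then have "norm (tangent z n p s) \<le> Q * norm (tangent z n p v) \<and> norm (tangent z n p u) \<le> Q * norm (tangent z n p v)"
        using angle[OF FK[OF p] invs[OF p s] invu[OF p u], of n] by simp
      then show ?thesis using mult_left_mono[OF B[of n] Q0] by linarith
    qed
    have sn: "norm s \<le> C * \<mu> ^ n * (Q * B)" for n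
    proof -
      have "norm s = norm (tangent z (int n) (?F (- int n) p) (tangent z (- int n) p s))"
        by (simp add: tangent_inverse'[OF z])
      also have "\<dots> \<le> C * \<mu> ^ n * norm (tangent z (- int n) p s)" by (intro dec FK p invs s)
      also have "\<dots> \<le> C * \<mu> ^ n * (Q * B)" using C \<mu> le by (intro mult_left_mono) auto
      finally show ?thesis .
    qed
    have un: "norm u \<le> C * \<mu> ^ n * (Q * B)" for n
    proof -
      have "norm u = norm (tangent z (- int n) (?F (int n) p) (tangent z (int n) p u))"
        by (simp add: tangent_inverse[OF z])
      also have "\<dots> \<le> C * \<mu> ^ n * norm (tangent z (int n) p u)" by (intro dec FK p invu u)
      also have "\<dots> \<le> C * \<mu> ^ n * (Q * B)" using C \<mu> le by (intro mult_left_mono) auto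
      finally show ?thesis .
    qed
    have lim: "(\<lambda>n. C * \<mu> ^ n * (Q * B)) \<longlonglongrightarrow> C * 0 * (Q * B)"
      using \<mu> by (intro tendsto_intros LIMSEQ_power_zero) auto
    have "norm s \<le> 0" "norm u \<le> 0"
      using LIMSEQ_le_const[OF lim, of "norm s"] LIMSEQ_le_const[OF lim, of "norm u"] sn un by auto
    then show "v = 0" by (simp add: u_def)
  qed
  have "unif_inv M (orb z p) (snd z)" if p: "p \<in> ?K" for p
    unfolding unif_inv_def
  proof (intro conjI allI impI)
    show "0 < M" by (rule M0)
    show "\<exists>u. bounded (range u) \<and> lin_op (orb z p) (snd z) u = g" if g: "bounded (range g)" for g
    proof -
      obtain B where "\<And>n. cmod (g n) \<le> B" using bounded_range_E[OF g] by metis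
      then obtain u where "\<forall>n. cmod (u n) \<le> M * B" "lin_op (orb z p) (snd z) u = g"
        using ex[OF p, of g B] by auto
      then show ?thesis by (intro exI[of _ u] conjI bounded_range_le) auto
    qed
    fix u :: "int \<Rightarrow> complex" and B n
    assume u: "bounded (range u)" and B: "\<forall>n. cmod (lin_op (orb z p) (snd z) u n) \<le> B"
    obtain u' where u': "\<And>n. cmod (u' n) \<le> M * B" "lin_op (orb z p) (snd z) u' = lin_op (orb z p) (snd z) u"
      using ex[OF p, of "lin_op (orb z p) (snd z) u" B] B by blast
    define e where "e n = u n - u' n" for n
    have e0: "lin_op (orb z p) (snd z) e n = 0" for n
      unfolding e_def lin_op_diff u'(2) by simp
    have "bounded (range e)" unfolding e_def
      using bounded_range_diff[OF u bounded_range_le[OF u'(1)]] .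
    then obtain E where E: "\<And>n. cmod (e n) \<le> E" using bounded_range_E by metis
    have "e n = 0" for n
    proof -
      have te: "tangent z k p (e 0, e (-1)) = (e k, e (k - 1))" for k
        by (rule tangent_of_lin_op[OF z e0])
      have "norm (tangent z k p (e 0, e (-1))) \<le> E + E" for k
        unfolding te by (intro order_trans[OF norm_Pair_le] add_mono E)
      then have "(e 0, e (-1)) = 0" by (rule zero[OF p])
      then have "tangent z n p (e 0, e (-1)) = 0" using linear_0[OF linear_tangent[OF z]] by simp
      then show ?thesis unfolding te by (simp add: prod_eq_iff)
    qed
    then have "u n = u' n" by (simp add: e_def)
    then show "cmod (u n) \<le> M * B" using u'(1)[of n] by simp
  qed
  then have "unif_inv_on M z" unfolding unif_inv_on_def by blast
  then show ?thesis using that M0 by blast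
qed

text \<open>A solution cut off between times \<open>-1\<close> and \<open>0\<close> violates the
  recurrence only at these two times, by amounts controlled by \<open>N\<close>. The weighted bound
  then turns mere boundedness of the half-orbit into exponential decay with a constant independent
  of \<open>B\<close>; \<open>\<epsilon>\<close> is the largest rate that
  \<open>unif_inv_weighted\<close> allows.\<close>

lemma half_orbit_decay:
  assumes inv: "unif_inv M c b" and u0: "\<And>n. lin_op c b u n = 0"
    and N: "cmod (u 0) \<le> N" "cmod (u (-1)) \<le> N"
  defines "\<epsilon> \<equiv> 1 / (2 * M * (1 + cmod b))" and "A \<equiv> 2 * M * (1 + cmod b) * N"
  shows "\<lbrakk>\<And>n. 0 \<le> n \<Longrightarrow> cmod (u n) \<le> B\<rbrakk> \<Longrightarrow> (1 + \<epsilon>) ^ k * cmod (u (int k)) \<le> A"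
    and "\<lbrakk>\<And>n. n < 0 \<Longrightarrow> cmod (u n) \<le> B\<rbrakk> \<Longrightarrow> (1 + \<epsilon>) ^ Suc k * cmod (u (- int (Suc k))) \<le> (1 + \<epsilon>) * A"
proof -
  note M = unif_invD[OF inv]
  have b1: "0 < 1 + cmod b" by (simp add: add_pos_nonneg)
  have \<epsilon>: "0 \<le> \<epsilon>" "2 * M * (1 + cmod b) * \<epsilon> \<le> 1" using M(1) b1 by (simp_all add: \<epsilon>_def)
  have N0: "0 \<le> N" using N(1) norm_ge_zero order_trans by blast
  have Nle: "cmod (u 0) \<le> (1 + cmod b) * N" "cmod b * cmod (u (-1)) \<le> (1 + cmod b) * N"
    "0 \<le> (1 + cmod b) * N"
    using N N0 mult_left_mono[OF N(2), of "cmod b"] by (auto simp: algebra_simps intro: order_trans)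
  {
    assume B: "\<And>n. 0 \<le> n \<Longrightarrow> cmod (u n) \<le> B"
    define v where "v n = (if 0 \<le> n then u n else 0)" for n
    \<comment> \<open>The exponent is capped at \<open>k\<close> because the weighted estimate asks
      for a bounded weight; at time \<open>k\<close> the cap has no effect.\<close>
    define w where "w n = (1 + \<epsilon>) ^ min (nat n) k" for n
    have "0 \<le> B" using B[of 0] norm_ge_zero order_trans by blast
    then have bv: "bounded (range v)" by (intro bounded_range_le[of _ B]) (auto simp: v_def B)
    have bw: "bounded (range w)"
      using \<epsilon>(1) by (intro bounded_range_le[of _ "(1 + \<epsilon>) ^ k"]) (auto simp: w_def intro!: power_increasing)
    have slow: "w n \<le> (1 + \<epsilon>) * w (n + 1) \<and> w (n + 1) \<le> (1 + \<epsilon>) * w n" for n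
      unfolding w_def power_Suc[symmetric] using \<epsilon>(1) by (intro conjI power_increasing) auto
    have "w n * cmod (lin_op c b v n) \<le> (1 + cmod b) * N" for n
    proof -
      consider "n > 0" | "n = 0" | "n = -1" | "n < -1" by linarith
      then show ?thesis
      proof cases
        case 1
        then have "lin_op c b v n = lin_op c b u n" by (simp add: lin_op_def v_def)
        then show ?thesis using u0 Nle by simp
      next
        case 2
        then have "lin_op c b v n = lin_op c b u n - b * u (-1)" by (simp add: lin_op_def v_def)
        then show ?thesis using u0 Nle 2 by (simp add: w_def norm_mult)
      qed (use Nle in \<open>auto simp: lin_op_def v_def w_def\<close>)
    qed
    then have "w (int k) * cmod (v (int k)) \<le> 2 * M * ((1 + cmod b) * N)"
      using \<epsilon> slow by (intro unif_inv_weighted[OF inv bv _ bw]) (auto simp: w_def)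
    then show "(1 + \<epsilon>) ^ k * cmod (u (int k)) \<le> A" by (simp add: w_def v_def A_def mult.assoc)
  next
    assume B: "\<And>n. n < 0 \<Longrightarrow> cmod (u n) \<le> B"
    define v where "v n = (if n < 0 then u n else 0)" for n
    define w where "w n = (1 + \<epsilon>) ^ min (nat (- n)) (Suc k)" for n
    have "0 \<le> B" using order_trans[OF norm_ge_zero B[of "-1"]] by simp
    then have bv: "bounded (range v)" by (intro bounded_range_le[of _ B]) (auto simp: v_def B)
    have bw: "bounded (range w)"
      using \<epsilon>(1) by (intro bounded_range_le[of _ "(1 + \<epsilon>) ^ Suc k"]) (auto simp: w_def simp del: power_Suc intro!: power_increasing)
    have slow: "w n \<le> (1 + \<epsilon>) * w (n + 1) \<and> w (n + 1) \<le> (1 + \<epsilon>) * w n" for n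
      unfolding w_def power_Suc[symmetric] using \<epsilon>(1) by (intro conjI power_increasing) auto
    \<comment> \<open>In the past the weight at \<open>n = -1\<close> is already
      \<open>1 + \<epsilon>\<close>, which accounts for the extra factor compared with the forward
      half.\<close>
    have \<epsilon>N: "(1 + cmod b) * N \<le> (1 + \<epsilon>) * ((1 + cmod b) * N)"
      using mult_right_mono[of 1 "1 + \<epsilon>" "(1 + cmod b) * N"] Nle(3) \<epsilon>(1) by simp
    have "w n * cmod (lin_op c b v n) \<le> (1 + \<epsilon>) * ((1 + cmod b) * N)" for n
    proof -
      consider "n < -1" | "n = -1" | "n = 0" | "n > 0" by linarith
      then show ?thesis
      proof cases
        case 1
        then have "lin_op c b v n = lin_op c b u n" by (simp add: lin_op_def v_def)
        then show ?thesis using u0 Nle(3) \<epsilon>N by simp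
      next
        case 2
        then have "lin_op c b v n = lin_op c b u n - u 0" by (simp add: lin_op_def v_def)
        then show ?thesis using u0 Nle 2 \<epsilon>(1) by (auto simp: w_def intro!: mult_left_mono)
      next
        case 3
        then show ?thesis using Nle(2) \<epsilon>N by (simp add: lin_op_def v_def w_def norm_mult)
      next
        case 4
        then show ?thesis using Nle(3) \<epsilon>N by (simp add: lin_op_def v_def)
      qed
    qed
    then have "w (- int (Suc k)) * cmod (v (- int (Suc k))) \<le> 2 * M * ((1 + \<epsilon>) * ((1 + cmod b) * N))"
      using \<epsilon> slow by (intro unif_inv_weighted[OF inv bv _ bw]) (auto simp: w_def)
    moreover have "w (- int (Suc k)) = (1 + \<epsilon>) ^ Suc k"
      unfolding w_def by (simp only: minus_minus nat_int min.idem)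
    moreover have "v (- int (Suc k)) = u (- int (Suc k))" by (simp add: v_def)
    ultimately show "(1 + \<epsilon>) ^ Suc k * cmod (u (- int (Suc k))) \<le> (1 + \<epsilon>) * A"
      unfolding A_def by (simp only: mult_ac)
  }
qed

text \<open>The spaces are defined by boundedness of half-orbits, which makes invariance formal.
  Decay is \<open>half_orbit_decay\<close>, transversality is triviality of the bounded kernel, and
  spanning comes from solving the inhomogeneous equation for a truncated tangent orbit.\<close>

lemma unif_inv_on_imp_hyperbolic:
  assumes z: "snd z \<noteq> 0" and inv: "unif_inv_on M z" and M: "0 < M"
  shows "hyperbolic_set (henon z) (henon_K z)"
proof -
  let ?F = "int_iter (henon z)" and ?K = "henon_K z"
  define Es where "Es p = {v. \<exists>B. \<forall>n\<ge>0. norm (tangent z n p v) \<le> B}" for p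
  define Eu where "Eu p = {v. \<exists>B. \<forall>n\<le>0. norm (tangent z n p v) \<le> B}" for p
  define \<epsilon> where "\<epsilon> = 1 / (2 * M * (1 + cmod (snd z)))"
  define A where "A = 2 * M * (1 + cmod (snd z))"
  define \<mu> where "\<mu> = 1 / (1 + \<epsilon>)"
  \<comment> \<open>A tangent vector holds the sequence at two adjacent times, each entry costing at
    most \<open>(1 + \<epsilon>) * A\<close>; the added 1 covers \<open>n = 0\<close>.\<close>
  define C where "C = 2 * (1 + \<epsilon>) * A + 1"
  have b1: "0 < 1 + cmod (snd z)" by (simp add: add_pos_nonneg)
  have \<epsilon>: "0 < \<epsilon>" using M b1 by (simp add: \<epsilon>_def)
  have A: "0 < A" using M b1 by (simp add: A_def)
  have C: "0 < C" using \<epsilon> A by (simp add: C_def add_pos_pos)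
  have \<mu>: "0 < \<mu>" "\<mu> < 1" using \<epsilon> by (simp_all add: \<mu>_def)
  have pw: "(1 + \<epsilon>) ^ n * \<mu> ^ n = 1" for n using \<epsilon> by (simp add: \<mu>_def flip: power_mult_distrib)
  have div: "x \<le> D * \<mu> ^ n" if "(1 + \<epsilon>) ^ n * x \<le> D" for x D n
  proof -
    have "(1 + \<epsilon>) ^ n * x * \<mu> ^ n \<le> D * \<mu> ^ n" using that \<mu>(1) by (simp add: mult_right_mono)
    moreover have "(1 + \<epsilon>) ^ n * x * \<mu> ^ n = ((1 + \<epsilon>) ^ n * \<mu> ^ n) * x" by (simp only: mult_ac)
    ultimately show ?thesis by (simp only: pw mult_1)
  qed
  have fst_le: "cmod (fst v) \<le> norm v" and snd_le: "cmod (snd v) \<le> norm v" for v :: "complex \<times> complex"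
    using norm_fst_le[of "fst v" "snd v"] norm_snd_le[of "snd v" "fst v"] by auto
  have seq0: "tseq z p v 0 = fst v" "tseq z p v (-1) = snd v" for p v
    using tangent_tseq[OF z, of 0 p v] by (auto simp: prod_eq_iff)
  have tseq_le: "cmod (tseq z p v n) \<le> norm (tangent z n p v)" for p v n
    by (simp add: tseq_def fst_le)
  have subspace: "subspace (Es p)" "subspace (Eu p)" for p
  proof -
    have "subspace {v. \<exists>B. \<forall>n\<in>I. norm (tangent z n p v) \<le> B}" for I
    proof (rule subspaceI)
      note l = linear_tangent[OF z]
      show "0 \<in> {v. \<exists>B. \<forall>n\<in>I. norm (tangent z n p v) \<le> B}"
        by (auto simp: linear_0[OF l])
      show "x + y \<in> {v. \<exists>B. \<forall>n\<in>I. norm (tangent z n p v) \<le> B}"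
        if "x \<in> {v. \<exists>B. \<forall>n\<in>I. norm (tangent z n p v) \<le> B}"
          "y \<in> {v. \<exists>B. \<forall>n\<in>I. norm (tangent z n p v) \<le> B}" for x y
        using that unfolding mem_Collect_eq linear_add[OF l]
        by (meson norm_add_rule_thm)
      show "c *\<^sub>R x \<in> {v. \<exists>B. \<forall>n\<in>I. norm (tangent z n p v) \<le> B}"
        if "x \<in> {v. \<exists>B. \<forall>n\<in>I. norm (tangent z n p v) \<le> B}" for x c
        using that unfolding mem_Collect_eq linear_scale[OF l] norm_scaleR
        by (meson abs_ge_zero mult_left_mono)
    qed
    from this[of "{0..}"] this[of "{..0}"] show "subspace (Es p)" "subspace (Eu p)"
      by (simp_all add: Es_def Eu_def Ball_def)
  qed
  have dec_s: "norm (tangent z (int n) p v) \<le> C * \<mu> ^ n * norm v" if p: "p \<in> ?K" and v: "v \<in> Es p" for n p v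
  proof -
    have inv': "unif_inv M (orb z p) (snd z)" using inv p by (simp add: unif_inv_on_def)
    obtain B where B: "\<And>n. 0 \<le> n \<Longrightarrow> norm (tangent z n p v) \<le> B" using v by (auto simp: Es_def)
    have d: "cmod (tseq z p v (int k)) \<le> A * norm v * \<mu> ^ k" for k
    proof (rule div)
      show "(1 + \<epsilon>) ^ k * cmod (tseq z p v (int k)) \<le> A * norm v"
        unfolding \<epsilon>_def A_def
        by (rule half_orbit_decay(1)[OF inv' lin_op_tseq[OF z]])
          (auto simp: seq0 fst_le snd_le intro: order_trans[OF tseq_le] B)
    qed
    show ?thesis
    proof (cases n)
      case 0
      then show ?thesis using \<epsilon> A by (simp add: C_def algebra_simps)
    next
      case (Suc k)
      have "A * norm v * \<mu> ^ k = (1 + \<epsilon>) * (A * norm v * \<mu> ^ n)"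
        using \<epsilon> by (simp add: Suc \<mu>_def)
      moreover have "int n - 1 = int k" by (simp add: Suc)
      ultimately have "cmod (tseq z p v (int n)) + cmod (tseq z p v (int n - 1))
          \<le> A * norm v * \<mu> ^ n + (1 + \<epsilon>) * (A * norm v * \<mu> ^ n)"
        using d[of n] d[of k] by (metis add_mono)
      also have "\<dots> \<le> C * \<mu> ^ n * norm v"
      proof -
        have "0 \<le> A * norm v * \<mu> ^ n" "0 \<le> \<epsilon> * (A * norm v * \<mu> ^ n)" "0 \<le> \<mu> ^ n * norm v" using A \<mu> \<epsilon> by simp_all
        then show ?thesis by (simp add: C_def algebra_simps)
      qed
      finally show ?thesis unfolding tangent_tseq[OF z] by (rule order_trans[OF norm_Pair_le])
    qed
  qed
  have dec_u: "norm (tangent z (- int n) p v) \<le> C * \<mu> ^ n * norm v" if p: "p \<in> ?K" and v: "v \<in> Eu p" for n p v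
  proof -
    have inv': "unif_inv M (orb z p) (snd z)" using inv p by (simp add: unif_inv_on_def)
    obtain B where B: "\<And>n. n \<le> 0 \<Longrightarrow> norm (tangent z n p v) \<le> B" using v by (auto simp: Eu_def)
    have d: "cmod (tseq z p v (- int (Suc k))) \<le> (1 + \<epsilon>) * (A * norm v) * \<mu> ^ Suc k" for k
    proof (rule div)
      show "(1 + \<epsilon>) ^ Suc k * cmod (tseq z p v (- int (Suc k))) \<le> (1 + \<epsilon>) * (A * norm v)"
        unfolding \<epsilon>_def A_def
        by (rule half_orbit_decay(2)[OF inv' lin_op_tseq[OF z], where B = B])
          (auto simp: seq0 fst_le snd_le intro: order_trans[OF tseq_le B])
    qed
    show ?thesis
    proof (cases n)
      case 0
      then show ?thesis using \<epsilon> A by (simp add: C_def algebra_simps)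
    next
      case (Suc k)
      have "(1 + \<epsilon>) * (A * norm v) * \<mu> ^ Suc n \<le> (1 + \<epsilon>) * (A * norm v) * \<mu> ^ n"
        using \<epsilon> A \<mu> by (intro mult_left_mono power_decreasing) auto
      moreover have "- int n - 1 = - int (Suc n)" by simp
      ultimately have "cmod (tseq z p v (- int n)) + cmod (tseq z p v (- int n - 1))
          \<le> (1 + \<epsilon>) * (A * norm v) * \<mu> ^ n + (1 + \<epsilon>) * (A * norm v) * \<mu> ^ n"
        using d[of n] d[of k] by (simp only: Suc)
      also have "\<dots> \<le> C * \<mu> ^ n * norm v"
        using A \<mu> \<epsilon> by (simp add: C_def algebra_simps)
      finally show ?thesis unfolding tangent_tseq[OF z] by (rule order_trans[OF norm_Pair_le])
    qed
  qed
  have inter: "Es p \<inter> Eu p = {0}" if p: "p \<in> ?K" for p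
  proof -
    note D = unif_invD[OF inv[unfolded unif_inv_on_def, rule_format, OF p]]
    have "v = 0" if v: "v \<in> Es p" "v \<in> Eu p" for v
    proof -
      obtain B B' where "\<And>n. 0 \<le> n \<Longrightarrow> norm (tangent z n p v) \<le> B" "\<And>n. n \<le> 0 \<Longrightarrow> norm (tangent z n p v) \<le> B'"
        using v by (auto simp: Es_def Eu_def)
      then have "cmod (tseq z p v n) \<le> max B B'" for n
        by (intro order_trans[OF tseq_le]) (cases "0 \<le> n"; force simp: le_max_iff_disj)
      then have "cmod (tseq z p v n) \<le> M * 0" for n
        by (intro D(2) bounded_range_le[of _ "max B B'"]) (simp_all add: lin_op_tseq[OF z])
      then show "v = 0" using seq0[of p v] by (simp add: prod_eq_iff)
    qed
    moreover have "0 \<in> Es p" "0 \<in> Eu p" by (intro subspace_0 subspace)+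
    ultimately show ?thesis by blast
  qed
  have sum: "{u + v |u v. u \<in> Es p \<and> v \<in> Eu p} = UNIV" if p: "p \<in> ?K" for p
  proof -
    note D = unif_invD[OF inv[unfolded unif_inv_on_def, rule_format, OF p]]
    have "\<exists>s u. v = s + u \<and> s \<in> Es p \<and> u \<in> Eu p" for v
    proof -
      define t where "t = tseq z p v"
      \<comment> \<open>Truncation leaves a defect at \<open>0\<close> and \<open>-1\<close> only,
        hence a bounded one, so a bounded \<open>y\<close> with the same defect exists.\<close>
      define w where "w n = (if 0 \<le> n then t n else 0)" for n
      have "cmod (lin_op (orb z p) (snd z) w n) \<le> norm v + cmod (snd z) * norm v" for n
      proof -
        consider "n > 0" | "n = 0" | "n = -1" | "n < -1" by linarith
        then show ?thesis
        proof cases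
          case 1
          then have "lin_op (orb z p) (snd z) w n = lin_op (orb z p) (snd z) t n" by (simp add: lin_op_def w_def)
          then show ?thesis by (simp add: t_def lin_op_tseq[OF z])
        next
          case 2
          then have "lin_op (orb z p) (snd z) w n = lin_op (orb z p) (snd z) t n - snd z * t (-1)"
            by (simp add: lin_op_def w_def)
          moreover have "cmod (snd z) * cmod (snd v) \<le> cmod (snd z) * norm v"
            by (intro mult_left_mono snd_le) simp
          ultimately show ?thesis unfolding t_def lin_op_tseq[OF z] seq0
            by (simp add: norm_mult add_increasing)
        next
          case 3
          then have "lin_op (orb z p) (snd z) w n = fst v" by (simp add: lin_op_def w_def t_def seq0)
          then show ?thesis using fst_le[of v] by (simp add: add_increasing2)
        qed (simp add: lin_op_def w_def)
      qed
      then obtain y where y: "bounded (range y)" "lin_op (orb z p) (snd z) y = lin_op (orb z p) (snd z) w"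
        using D(3)[OF bounded_range_le] by metis
      then obtain Y where Y: "\<And>n. cmod (y n) \<le> Y" and Y0: "0 \<le> Y" using bounded_range_E by metis
      define e where "e n = y n - w n" for n
      have e0: "lin_op (orb z p) (snd z) e n = 0" for n
        unfolding e_def lin_op_diff y(2) by simp
      \<comment> \<open>Both \<open>e\<close> and \<open>f\<close> solve the homogeneous equation
        and \<open>t = f - e\<close>. For negative times \<open>e\<close> equals the bounded
        \<open>y\<close>, for nonnegative times \<open>f\<close> does, which places them in the
        unstable and the stable space.\<close>
      define f where "f n = t n - (w n - y n)" for n
      have f0: "lin_op (orb z p) (snd z) f n = 0" for n
        unfolding f_def lin_op_diff y(2) by (simp add: t_def lin_op_tseq[OF z])
      note te = tangent_of_lin_op[OF z e0] and tf = tangent_of_lin_op[OF z f0]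
      have "norm (tangent z n p (e 0, e (-1))) \<le> cmod (e 0) + Y + Y" if "n \<le> 0" for n
      proof -
        have "cmod (e n) \<le> cmod (e 0) + Y"
        proof (cases "n = 0")
          case False
          then have "e n = y n" using that by (simp add: e_def w_def)
          then have "cmod (e n) \<le> Y" using Y[of n] by simp
          then show ?thesis using norm_ge_zero[of "e 0"] by linarith
        qed (use Y0 in simp)
        moreover have "cmod (e (n - 1)) \<le> Y"
          using that Y[of "n - 1"] by (simp add: e_def w_def)
        ultimately have "cmod (e n) + cmod (e (n - 1)) \<le> cmod (e 0) + Y + Y" by linarith
        then show ?thesis unfolding te by (rule order_trans[OF norm_Pair_le])
      qed
      then have u: "(e 0, e (-1)) \<in> Eu p" by (auto simp: Eu_def)
      have "norm (tangent z n p (f 0, f (-1))) \<le> Y + (cmod (f (-1)) + Y)" if "0 \<le> n" for n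
      proof -
        have "cmod (f (n - 1)) \<le> cmod (f (-1)) + Y"
        proof (cases "n = 0")
          case False
          then have "f (n - 1) = y (n - 1)" using that by (simp add: f_def w_def)
          then have "cmod (f (n - 1)) \<le> Y" using Y[of "n - 1"] by simp
          then show ?thesis using norm_ge_zero[of "f (-1)"] by linarith
        qed (use Y0 in simp)
        moreover have "cmod (f n) \<le> Y" using that Y[of n] by (simp add: f_def w_def)
        ultimately have "cmod (f n) + cmod (f (n - 1)) \<le> Y + (cmod (f (-1)) + Y)" by linarith
        then show ?thesis unfolding tf by (rule order_trans[OF norm_Pair_le])
      qed
      then have s: "(f 0, f (-1)) \<in> Es p" by (auto simp: Es_def)
      have "v = (t 0, t (-1))" by (simp add: t_def seq0)
      also have "\<dots> = (f 0, f (-1)) + (- (e 0, e (-1)))"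
        by (simp add: f_def e_def)
      finally show ?thesis using s subspace_neg[OF subspace(2) u] by blast
    qed
    then show ?thesis by blast
  qed
  have im: "tangent z 1 p ` Es p = Es (henon z p)" "tangent z 1 p ` Eu p = Eu (henon z p)" for p
  proof -
    have t: "tangent z n (henon z p) (tangent z 1 p v) = tangent z (n + 1) p v" for n v
      using tangent_add[OF z, of n 1 p v] by simp
    have t': "tangent z n p (tangent z (-1) (henon z p) v) = tangent z (n - 1) (henon z p) v" for n v
      using tangent_add[OF z, of n "-1" "henon z p" v] hiter_pred[OF z, of 1 p]
      by (simp add: int_iter_def henon_inv_henon[OF z] inv_henon[OF z])
    have surj: "v = tangent z 1 p (tangent z (-1) (henon z p) v)" for v
      using t'[of 1 v] by simp
    show "tangent z 1 p ` Es p = Es (henon z p)"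
    proof
      show "tangent z 1 p ` Es p \<subseteq> Es (henon z p)"
      proof (rule image_subsetI)
        fix v assume "v \<in> Es p"
        then obtain B where "\<And>n. 0 \<le> n \<Longrightarrow> norm (tangent z n p v) \<le> B" by (auto simp: Es_def)
        then have "norm (tangent z (n + 1) p v) \<le> B" if "0 \<le> n" for n using that by simp
        then show "tangent z 1 p v \<in> Es (henon z p)" by (auto simp: Es_def t)
      qed
      show "Es (henon z p) \<subseteq> tangent z 1 p ` Es p"
      proof
        fix v assume "v \<in> Es (henon z p)"
        then obtain B where B: "\<And>n. 0 \<le> n \<Longrightarrow> norm (tangent z n (henon z p) v) \<le> B" by (auto simp: Es_def)
        have "norm (tangent z (n - 1) (henon z p) v) \<le> B + norm (tangent z (-1) (henon z p) v)" if "0 \<le> n" for n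
        proof (cases "n = 0")
          case True
          then show ?thesis using order_trans[OF norm_ge_zero B[of 0]] by simp
        next
          case False
          then show ?thesis using that B[of "n - 1"] by (simp add: add_increasing2)
        qed
        then have "tangent z (-1) (henon z p) v \<in> Es p" by (auto simp: Es_def t')
        then show "v \<in> tangent z 1 p ` Es p" using surj by blast
      qed
    qed
    show "tangent z 1 p ` Eu p = Eu (henon z p)"
    proof
      show "Eu (henon z p) \<subseteq> tangent z 1 p ` Eu p"
      proof
        fix v assume "v \<in> Eu (henon z p)"
        then obtain B where "\<And>n. n \<le> 0 \<Longrightarrow> norm (tangent z n (henon z p) v) \<le> B" by (auto simp: Eu_def)
        then have "norm (tangent z (n - 1) (henon z p) v) \<le> B" if "n \<le> 0" for n using that by simp
        then have "tangent z (-1) (henon z p) v \<in> Eu p" by (auto simp: Eu_def t')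
        then show "v \<in> tangent z 1 p ` Eu p" using surj by blast
      qed
      show "tangent z 1 p ` Eu p \<subseteq> Eu (henon z p)"
      proof (rule image_subsetI)
        fix v assume "v \<in> Eu p"
        then obtain B where B: "\<And>n. n \<le> 0 \<Longrightarrow> norm (tangent z n p v) \<le> B" by (auto simp: Eu_def)
        have "norm (tangent z (n + 1) p v) \<le> B + norm (tangent z 1 p v)" if "n \<le> 0" for n
        proof (cases "n = 0")
          case True
          then show ?thesis using order_trans[OF norm_ge_zero B[of 0]] by simp
        next
          case False
          then show ?thesis using that B[of "n + 1"] by (simp add: add_increasing2)
        qed
        then show "tangent z 1 p v \<in> Eu (henon z p)" by (auto simp: Eu_def t)
      qed
    qed
  qed
  show ?thesis
    unfolding hyperbolic_set_henon_iff[OF z]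
    by (intro exI[of _ Es] exI[of _ Eu] exI[of _ C] exI[of _ \<mu>] conjI ballI allI
        C \<mu> subspace inter sum im dec_s dec_u)
qed

lemma hyperbolic_iff_unif_inv_on:
  assumes "snd z \<noteq> 0"
  shows "hyperbolic_set (henon z) (henon_K z) \<longleftrightarrow> (\<exists>M>0. unif_inv_on M z)"
  using hyperbolic_imp_unif_inv_on[OF assms] unif_inv_on_imp_hyperbolic[OF assms] by metis

section \<open>Topological conjugacy\<close>

lemma conjugatesI:
  assumes "compact K" "continuous_on K h" "inj_on h K" "h ` K = L" "\<And>p. p \<in> K \<Longrightarrow> h (f p) = g (h p)"
  shows "conjugates (h :: 'a::t2_space \<Rightarrow> 'b::t2_space) f K g L"
  using homeomorphism_compact[OF assms(1,2,4,3)] assms(5) unfolding conjugates_def by blast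

lemma conjugatesD:
  assumes "conjugates h f K g L"
  shows "continuous_on K h" "inj_on h K" "h ` K = L" "\<And>p. p \<in> K \<Longrightarrow> h (f p) = g (h p)"
    "\<And>p. p \<in> K \<Longrightarrow> h p \<in> L"
  using assms unfolding conjugates_def homeomorphism_def by (auto simp: inj_on_def) metis

lemma conjugates_id: "conjugates (\<lambda>p. p) f K f K"
  unfolding conjugates_def using homeomorphism_ident by blast

lemma conjugates_inverse:
  assumes "conjugates h f K g L" and fK: "\<And>p. p \<in> K \<Longrightarrow> f p \<in> K"
  obtains k where "conjugates k g L f K" "\<And>p. p \<in> K \<Longrightarrow> k (h p) = p" "\<And>q. q \<in> L \<Longrightarrow> h (k q) = q"
proof -
  obtain k where k: "homeomorphism K L h k" and c: "\<And>p. p \<in> K \<Longrightarrow> h (f p) = g (h p)"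
    using assms(1) unfolding conjugates_def by blast
  have "k (g q) = f (k q)" if q: "q \<in> L" for q
  proof -
    have "k q \<in> K" "h (k q) = q" using k q unfolding homeomorphism_def by auto
    then have "k (g q) = k (h (f (k q)))" using c by simp
    also have "\<dots> = f (k q)" using k fK[OF \<open>k q \<in> K\<close>] unfolding homeomorphism_def by simp
    finally show ?thesis .
  qed
  then have "conjugates k g L f K"
    using homeomorphism_symD[OF k] unfolding conjugates_def by blast
  moreover have "k (h p) = p" if "p \<in> K" for p using k that unfolding homeomorphism_def by blast
  moreover have "h (k q) = q" if "q \<in> L" for q using k that unfolding homeomorphism_def by blast
  ultimately show ?thesis by (rule that)
qed

lemma conjugates_compose:
  assumes "conjugates h f K g L" "conjugates k g L e J"
  shows "conjugates (\<lambda>p. k (h p)) f K e J"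
proof -
  obtain h' k' where "homeomorphism K L h h'" "homeomorphism L J k k'"
    using assms unfolding conjugates_def by blast
  then have "homeomorphism K J (k \<circ> h) (h' \<circ> k')" by (rule homeomorphism_compose)
  then show ?thesis using conjugatesD(4)[OF assms(1)] conjugatesD(4)[OF assms(2)] conjugatesD(5)[OF assms(1)]
    unfolding conjugates_def comp_def by auto
qed

lemma conjugates_subset:
  assumes "conjugates h f K g L" "S \<subseteq> K" "h ` S = T"
  shows "conjugates h f S g T"
proof -
  obtain k where "homeomorphism K L h k" using assms(1) unfolding conjugates_def by blast
  then have "homeomorphism S T h k"
    using homeomorphism_of_subsets assms(2,3) subset_refl by metis
  then show ?thesis using assms(1,2) unfolding conjugates_def by blast
qed

lemma top_conjugate_refl: "top_conjugate f K f K"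
  unfolding top_conjugate_def using conjugates_id by blast

lemma top_conjugate_sym:
  "top_conjugate f K g L \<Longrightarrow> (\<And>p. p \<in> K \<Longrightarrow> f p \<in> K) \<Longrightarrow> top_conjugate g L f K"
  unfolding top_conjugate_def using conjugates_inverse by metis

lemma top_conjugate_trans:
  "top_conjugate f K g L \<Longrightarrow> top_conjugate g L e J \<Longrightarrow> top_conjugate f K e J"
  unfolding top_conjugate_def using conjugates_compose by metis

lemma conjugates_int_iter:
  assumes c: "conjugates h (henon z) (henon_K z) (henon w) (henon_K w)"
    and z: "snd z \<noteq> 0" "snd w \<noteq> 0" and p: "p \<in> henon_K z"
  shows "h (int_iter (henon z) n p) = int_iter (henon w) n (h p)"
proof -
  note K = int_iter_in_henon_K[OF z(1) p]
  show ?thesis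
  proof (induction n rule: int_induct[where k = 0])
    case base
    then show ?case by simp
  next
    case (step1 i)
    then show ?case using conjugatesD(4)[OF c K, of i] by (simp add: hiter_Suc z)
  next
    case (step2 i)
    have "henon w (h (int_iter (henon z) (i - 1) p)) = int_iter (henon w) i (h p)"
      using step2(2) conjugatesD(4)[OF c K, of "i - 1"] hiter_Suc[OF z(1), of "i - 1" p] by simp
    then have "inv (henon w) (int_iter (henon w) i (h p)) = h (int_iter (henon z) (i - 1) p)"
      using bij_henon[OF z(2)] by (metis bij_inv_eq_iff)
    then show ?case by (simp add: hiter_pred z)
  qed
qed

section \<open>Shadowing\<close>

text \<open>A sequence of counterexamples with parameters tending to \<open>z\<close> would
  accumulate, by compactness, at a point of \<open>henon_K z\<close>; finitely many iterates are
  continuous there, so this point contradicts them.\<close>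

lemma henon_K_upper_semicontinuous:
  assumes z: "snd z \<noteq> 0" and \<epsilon>: "0 < \<epsilon>"
  shows "\<exists>\<delta>>0. \<forall>w p. dist w z < \<delta> \<longrightarrow> p \<in> henon_K w \<longrightarrow>
       (\<exists>q\<in>henon_K z. \<forall>j\<in>{-N..N}. dist (int_iter (henon z) j q) (int_iter (henon w) j p) < \<epsilon>)"
proof (rule ccontr)
  assume "\<not> ?thesis"
  then have neg: "\<exists>w p. dist w z < \<delta> \<and> p \<in> henon_K w \<and>
      \<not> (\<exists>q\<in>henon_K z. \<forall>j\<in>{-N..N}. dist (int_iter (henon z) j q) (int_iter (henon w) j p) < \<epsilon>)"
    if "0 < \<delta>" for \<delta>
    using that by blast
  \<comment> \<open>The minimum with \<open>cmod (snd z)\<close> keeps the second parameter of all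
    counterexamples nonzero.\<close>
  have "\<forall>k. \<exists>w p. dist w z < min (cmod (snd z)) (inverse (real (Suc k))) \<and> p \<in> henon_K w \<and>
      \<not> (\<exists>q\<in>henon_K z. \<forall>j\<in>{-N..N}. dist (int_iter (henon z) j q) (int_iter (henon w) j p) < \<epsilon>)"
    using z by (intro allI neg) auto
  then obtain Z P where Z: "\<And>k. dist (Z k) z < min (cmod (snd z)) (inverse (real (Suc k)))"
    and P: "\<And>k. P k \<in> henon_K (Z k)"
    and no: "\<And>k q. q \<in> henon_K z \<Longrightarrow>
      \<exists>j\<in>{-N..N}. \<not> dist (int_iter (henon z) j q) (int_iter (henon (Z k)) j (P k)) < \<epsilon>"
    by metis
  have lim: "Z \<longlonglongrightarrow> z"
  proof (rule metric_LIMSEQ_I)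
    fix e :: real assume "0 < e"
    then obtain k0 where "inverse (real (Suc k0)) < e" using reals_Archimedean by blast
    moreover have "dist (Z k) z < inverse (real (Suc k0))" if "k0 \<le> k" for k
    proof -
      have "inverse (real (Suc k)) \<le> inverse (real (Suc k0))" using that by simp
      then show ?thesis using Z[of k] by linarith
    qed
    ultimately show "\<exists>no. \<forall>n\<ge>no. dist (Z n) z < e"
      by (intro exI[of _ k0]) (auto intro: less_trans)
  qed
  have Z0: "snd (Z k) \<noteq> 0" for k
  proof
    assume "snd (Z k) = 0"
    then have "cmod (snd z) \<le> dist (Z k) z" using dist_snd_le[of "Z k" z] by simp
    then show False using Z[of k] by simp
  qed
  obtain p r where r: "strict_mono (r :: nat \<Rightarrow> nat)" "(P \<circ> r) \<longlonglongrightarrow> p" "p \<in> henon_K z"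
    using henon_K_seq_compact[OF lim z P Z0] .
  have "\<forall>\<^sub>F k in sequentially. dist (int_iter (henon z) j p) (int_iter (henon (Z (r k))) j (P (r k))) < \<epsilon>" for j
  proof -
    have "(\<lambda>k. int_iter (henon ((Z \<circ> r) k)) j ((P \<circ> r) k)) \<longlonglongrightarrow> int_iter (henon z) j p"
      by (intro tendsto_int_iter_henon LIMSEQ_subseq_LIMSEQ lim r z)
    then show ?thesis using tendstoD[OF _ \<epsilon>] by (simp add: dist_commute)
  qed
  then have "\<forall>\<^sub>F k in sequentially. \<forall>j\<in>{-N..N}.
      dist (int_iter (henon z) j p) (int_iter (henon (Z (r k))) j (P (r k))) < \<epsilon>"
    by (intro eventually_ball_finite) auto
  then obtain k where "\<forall>j\<in>{-N..N}. dist (int_iter (henon z) j p) (int_iter (henon (Z (r k))) j (P (r k))) < \<epsilon>"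
    using eventually_happens by fastforce
  then show False using no[OF r(3), of "r k"] by blast
qed

lemma shift_conjugacy_apply:
  assumes c: "conjugates c (henon z) (henon_K z) shift (UNIV :: sigma2 set)"
    and z: "snd z \<noteq> 0" and p: "p \<in> henon_K z"
  shows "c (int_iter (henon z) m p) j = c p (j + m)"
proof -
  note K = int_iter_in_henon_K[OF z p]
  show ?thesis
  proof (induction m arbitrary: j rule: int_induct[where k = 0])
    case base
    then show ?case by simp
  next
    case (step1 i)
    have "c (int_iter (henon z) (i + 1) p) j = c (int_iter (henon z) i p) (j + 1)"
      using conjugatesD(4)[OF c K, of i] by (simp add: hiter_Suc z shift_def)
    then show ?case using step1(2) by (simp add: add_ac)
  next
    case (step2 i)
    have "c (int_iter (henon z) i p) (j - 1) = c (int_iter (henon z) (i - 1) p) j"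
      using conjugatesD(4)[OF c K, of "i - 1"] hiter_Suc[OF z, of "i - 1" p] by (simp add: shift_def)
    then show ?case using step2(2)[of "j - 1"] by (simp add: algebra_simps)
  qed
qed

text \<open>Shadowing is a topological property, so \<open>henon_K z\<close> inherits it from the full shift.\<close>

lemma henon_K_shadowing:
  assumes c: "conjugates c (henon z) (henon_K z) shift (UNIV :: sigma2 set)"
    and z: "snd z \<noteq> 0" and \<eta>: "0 < \<eta>"
  obtains \<epsilon> N where "0 < \<epsilon>"
    "\<And>q. (\<And>n. q n \<in> henon_K z) \<Longrightarrow>
       (\<And>n j. j \<in> {-N..N} \<Longrightarrow> dist (int_iter (henon z) j (q n)) (q (n + j)) < \<epsilon>) \<Longrightarrow>
       \<exists>p\<in>henon_K z. \<forall>n. dist (int_iter (henon z) n p) (q n) < \<eta>"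
proof -
  let ?K = "henon_K z"
  note sym = shift_conjugacy_apply[OF c z]
  have cn: "continuous_on ?K (\<lambda>p. c p n)" for n
    using continuous_on_product_then_coordinatewise[OF conjugatesD(1)[OF c]] .
  have pre: "\<exists>U. open U \<and> ?K \<inter> U = {p \<in> ?K. c p n = v}" for n v
  proof -
    have "openin (top_of_set ?K) (?K \<inter> (\<lambda>p. c p n) -` {v})"
      by (rule continuous_openin_preimage_gen[OF cn]) (simp add: open_discrete)
    moreover have "?K \<inter> (\<lambda>p. c p n) -` {v} = {p \<in> ?K. c p n = v}" by auto
    ultimately show ?thesis unfolding openin_open by metis
  qed
  then obtain U where U: "\<And>n v. open (U n v)" "\<And>n v. ?K \<inter> U n v = {p \<in> ?K. c p n = v}" by metis
  \<comment> \<open>Pairs that are far apart form a compact set covered by the open conditions that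
    some symbol differs. A finite subcover yields a window of symbols that determines a point up to
    \<open>\<eta> / 2\<close>.\<close>
  define D where "D = {(p, q). p \<in> ?K \<and> q \<in> ?K \<and> \<eta> / 2 \<le> dist p q}"
  have "D = (?K \<times> ?K) \<inter> {x. \<eta> / 2 \<le> dist (fst x) (snd x)}" by (auto simp: D_def)
  moreover have "closed {x :: (complex \<times> complex) \<times> complex \<times> complex. \<eta> / 2 \<le> dist (fst x) (snd x)}"
    by (intro closed_Collect_le continuous_intros)
  ultimately have "compact D"
    using compact_Int_closed[OF compact_Times[OF compact_henon_K[OF z] compact_henon_K[OF z]]] by simp
  define W where "W n = U n True \<times> U n False \<union> U n False \<times> U n True" for n
  have UK: "q \<in> U n v \<longleftrightarrow> c q n = v" if "q \<in> ?K" for q n v using U(2)[of n v] that by auto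
  have "D \<subseteq> (\<Union>n\<in>UNIV. W n)"
  proof clarify
    fix p q assume pq: "(p, q) \<in> D"
    then have "p \<noteq> q" using \<eta> by (auto simp: D_def)
    then have "c p \<noteq> c q" using pq conjugatesD(2)[OF c] by (auto simp: D_def inj_on_def)
    then obtain n where "c p n \<noteq> c q n" by blast
    then show "(p, q) \<in> (\<Union>n\<in>UNIV. W n)"
      using pq UK by (cases "c p n") (auto simp: W_def D_def intro!: exI[of _ n])
  qed
  moreover have "open (W n)" for n unfolding W_def by (intro open_Un open_Times U)
  ultimately obtain I where I: "finite I" "D \<subseteq> (\<Union>n\<in>I. W n)"
    using compactE_image[OF \<open>compact D\<close>, of UNIV W] by (metis subset_UNIV)
  define N where "N = Max (insert 0 (abs ` I))"
  have N: "n \<in> {-N..N}" if "n \<in> I" for n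
  proof -
    have "\<bar>n\<bar> \<le> N" unfolding N_def using I(1) that by (intro Max_ge) auto
    then show ?thesis by auto
  qed
  have close: "dist p q < \<eta> / 2" if "p \<in> ?K" "q \<in> ?K" "\<And>n. n \<in> {-N..N} \<Longrightarrow> c p n = c q n" for p q
  proof (rule ccontr)
    assume "\<not> ?thesis"
    then have "(p, q) \<in> D" using that by (simp add: D_def)
    then obtain n where "n \<in> I" "(p, q) \<in> W n" using I(2) by blast
    then show False using N[of n] that(3)[of n] UK[OF that(1)] UK[OF that(2)] by (auto simp: W_def)
  qed
  \<comment> \<open>Conversely, the two sets given by the symbol at 0 are compact and disjoint,
    hence a positive distance apart: close points share this symbol.\<close>
  define S where "S v = {p \<in> ?K. c p 0 = v}" for v
  have S: "compact (S v)" for v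
  proof -
    have "S v = ?K - U 0 (\<not> v)" using UK by (auto simp: S_def)
    then show ?thesis using compact_diff[OF compact_henon_K[OF z] U(1)] by simp
  qed
  moreover have "S True \<inter> S False = {}" by (auto simp: S_def)
  ultimately obtain e where e: "0 < e" "\<And>p q. p \<in> S True \<Longrightarrow> q \<in> S False \<Longrightarrow> e \<le> dist p q"
    using separate_compact_closed[of "S True" "S False"] compact_imp_closed by blast
  have symb: "c p 0 = c q 0" if "p \<in> ?K" "q \<in> ?K" "dist p q < e" for p q
    using e(2)[of p q] e(2)[of q p] that by (auto simp: S_def dist_commute)
  show ?thesis
  proof (rule that)
    show "0 < min e (\<eta> / 2)" using e \<eta> by simp
    fix q assume qK: "\<And>n. q n \<in> ?K"
      and po: "\<And>n j. j \<in> {-N..N} \<Longrightarrow> dist (int_iter (henon z) j (q n)) (q (n + j)) < min e (\<eta> / 2)"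
    \<comment> \<open>The shadowing point is the one whose symbol at each time \<open>n\<close> is
      the zeroth symbol of \<open>q n\<close>; in the full shift every such sequence occurs. The
      pseudo-orbit condition on the window makes it agree with each \<open>q n\<close> on the whole
      window.\<close>
    have "(\<lambda>n. c (q n) 0) \<in> c ` ?K" using conjugatesD(3)[OF c] by simp
    then obtain p where p: "p \<in> ?K" "c p = (\<lambda>n. c (q n) 0)" by auto
    have "dist (int_iter (henon z) n p) (q n) < \<eta> / 2" for n
    proof (rule close[OF int_iter_in_henon_K[OF z p(1)] qK])
      fix j assume j: "j \<in> {-N..N}"
      have "c (q n) j = c (int_iter (henon z) j (q n)) 0" using sym[OF qK] by simp
      also have "\<dots> = c (q (n + j)) 0"
        using po[OF j, of n] by (intro symb int_iter_in_henon_K z qK) simp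
      finally show "c (int_iter (henon z) n p) j = c (q n) j" by (simp add: sym[OF p(1)] p(2) add.commute)
    qed
    moreover have "\<eta> / 2 < \<eta>" using \<eta> by simp
    ultimately have "dist (int_iter (henon z) n p) (q n) < \<eta>" for n by (rule less_trans)
    then show "\<exists>p\<in>?K. \<forall>n. dist (int_iter (henon z) n p) (q n) < \<eta>" using p(1) by blast
  qed
qed

text \<open>Continuation only produces orbits of \<open>w\<close>; this lemma shows that no others
  exist in \<open>henon_K w\<close>. Replacing each point of such an orbit by a close point of
  \<open>henon_K z\<close> gives a pseudo-orbit of \<open>z\<close>, which is then shadowed.\<close>

lemma henon_K_orbits_shadowed:
  assumes z: "snd z \<noteq> 0" and top: "top_conjugate (henon z) (henon_K z) shift (UNIV :: sigma2 set)"
    and \<eta>: "0 < \<eta>"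
  obtains \<delta> where "0 < \<delta>" "\<And>w. dist w z < \<delta> \<Longrightarrow> snd w \<noteq> 0"
    "\<And>w p'. dist w z < \<delta> \<Longrightarrow> p' \<in> henon_K w \<Longrightarrow>
       \<exists>p\<in>henon_K z. \<forall>n. cmod (orb z p n - orb w p' n) \<le> \<eta>"
proof -
  obtain c where c: "conjugates c (henon z) (henon_K z) shift (UNIV :: sigma2 set)"
    using top unfolding top_conjugate_def by blast
  have "0 < \<eta> / 2" using \<eta> by simp
  obtain \<epsilon> N where \<epsilon>: "0 < \<epsilon>"
    and shad: "\<And>q. (\<And>n. q n \<in> henon_K z) \<Longrightarrow>
       (\<And>n j. j \<in> {-N..N} \<Longrightarrow> dist (int_iter (henon z) j (q n)) (q (n + j)) < \<epsilon>) \<Longrightarrow>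
       \<exists>p\<in>henon_K z. \<forall>n. dist (int_iter (henon z) n p) (q n) < \<eta> / 2"
    using henon_K_shadowing[OF c z \<open>0 < \<eta> / 2\<close>] by blast
  define e where "e = min (\<epsilon> / 2) (\<eta> / 2)"
  have e: "0 < e" using \<epsilon> \<eta> by (simp add: e_def)
  \<comment> \<open>The window is enlarged to contain 0, since closeness at time 0 is used
    separately.\<close>
  obtain \<delta> where \<delta>: "0 < \<delta>" and usc: "\<And>w p. dist w z < \<delta> \<Longrightarrow> p \<in> henon_K w \<Longrightarrow>
       \<exists>q\<in>henon_K z. \<forall>j\<in>{-max 0 N..max 0 N}. dist (int_iter (henon z) j q) (int_iter (henon w) j p) < e"
    using henon_K_upper_semicontinuous[OF z e, of "max 0 N"] by blast
  show ?thesis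
  proof (rule that[of "min \<delta> (cmod (snd z))"])
    show "0 < min \<delta> (cmod (snd z))" using \<delta> z by simp
    show w0: "snd w \<noteq> 0" if "dist w z < min \<delta> (cmod (snd z))" for w
      using dist_snd_le[of w z] that by auto
    fix w p' assume w: "dist w z < min \<delta> (cmod (snd z))" and p': "p' \<in> henon_K w"
    note w0 = w0[OF w]
    have "\<forall>n. \<exists>q\<in>henon_K z. \<forall>j\<in>{-max 0 N..max 0 N}.
        dist (int_iter (henon z) j q) (int_iter (henon w) j (int_iter (henon w) n p')) < e"
      using w usc[OF _ int_iter_in_henon_K[OF w0 p']] by simp
    then obtain q where q: "\<And>n. q n \<in> henon_K z"
      and near: "\<And>n j. j \<in> {-max 0 N..max 0 N} \<Longrightarrow>
        dist (int_iter (henon z) j (q n)) (int_iter (henon w) j (int_iter (henon w) n p')) < e"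
      by metis
    have near0: "dist (q n) (int_iter (henon w) n p') < e" for n
      using near[of 0 n] by simp
    have "dist (int_iter (henon z) j (q n)) (q (n + j)) < \<epsilon>" if j: "j \<in> {-N..N}" for n j
    proof -
      have "dist (int_iter (henon z) j (q n)) (int_iter (henon w) (n + j) p') < \<epsilon> / 2"
        using near[of j n] j hiter_add[OF w0, of j n p'] by (simp add: e_def add.commute)
      moreover have "dist (q (n + j)) (int_iter (henon w) (n + j) p') < \<epsilon> / 2"
        using near0[of "n + j"] by (simp add: e_def)
      ultimately show ?thesis by (rule dist_triangle_half_l)
    qed
    from shad[OF q this] obtain p where p: "p \<in> henon_K z"
      and pq: "\<And>n. dist (int_iter (henon z) n p) (q n) < \<eta> / 2" by blast
    have "cmod (orb z p n - orb w p' n) \<le> \<eta>" for n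
    proof -
      have "dist (q n) (int_iter (henon w) n p') < \<eta> / 2" using near0[of n] by (simp add: e_def)
      then have "dist (int_iter (henon z) n p) (int_iter (henon w) n p') < \<eta>"
        using pq[of n] dist_triangle[of "int_iter (henon z) n p" "int_iter (henon w) n p'" "q n"] by linarith
      then show ?thesis
        using dist_fst_le[of "int_iter (henon z) n p" "int_iter (henon w) n p'"]
        by (simp add: orb_def dist_norm)
    qed
    then show "\<exists>p\<in>henon_K z. \<forall>n. cmod (orb z p n - orb w p' n) \<le> \<eta>" using p by blast
  qed
qed

section \<open>Structural stability\<close>

lemma horseshoe_locusD:
  assumes "z \<in> horseshoe_locus"
  shows "snd z \<noteq> 0" "hyperbolic_set (henon z) (henon_K z)"
    "top_conjugate (henon z) (henon_K z) shift (UNIV :: sigma2 set)"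
  using assms by (auto simp: horseshoe_locus_def)

text \<open>Nearness of entire orbits within \<open>r\<close> is a one-to-one relation between the
  two sets \<open>henon_K\<close>, and \<open>h\<close> is the function it defines. The last clause,
  which identifies \<open>h\<close> by nearness alone, is what makes conjugacy families
  unique.\<close>

lemma horseshoe_locus_local_conjugacy:
  assumes zH: "z \<in> horseshoe_locus"
  obtains \<delta> r h where "0 < \<delta>" "0 < r" "ball z \<delta> \<subseteq> horseshoe_locus"
    "continuous_on (ball z \<delta> \<times> henon_K z) (\<lambda>(w, p). h w p)"
    "\<And>w. w \<in> ball z \<delta> \<Longrightarrow> conjugates (h w) (henon z) (henon_K z) (henon w) (henon_K w)"
    "\<And>w p p'. w \<in> ball z \<delta> \<Longrightarrow> p \<in> henon_K z \<Longrightarrow> p' \<in> henon_K w \<Longrightarrow>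
       (\<And>n. cmod (orb z p n - orb w p' n) \<le> r) \<Longrightarrow> p' = h w p"
proof -
  note z = horseshoe_locusD(1)[OF zH]
  obtain M where M: "0 < M" and inv: "\<And>p. p \<in> henon_K z \<Longrightarrow> unif_inv M (orb z p) (snd z)"
    using horseshoe_locusD(2)[OF zH] hyperbolic_iff_unif_inv_on[OF z] unfolding unif_inv_on_def by blast
  \<comment> \<open>\<open>orbit_near_unique\<close> is applied with constant \<open>2 * M\<close>
    and so needs \<open>8 * M * r \<le> 1\<close>, as does continuation; changing coefficients by
    \<open>r\<close> needs only \<open>6 * M * r \<le> 1\<close>.\<close>
  define r where "r = 1 / (8 * M)"
  have r: "0 < r" "8 * M * r \<le> 1" using M by (simp_all add: r_def)
  obtain \<delta>1 where \<delta>1: "0 < \<delta>1" "\<And>w. dist w z < \<delta>1 \<Longrightarrow> snd w \<noteq> 0"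
    and shad: "\<And>w p'. dist w z < \<delta>1 \<Longrightarrow> p' \<in> henon_K w \<Longrightarrow>
       \<exists>p\<in>henon_K z. \<forall>n. cmod (orb z p n - orb w p' n) \<le> r"
    using henon_K_orbits_shadowed[OF z horseshoe_locusD(3)[OF zH] r(1)] by blast
  \<comment> \<open>In turn: the range of shadowing, the allowed change of \<open>snd z\<close>, and
    a defect of old orbits of at most \<open>r / (4 * M)\<close>.\<close>
  define \<delta> where "\<delta> = min \<delta>1 (min r (r / (4 * M * (1 + escape_radius z))))"
  have R: "0 < 1 + escape_radius z" using escape_radius_ge_1[of z] by simp
  have \<delta>: "0 < \<delta>" using \<delta>1 r M R by (simp add: \<delta>_def)
  have w0: "snd w \<noteq> 0" and wb: "cmod (snd z - snd w) \<le> r"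
    and wab: "4 * M * (cmod (fst w - fst z) + cmod (snd w - snd z) * escape_radius z) \<le> r"
    if "w \<in> ball z \<delta>" for w
  proof -
    have d: "dist w z < \<delta>" using that by (simp add: dist_commute)
    then show "snd w \<noteq> 0" using \<delta>1(2) by (simp add: \<delta>_def)
    have le: "cmod (fst w - fst z) \<le> \<delta>" "cmod (snd w - snd z) \<le> \<delta>"
      using d dist_fst_le[of w z] dist_snd_le[of w z] by (simp_all add: dist_norm)
    then show "cmod (snd z - snd w) \<le> r" by (simp add: \<delta>_def norm_minus_commute)
    have "cmod (fst w - fst z) + cmod (snd w - snd z) * escape_radius z \<le> \<delta> + \<delta> * escape_radius z"
      using le escape_radius_ge_1[of z] by (intro add_mono mult_right_mono) auto
    also have "\<dots> = \<delta> * (1 + escape_radius z)" by (simp add: algebra_simps)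
    also have "\<dots> \<le> r / (4 * M * (1 + escape_radius z)) * (1 + escape_radius z)"
      using R by (intro mult_right_mono) (auto simp: \<delta>_def)
    also have "\<dots> = r / (4 * M)" using R by simp
    finally show "4 * M * (cmod (fst w - fst z) + cmod (snd w - snd z) * escape_radius z) \<le> r"
      using M by (simp add: field_simps)
  qed
  define near where "near w p p' \<longleftrightarrow> (\<forall>n. cmod (orb z p n - orb w p' n) \<le> r)" for w p p'
  have Mr: "6 * M * r \<le> 1" "6 * M * 0 \<le> 1" using r(2) M r(1) by (auto simp: r_def)
  have inv_b: "unif_inv (2 * M) (orb z p) (snd w)" if "w \<in> ball z \<delta>" "p \<in> henon_K z" for w p
    using wb[OF that(1)] r by (intro unif_inv_perturb[OF inv[OF that(2)] _ _ Mr(1)]) auto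
  have inv_near: "unif_inv (2 * M) (orb w p') (snd w)" "unif_inv (2 * M) (orb w p') (snd z)"
    if "w \<in> ball z \<delta>" "p \<in> henon_K z" "near w p p'" for w p p'
    using wb[OF that(1)] r that(3)
    by (auto simp: near_def intro!: unif_inv_perturb[OF inv[OF that(2)] _ _ Mr(1)])
  have ex': "\<exists>p'. p' \<in> henon_K w \<and> near w p p'" if w: "w \<in> ball z \<delta>" and p: "p \<in> henon_K z" for w p
  proof -
    have "6 * M * cmod (snd z - snd w) \<le> 6 * M * r" using wb[OF w] M by simp
    then have "6 * M * cmod (snd z - snd w) \<le> 1" using Mr by linarith
    then obtain p' where "p' \<in> henon_K w" "\<And>n. cmod (orb z p n - orb w p' n) \<le> r"
      using orbit_continuation[OF z w0[OF w] p inv[OF p] _ r(2) _ wab[OF w]] r(1) by auto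
    then show ?thesis unfolding near_def by blast
  qed
  have uniq': "p' = q'" if "w \<in> ball z \<delta>" "p \<in> henon_K z" "near w p p'" "near w p q'" for w p p' q'
    by (rule orbit_near_unique[OF w0[OF that(1)] inv_b[OF that(1,2)]])
      (use that r in \<open>auto simp: near_def\<close>)
  have ex: "\<exists>p. p \<in> henon_K z \<and> near w p p'" if "w \<in> ball z \<delta>" "p' \<in> henon_K w" for w p'
    using shad[of w p'] that unfolding near_def by (auto simp: \<delta>_def dist_commute)
  have uniq: "p = q" if "w \<in> ball z \<delta>" "p \<in> henon_K z" "near w p p'" "near w q p'" for w p p' q
    by (rule orbit_near_unique[OF z inv_near(2)[OF that(1-3)]])
      (use that r in \<open>auto simp: near_def norm_minus_commute\<close>)
  define h where "h w p = (SOME p'. p' \<in> henon_K w \<and> near w p p')" for w p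
  have h: "h w p \<in> henon_K w" "near w p (h w p)" if "w \<in> ball z \<delta>" "p \<in> henon_K z" for w p
    using someI_ex[OF ex'[OF that]] unfolding h_def by blast+
  \<comment> \<open>A subsequential limit of the values lies in \<open>henon_K w\<close> and
    inherits nearness to \<open>p\<close>, so uniqueness identifies it with \<open>h w p\<close>;
    compactness upgrades this to convergence.\<close>
  have cont: "continuous_on (ball z \<delta> \<times> henon_K z) (\<lambda>(w, p). h w p)"
  proof (rule continuous_on_sequentiallyI)
    fix u :: "nat \<Rightarrow> (complex \<times> complex) \<times> complex \<times> complex" and a
    assume u: "\<forall>n. u n \<in> ball z \<delta> \<times> henon_K z" and a: "a \<in> ball z \<delta> \<times> henon_K z" and lim: "u \<longlonglongrightarrow> a"
    obtain w p where wp: "a = (w, p)" "w \<in> ball z \<delta>" "p \<in> henon_K z" using a by auto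
    define W P where "W n = fst (u n)" and "P n = snd (u n)" for n
    have W: "W n \<in> ball z \<delta>" and P: "P n \<in> henon_K z" for n
      using u by (auto simp: W_def P_def mem_Times_iff)
    have Wl: "W \<longlonglongrightarrow> w" and Pl: "P \<longlonglongrightarrow> p"
      unfolding W_def P_def using tendsto_fst[OF lim] tendsto_snd[OF lim] by (simp_all add: wp)
    have "(\<lambda>n. h (W n) (P n)) \<longlonglongrightarrow> h w p"
    proof (rule tendstoI, rule ccontr)
      fix e :: real assume e: "0 < e"
        and "\<not> (\<forall>\<^sub>F n in sequentially. dist (h (W n) (P n)) (h w p) < e)"
      then obtain s where s: "strict_mono (s :: nat \<Rightarrow> nat)"
        and far: "\<And>n. \<not> dist (h (W (s n)) (P (s n))) (h w p) < e"
        using not_eventually_sequentiallyD by blast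
      note Ws = LIMSEQ_subseq_LIMSEQ[OF Wl s, unfolded comp_def]
        and Ps = LIMSEQ_subseq_LIMSEQ[OF Pl s, unfolded comp_def]
      obtain q t where t: "strict_mono (t :: nat \<Rightarrow> nat)" "((\<lambda>n. h (W (s n)) (P (s n))) \<circ> t) \<longlonglongrightarrow> q"
        and q: "q \<in> henon_K w"
        using henon_K_seq_compact[OF Ws w0[OF wp(2)] h(1)[OF W P] w0[OF W]] .
      have "near w p q" unfolding near_def
      proof
        fix n
        have "(\<lambda>k. cmod (orb z (P (s (t k))) n - orb (W (s (t k))) (h (W (s (t k))) (P (s (t k)))) n))
            \<longlonglongrightarrow> cmod (orb z p n - orb w q n)"
          using t(2) LIMSEQ_subseq_LIMSEQ[OF Ws t(1)] LIMSEQ_subseq_LIMSEQ[OF Ps t(1)]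
          by (intro tendsto_intros tendsto_orb[OF tendsto_const _ z] tendsto_orb[OF _ _ w0[OF wp(2)]])
            (simp_all add: comp_def)
        then show "cmod (orb z p n - orb w q n) \<le> r"
          by (rule LIMSEQ_le_const2) (use h(2)[OF W P] in \<open>auto simp: near_def\<close>)
      qed
      then have "q = h w p" using uniq'[OF wp(2,3)] h(2)[OF wp(2,3)] by blast
      then have "\<forall>\<^sub>F n in sequentially. dist (h (W (s (t n))) (P (s (t n)))) (h w p) < e"
        using tendstoD[OF t(2) e] by (simp add: comp_def)
      then show False using far by simp
    qed
    then show "(\<lambda>n. case u n of (w, p) \<Rightarrow> h w p) \<longlonglongrightarrow> (case a of (w, p) \<Rightarrow> h w p)"
      by (simp add: wp(1) W_def P_def case_prod_beta)
  qed
  have conj: "conjugates (h w) (henon z) (henon_K z) (henon w) (henon_K w)" if w: "w \<in> ball z \<delta>" for w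
  proof (rule conjugatesI[OF compact_henon_K[OF z]])
    have "continuous_on (henon_K z) (\<lambda>p. (\<lambda>(w, p). h w p) (w, p))"
      by (rule continuous_on_compose2[OF cont]) (use w in \<open>auto intro!: continuous_intros\<close>)
    then show "continuous_on (henon_K z) (h w)" by simp
    show "inj_on (h w) (henon_K z)"
      using h(2)[OF w] uniq[OF w] unfolding inj_on_def by metis
    show "h w ` henon_K z = henon_K w"
    proof
      show "h w ` henon_K z \<subseteq> henon_K w" using h(1)[OF w] by blast
      show "henon_K w \<subseteq> h w ` henon_K z"
        using ex[OF w] uniq'[OF w] h(2)[OF w] by (metis image_eqI subsetI)
    qed
    fix p assume p: "p \<in> henon_K z"
    \<comment> \<open>Applying the maps shifts both orbits by one step, which preserves nearness,
      and uniqueness gives equivariance.\<close>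
    have "near w (henon z p) (henon w (h w p))"
      using h(2)[OF w p] by (simp add: near_def orb_henon[OF z] orb_henon[OF w0[OF w]])
    then show "h w (henon z p) = henon w (h w p)"
      using uniq'[OF w henon_in_henon_K[OF z p]] h(2)[OF w henon_in_henon_K[OF z p]] by blast
  qed
  have sub: "ball z \<delta> \<subseteq> horseshoe_locus"
  proof
    fix w assume w: "w \<in> ball z \<delta>"
    have "unif_inv_on (2 * M) w"
      unfolding unif_inv_on_def using ex[OF w] inv_near(1)[OF w] by blast
    then have hyp: "hyperbolic_set (henon w) (henon_K w)"
      using hyperbolic_iff_unif_inv_on[OF w0[OF w]] M by (metis mult_pos_pos zero_less_numeral)
    have "top_conjugate (henon z) (henon_K z) (henon w) (henon_K w)"
      using conj[OF w] unfolding top_conjugate_def by blast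
    then have "top_conjugate (henon w) (henon_K w) shift (UNIV :: sigma2 set)"
      using top_conjugate_sym henon_in_henon_K[OF z] top_conjugate_trans horseshoe_locusD(3)[OF zH] by blast
    then show "w \<in> horseshoe_locus" using hyp w0[OF w] by (simp add: horseshoe_locus_def)
  qed
  show ?thesis
  proof (rule that[OF \<delta> r(1) sub cont conj])
    fix w p p' assume w: "w \<in> ball z \<delta>" and p: "p \<in> henon_K z" and "p' \<in> henon_K w"
      and "\<And>n. cmod (orb z p n - orb w p' n) \<le> r"
    then show "p' = h w p" using uniq'[OF w p _ h(2)[OF w p]] unfolding near_def by blast
  qed
qed

lemma open_horseshoe_locus: "open horseshoe_locus"
  unfolding open_contains_ball using horseshoe_locus_local_conjugacy by metis

section \<open>Families of conjugacies along paths\<close>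

text \<open>A conjugacy family stopped at time \<open>s\<close>, so that it can be built by
  induction along the path.\<close>

definition partial_family ::
  "(real \<Rightarrow> complex \<times> complex) \<Rightarrow> real \<Rightarrow> (real \<Rightarrow> complex \<times> complex \<Rightarrow> complex \<times> complex) \<Rightarrow> bool" where
  "partial_family \<sigma> s g \<longleftrightarrow>
     continuous_on ({0..s} \<times> henon_K (\<sigma> 0)) (\<lambda>(t, p). g t p) \<and>
     (\<forall>t\<in>{0..s}. conjugates (g t) (henon (\<sigma> 0)) (henon_K (\<sigma> 0)) (henon (\<sigma> t)) (henon_K (\<sigma> t))) \<and>
     (\<forall>p\<in>henon_K (\<sigma> 0). g 0 p = p)"

lemma conjugacy_family_iff_partial: "conjugacy_family \<sigma> g \<longleftrightarrow> partial_family \<sigma> 1 g"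
  by (simp add: conjugacy_family_def partial_family_def)

text \<open>The local conjugacies start at the centre \<open>z\<close>, not at
  \<open>\<sigma> s\<close>. So \<open>g s\<close> is first carried to \<open>z\<close> by the
  inverse of \<open>h (\<sigma> s)\<close> and then moved on by \<open>h (\<sigma> t)\<close>; at
  \<open>t = s\<close> the two formulas agree.\<close>

lemma partial_family_extend:
  assumes g: "partial_family \<sigma> s g" and s: "0 \<le> s" "s \<le> s'"
    and \<sigma>: "continuous_on {s..s'} \<sigma>" "\<And>t. t \<in> {s..s'} \<Longrightarrow> \<sigma> t \<in> B"
    and z: "snd z \<noteq> 0" "snd (\<sigma> 0) \<noteq> 0"
    and h: "continuous_on (B \<times> henon_K z) (\<lambda>(w, p). h w p)"
      "\<And>w. w \<in> B \<Longrightarrow> conjugates (h w) (henon z) (henon_K z) (henon w) (henon_K w)"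
  obtains g' where "partial_family \<sigma> s' g'"
proof -
  let ?K = "henon_K (\<sigma> 0)"
  have gs: "conjugates (g s) (henon (\<sigma> 0)) ?K (henon (\<sigma> s)) (henon_K (\<sigma> s))"
    and gc: "continuous_on ({0..s} \<times> ?K) (\<lambda>(t, p). g t p)"
    using g s(1) by (auto simp: partial_family_def)
  have "\<sigma> s \<in> B" using \<sigma>(2) s by simp
  obtain k where k: "conjugates k (henon (\<sigma> s)) (henon_K (\<sigma> s)) (henon z) (henon_K z)"
    and "\<And>p. p \<in> henon_K z \<Longrightarrow> k (h (\<sigma> s) p) = p"
    and hk: "\<And>q. q \<in> henon_K (\<sigma> s) \<Longrightarrow> h (\<sigma> s) (k q) = q"
  proof (rule conjugates_inverse[OF h(2)[OF \<open>\<sigma> s \<in> B\<close>]])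
    show "henon z p \<in> henon_K z" if "p \<in> henon_K z" for p using henon_in_henon_K[OF z(1) that] .
  qed (rule that)
  define g' where "g' t p = (if t \<le> s then g t p else h (\<sigma> t) (k (g s p)))" for t p
  have kg: "conjugates (\<lambda>p. k (g s p)) (henon (\<sigma> 0)) ?K (henon z) (henon_K z)"
    using gs k by (rule conjugates_compose)
  have "continuous_on ({0..s} \<times> ?K \<union> {s..s'} \<times> ?K)
      (\<lambda>x. if fst x \<le> s then (\<lambda>(t, p). g t p) x else (\<lambda>(w, p). h w p) (\<sigma> (fst x), k (g s (snd x))))"
  proof (rule continuous_on_cases)
    have "closed ?K" by (intro compact_imp_closed compact_henon_K z)
    then show "closed ({0..s} \<times> ?K)" "closed ({s..s'} \<times> ?K)"
      by (simp_all add: closed_Times)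
    show "continuous_on ({0..s} \<times> ?K) (\<lambda>(t, p). g t p)" by (rule gc)
    have "continuous_on ({s..s'} \<times> ?K) (\<lambda>x. \<sigma> (fst x))"
      by (rule continuous_on_compose2[OF \<sigma>(1)]) (auto intro: continuous_intros)
    moreover have "continuous_on ({s..s'} \<times> ?K) (\<lambda>x. k (g s (snd x)))"
      by (rule continuous_on_compose2[OF conjugatesD(1)[OF kg]]) (auto intro: continuous_intros)
    ultimately have "continuous_on ({s..s'} \<times> ?K) (\<lambda>x. (\<sigma> (fst x), k (g s (snd x))))"
      by (rule continuous_on_Pair)
    then show "continuous_on ({s..s'} \<times> ?K) (\<lambda>x. (\<lambda>(w, p). h w p) (\<sigma> (fst x), k (g s (snd x))))"
    proof (rule continuous_on_compose2[OF h(1)])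
      show "(\<lambda>x. (\<sigma> (fst x), k (g s (snd x)))) ` ({s..s'} \<times> ?K) \<subseteq> B \<times> henon_K z"
      proof (rule image_subsetI)
        fix x assume "x \<in> {s..s'} \<times> ?K"
        then have "fst x \<in> {s..s'}" "snd x \<in> ?K" by (auto simp: mem_Times_iff)
        then show "(\<sigma> (fst x), k (g s (snd x))) \<in> B \<times> henon_K z"
          using \<sigma>(2) conjugatesD(5)[OF kg] by blast
      qed
    qed
    show "\<forall>x. x \<in> {0..s} \<times> ?K \<and> \<not> fst x \<le> s \<or> x \<in> {s..s'} \<times> ?K \<and> fst x \<le> s \<longrightarrow>
        (\<lambda>(t, p). g t p) x = (\<lambda>(w, p). h w p) (\<sigma> (fst x), k (g s (snd x)))"
    proof (intro allI impI)
      fix x assume x: "x \<in> {0..s} \<times> ?K \<and> \<not> fst x \<le> s \<or> x \<in> {s..s'} \<times> ?K \<and> fst x \<le> s"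
      then have "fst x = s" "snd x \<in> ?K" by (auto simp: mem_Times_iff)
      then show "(\<lambda>(t, p). g t p) x = (\<lambda>(w, p). h w p) (\<sigma> (fst x), k (g s (snd x)))"
        using hk[OF conjugatesD(5)[OF gs]] by (simp add: case_prod_beta)
    qed
  qed
  moreover have "{0..s} \<times> ?K \<union> {s..s'} \<times> ?K = {0..s'} \<times> ?K" using s by auto
  moreover have "(\<lambda>x. if fst x \<le> s then (\<lambda>(t, p). g t p) x else (\<lambda>(w, p). h w p) (\<sigma> (fst x), k (g s (snd x))))
      = (\<lambda>(t, p). g' t p)"
    by (auto simp: g'_def fun_eq_iff)
  ultimately have "continuous_on ({0..s'} \<times> ?K) (\<lambda>(t, p). g' t p)" by (simp only:)
  moreover have "conjugates (g' t) (henon (\<sigma> 0)) ?K (henon (\<sigma> t)) (henon_K (\<sigma> t))" if t: "t \<in> {0..s'}" for t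
  proof (cases "t \<le> s")
    case True
    then have "g' t = g t" by (simp add: g'_def fun_eq_iff)
    then show ?thesis using g t True by (simp add: partial_family_def)
  next
    case False
    then have "\<sigma> t \<in> B" using \<sigma>(2) t by auto
    have "g' t = (\<lambda>p. h (\<sigma> t) (k (g s p)))" using False by (simp add: g'_def fun_eq_iff)
    then show ?thesis using conjugates_compose[OF kg h(2)[OF \<open>\<sigma> t \<in> B\<close>]] by simp
  qed
  moreover have "g' 0 p = p" if "p \<in> ?K" for p using g s(1) that by (simp add: g'_def partial_family_def)
  ultimately have "partial_family \<sigma> s' g'" unfolding partial_family_def by blast
  then show ?thesis by (rule that)
qed

text \<open>A Lebesgue number for the cover by domains of local conjugacies, with uniform continuity
  of the path, gives a step length by which every partial family extends.\<close>

lemma conjugacy_family_exists: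
  assumes path: "path \<sigma>" and H: "path_image \<sigma> \<subseteq> horseshoe_locus"
  obtains g where "conjugacy_family \<sigma> g"
proof -
  define good where "good B \<longleftrightarrow> open B \<and> (\<exists>z h. snd z \<noteq> 0 \<and> continuous_on (B \<times> henon_K z) (\<lambda>(w, p). h w p) \<and>
      (\<forall>w\<in>B. conjugates (h w) (henon z) (henon_K z) (henon w) (henon_K w)))"
    for B :: "(complex \<times> complex) set"
  have "path_image \<sigma> \<subseteq> \<Union>{B. good B}"
  proof
    fix z assume "z \<in> path_image \<sigma>"
    then have z: "z \<in> horseshoe_locus" using H by blast
    obtain \<delta> h where \<delta>: "0 < \<delta>" and "continuous_on (ball z \<delta> \<times> henon_K z) (\<lambda>(w, p). h w p)"
      "\<And>w. w \<in> ball z \<delta> \<Longrightarrow> conjugates (h w) (henon z) (henon_K z) (henon w) (henon_K w)"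
      using horseshoe_locus_local_conjugacy[OF z] by metis
    then have "good (ball z \<delta>)"
      unfolding good_def using horseshoe_locusD(1)[OF z] by blast
    then show "z \<in> \<Union>{B. good B}" using \<delta> by auto
  qed
  then obtain e where e: "0 < e" "\<And>x. x \<in> path_image \<sigma> \<Longrightarrow> \<exists>B\<in>{B. good B}. ball x e \<subseteq> B"
  proof (rule Heine_Borel_lemma[OF compact_path_image[OF path]])
    show "open B" if "B \<in> {B. good B}" for B using that by (simp add: good_def)
  qed (rule that)
  have uc: "uniformly_continuous_on {0..1} \<sigma>"
    using path unfolding path_def by (intro compact_uniformly_continuous) auto
  then obtain d where d: "0 < d" "\<And>s t. s \<in> {0..1} \<Longrightarrow> t \<in> {0..1} \<Longrightarrow> dist t s < d \<Longrightarrow> dist (\<sigma> t) (\<sigma> s) < e"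
    using e(1) unfolding uniformly_continuous_on_def by metis
  have \<sigma>H: "\<sigma> t \<in> path_image \<sigma>" if "t \<in> {0..1}" for t using that by (simp add: path_image_def)
  have z0: "snd (\<sigma> 0) \<noteq> 0" using horseshoe_locusD(1)[OF subsetD[OF H \<sigma>H[of 0]]] by simp
  have "\<exists>g. partial_family \<sigma> (min 1 (real n * (d / 2))) g" for n
  proof (induction n)
    case 0
    have "continuous_on ({0} \<times> henon_K (\<sigma> 0)) (\<lambda>(t, p). p)"
      by (simp add: case_prod_beta) (intro continuous_intros)
    then have "partial_family \<sigma> 0 (\<lambda>t p. p)"
      by (simp add: partial_family_def conjugates_id)
    then show ?case by auto
  next
    case (Suc n)
    let ?s = "min 1 (real n * (d / 2))" and ?s' = "min 1 (real (Suc n) * (d / 2))"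
    obtain g where g: "partial_family \<sigma> ?s g" using Suc by blast
    have s: "0 \<le> ?s" "?s \<le> 1" "?s \<le> ?s'" "?s' \<le> 1" "?s' - ?s < d"
      using d(1) by (auto simp: algebra_simps min_def)
    obtain B where B: "good B" "ball (\<sigma> ?s) e \<subseteq> B" using e(2)[OF \<sigma>H[of ?s]] s by auto
    then obtain z h where zh: "snd z \<noteq> 0" "continuous_on (B \<times> henon_K z) (\<lambda>(w, p). h w p)"
      "\<And>w. w \<in> B \<Longrightarrow> conjugates (h w) (henon z) (henon_K z) (henon w) (henon_K w)"
      unfolding good_def by blast
    have \<sigma>B: "\<sigma> t \<in> B" if t: "t \<in> {?s..?s'}" for t
    proof -
      have "t \<in> {0..1}" "?s \<in> {0..1}" "dist t ?s < d"
        using t s unfolding atLeastAtMost_iff dist_real_def by linarith+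
      then have "dist (\<sigma> t) (\<sigma> ?s) < e" by (intro d(2))
      then show ?thesis using B(2) by (auto simp: dist_commute)
    qed
    have "continuous_on {?s..?s'} \<sigma>"
      using path unfolding path_def
    proof (rule continuous_on_subset)
      show "{?s..?s'} \<subseteq> {0..1}" unfolding atLeastatMost_subset_iff using s by blast
    qed
    then show ?case using partial_family_extend[OF g s(1,3) _ \<sigma>B zh(1) z0 zh(2,3)] by blast
  qed
  moreover obtain n where "1 \<le> real n * (d / 2)"
    using reals_Archimedean3[of "d / 2"] d(1) by (meson half_gt_zero less_imp_le)
  ultimately have "\<exists>g. partial_family \<sigma> 1 g" by (metis min.absorb1)
  then show ?thesis using that unfolding conjugacy_family_iff_partial by blast
qed

lemma conjugacy_familyD:
  assumes "conjugacy_family \<sigma> g"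
  shows "continuous_on ({0..1} \<times> henon_K (\<sigma> 0)) (\<lambda>(t, p). g t p)"
    and "\<And>t. t \<in> {0..1} \<Longrightarrow> conjugates (g t) (henon (\<sigma> 0)) (henon_K (\<sigma> 0)) (henon (\<sigma> t)) (henon_K (\<sigma> t))"
    and "\<And>p. p \<in> henon_K (\<sigma> 0) \<Longrightarrow> g 0 p = p"
  using assms by (auto simp: conjugacy_family_def)

text \<open>Uniform continuity on a compact product controls a single time of all orbits, and
  equivariance transfers this to all times \<open>n\<close> with the same \<open>d\<close>.\<close>

lemma conjugacy_family_near:
  assumes g: "conjugacy_family \<sigma> g" and H: "\<And>t. t \<in> {0..1} \<Longrightarrow> snd (\<sigma> t) \<noteq> 0" and r: "0 < r"
  obtains d where "0 < d" "\<And>s t p n. s \<in> {0..1} \<Longrightarrow> t \<in> {0..1} \<Longrightarrow> \<bar>s - t\<bar> < d \<Longrightarrow> p \<in> henon_K (\<sigma> 0) \<Longrightarrow>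
    cmod (orb (\<sigma> s) (g s p) n - orb (\<sigma> t) (g t p) n) \<le> r"
proof -
  let ?K = "henon_K (\<sigma> 0)"
  have z0: "snd (\<sigma> 0) \<noteq> 0" using H[of 0] by simp
  have "uniformly_continuous_on ({0..1} \<times> ?K) (\<lambda>(t, p). g t p)"
    using conjugacy_familyD(1)[OF g] compact_henon_K[OF z0]
    by (intro compact_uniformly_continuous compact_Times) auto
  then obtain d where d: "0 < d" "\<And>x y. x \<in> {0..1} \<times> ?K \<Longrightarrow> y \<in> {0..1} \<times> ?K \<Longrightarrow> dist y x < d \<Longrightarrow>
      dist ((\<lambda>(t, p). g t p) y) ((\<lambda>(t, p). g t p) x) < r"
    using r unfolding uniformly_continuous_on_def by metis
  show ?thesis
  proof (rule that[OF d(1)])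
    fix s t p n assume s: "s \<in> {0..1}" and t: "t \<in> {0..1}" and st: "\<bar>s - t\<bar> < d" and p: "p \<in> ?K"
    let ?q = "int_iter (henon (\<sigma> 0)) n p"
    have q: "?q \<in> ?K" using int_iter_in_henon_K[OF z0 p] .
    have "dist (s, ?q) (t, ?q) < d" using st by (simp add: dist_Pair_Pair dist_real_def)
    then have "dist (g s ?q) (g t ?q) < r" using d(2)[of "(t, ?q)" "(s, ?q)"] s t q by simp
    then have "dist (fst (g s ?q)) (fst (g t ?q)) < r" using dist_fst_le le_less_trans by blast
    moreover have "orb (\<sigma> u) (g u p) n = fst (g u ?q)" if "u \<in> {0..1}" for u
      using conjugates_int_iter[OF conjugacy_familyD(2)[OF g that] z0 H[OF that] p] by (simp add: orb_def)
    ultimately show "cmod (orb (\<sigma> s) (g s p) n - orb (\<sigma> t) (g t p) n) \<le> r"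
      using s t by (simp add: dist_norm)
  qed
qed

text \<open>The times of agreement form a closed set. It is also open: near an agreement time both
  families give points whose orbits are near the same orbit, and only one such point exists.\<close>

lemma conjugacy_family_unique:
  assumes path: "path \<sigma>" and H: "path_image \<sigma> \<subseteq> horseshoe_locus"
    and f: "conjugacy_family \<sigma> f" and g: "conjugacy_family \<sigma> g"
    and t: "t \<in> {0..1}" and p: "p \<in> henon_K (\<sigma> 0)"
  shows "f t p = g t p"
proof -
  let ?K = "henon_K (\<sigma> 0)"
  define T where "T = {t \<in> {0..1}. \<forall>p\<in>?K. f t p = g t p}"
  have \<sigma>H: "\<sigma> t \<in> horseshoe_locus" if "t \<in> {0..1}" for t using that H by (auto simp: path_image_def)
  note \<sigma>0 = horseshoe_locusD(1)[OF \<sigma>H]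
  have cont: "continuous_on {0..1} (\<lambda>t. k t p)" if k: "conjugacy_family \<sigma> k" and p: "p \<in> ?K" for k p
  proof -
    have "continuous_on {0..1} (\<lambda>t. (\<lambda>(t, p). k t p) (t, p))"
      by (rule continuous_on_compose2[OF conjugacy_familyD(1)[OF k]])
        (use p in \<open>auto intro!: continuous_intros\<close>)
    then show ?thesis by simp
  qed
  have "closedin (top_of_set {0..1}) T"
  proof -
    have "closedin (top_of_set {0..1}) {t \<in> {0..1}. f t p = g t p}" if "p \<in> ?K" for p
    proof -
      have "closedin (top_of_set {0..1}) ({0..1} \<inter> (\<lambda>t. f t p - g t p) -` {0})"
        using cont[OF f that] cont[OF g that]
        by (intro continuous_closedin_preimage continuous_on_diff) auto
      then show ?thesis by (simp add: vimage_def Int_def)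
    qed
    moreover have "T = {0..1} \<inter> (\<Inter>p\<in>?K. {t \<in> {0..1}. f t p = g t p})" by (auto simp: T_def)
    ultimately show ?thesis
      by (cases "?K = {}") (auto intro!: closedin_Int closedin_INT)
  qed
  moreover have "openin (top_of_set {0..1}) T"
    unfolding openin_euclidean_subtopology_iff
  proof (intro conjI ballI)
    show "T \<subseteq> {0..1}" by (auto simp: T_def)
    fix s assume s: "s \<in> T"
    then have s01: "s \<in> {0..1}" and fg: "\<And>p. p \<in> ?K \<Longrightarrow> f s p = g s p" by (auto simp: T_def)
    obtain \<delta> r h where \<delta>: "0 < \<delta>" and r: "0 < r"
      and h: "\<And>w p p'. w \<in> ball (\<sigma> s) \<delta> \<Longrightarrow> p \<in> henon_K (\<sigma> s) \<Longrightarrow> p' \<in> henon_K w \<Longrightarrow>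
       (\<And>n. cmod (orb (\<sigma> s) p n - orb w p' n) \<le> r) \<Longrightarrow> p' = h w p"
      using horseshoe_locus_local_conjugacy[OF \<sigma>H[OF s01]] by metis
    obtain d1 where d1: "0 < d1" "\<And>s t p n. s \<in> {0..1} \<Longrightarrow> t \<in> {0..1} \<Longrightarrow> \<bar>s - t\<bar> < d1 \<Longrightarrow> p \<in> ?K \<Longrightarrow>
        cmod (orb (\<sigma> s) (f s p) n - orb (\<sigma> t) (f t p) n) \<le> r"
      using conjugacy_family_near[OF f \<sigma>0 r] by blast
    obtain d2 where d2: "0 < d2" "\<And>s t p n. s \<in> {0..1} \<Longrightarrow> t \<in> {0..1} \<Longrightarrow> \<bar>s - t\<bar> < d2 \<Longrightarrow> p \<in> ?K \<Longrightarrow>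
        cmod (orb (\<sigma> s) (g s p) n - orb (\<sigma> t) (g t p) n) \<le> r"
      using conjugacy_family_near[OF g \<sigma>0 r] by blast
    obtain d3 where d3: "0 < d3" "\<And>t. t \<in> {0..1} \<Longrightarrow> dist t s < d3 \<Longrightarrow> dist (\<sigma> t) (\<sigma> s) < \<delta>"
      using path s01 \<delta> unfolding path_def continuous_on_iff by metis
    have "t \<in> T" if t: "t \<in> {0..1}" and ts: "dist t s < min d1 (min d2 d3)" for t
    proof -
      have w: "\<sigma> t \<in> ball (\<sigma> s) \<delta>" using d3(2)[OF t] ts by (simp add: dist_commute)
      have st: "\<bar>s - t\<bar> < d1" "\<bar>s - t\<bar> < d2"
        using ts by (simp_all add: dist_real_def abs_minus_commute)
      have "f t p = g t p" if p: "p \<in> ?K" for p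
      proof -
        have "f t p = h (\<sigma> t) (f s p)"
          using d1(2)[OF s01 t st(1) p]
          by (intro h w conjugatesD(5)[OF conjugacy_familyD(2)[OF f s01]] conjugatesD(5)[OF conjugacy_familyD(2)[OF f t]] p)

        moreover have "g t p = h (\<sigma> t) (g s p)"
          using d2(2)[OF s01 t st(2) p]
          by (intro h w conjugatesD(5)[OF conjugacy_familyD(2)[OF g s01]] conjugatesD(5)[OF conjugacy_familyD(2)[OF g t]] p)

        ultimately show ?thesis using fg[OF p] by simp
      qed
      then show ?thesis using t by (simp add: T_def)
    qed
    then show "\<exists>e>0. \<forall>x'\<in>{0..1}. dist x' s < e \<longrightarrow> x' \<in> T"
      using d1(1) d2(1) d3(1) by (intro exI[of _ "min d1 (min d2 d3)"]) auto
  qed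
  moreover have "0 \<in> T" using conjugacy_familyD(3)[OF f] conjugacy_familyD(3)[OF g] by (simp add: T_def)
  ultimately have "T = {0..1}"
    using connected_clopen[of "{0..1::real}"] connected_Icc by blast
  then show ?thesis using t p by (auto simp: T_def)
qed

lemma transport_eq:
  assumes "path \<sigma>" "path_image \<sigma> \<subseteq> horseshoe_locus" "conjugacy_family \<sigma> g"
  shows "transport \<sigma> = restrict (g 1) (henon_K (\<sigma> 0))"
  unfolding transport_def
proof (rule the_equality)
  show "\<exists>g'. conjugacy_family \<sigma> g' \<and> restrict (g 1) (henon_K (\<sigma> 0)) = restrict (g' 1) (henon_K (\<sigma> 0))"
    using assms(3) by blast
  fix k assume "\<exists>g'. conjugacy_family \<sigma> g' \<and> k = restrict (g' 1) (henon_K (\<sigma> 0))"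
  then obtain g' where g': "conjugacy_family \<sigma> g'" "k = restrict (g' 1) (henon_K (\<sigma> 0))" by blast
  have "g' 1 p = g 1 p" if "p \<in> henon_K (\<sigma> 0)" for p
    using conjugacy_family_unique[OF assms(1,2) g'(1) assms(3) _ that] by simp
  then show "k = restrict (g 1) (henon_K (\<sigma> 0))" unfolding g'(2) by (rule restrict_ext)
qed

section \<open>Complex conjugation\<close>

definition cj :: "complex \<times> complex \<Rightarrow> complex \<times> complex" where
  "cj p = (cnj (fst p), cnj (snd p))"

lemma fst_cj [simp]: "fst (cj p) = cnj (fst p)" and snd_cj [simp]: "snd (cj p) = cnj (snd p)"
  and cj_cj [simp]: "cj (cj p) = p"
  by (simp_all add: cj_def)

lemma continuous_on_cj [continuous_intros]: "continuous_on S f \<Longrightarrow> continuous_on S (\<lambda>x. cj (f x))"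
  unfolding cj_def by (intro continuous_intros)

lemma real_points_iff: "p \<in> real_points \<longleftrightarrow> cj p = p"
  unfolding real_points_def mem_Times_iff by (simp add: prod_eq_iff Reals_cnj_iff)

lemma cj_henon: "cj (henon z p) = henon (cj z) (cj p)"
  by (simp add: prod_eq_iff fst_henon)

lemma orb_cj:
  assumes z: "snd z \<noteq> 0"
  shows "orb (cj z) (cj p) n = cnj (orb z p n)"
proof -
  have "orb (cj z) (cnj (orb z p 0), cnj (orb z p (-1))) = (\<lambda>n. cnj (orb z p n))"
    by (rule orb_of_recurrence) (simp_all add: z orb_rec[OF z])
  moreover have "(cnj (orb z p 0), cnj (orb z p (-1))) = cj p"
    using orb_0[OF z, of p] by (metis cj_def fst_conv snd_conv)
  ultimately show ?thesis by simp
qed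

lemma cj_in_henon_K: "snd z \<noteq> 0 \<Longrightarrow> p \<in> henon_K z \<Longrightarrow> cj p \<in> henon_K (cj z)"
  by (auto intro!: in_henon_K_le[where B = "escape_radius z"] simp: orb_cj orb_le_escape_radius)

lemma conjugates_cj:
  assumes z: "snd z \<noteq> 0"
  shows "conjugates cj (henon z) (henon_K z) (henon (cj z)) (henon_K (cj z))"
proof (rule conjugatesI[OF compact_henon_K[OF z]])
  show "continuous_on (henon_K z) cj" by (intro continuous_on_cj continuous_on_id)
  show "inj_on cj (henon_K z)" by (rule inj_on_inverseI[of _ cj]) simp
  show "cj ` henon_K z = henon_K (cj z)"
  proof
    show "cj ` henon_K z \<subseteq> henon_K (cj z)" using cj_in_henon_K[OF z] by blast
    show "henon_K (cj z) \<subseteq> cj ` henon_K z"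
    proof
      fix p assume "p \<in> henon_K (cj z)"
      then have "cj p \<in> henon_K z" using cj_in_henon_K[of "cj z" p] z by simp
      then have "cj (cj p) \<in> cj ` henon_K z" by (rule imageI)
      then show "p \<in> cj ` henon_K z" by simp
    qed
  qed
qed (rule cj_henon)

lemma unif_inv_cnj:
  assumes "unif_inv M c b"
  shows "unif_inv M (\<lambda>n. cnj (c n)) (cnj b)"
  unfolding unif_inv_def
proof (intro conjI allI impI)
  note M = unif_invD[OF assms]
  have lin: "cnj (lin_op (\<lambda>n. cnj (c n)) (cnj b) u n) = lin_op c b (\<lambda>n. cnj (u n)) n" for u n
    by (simp add: lin_op_def)
  have bdd: "bounded (range (\<lambda>n. cnj (u n)))" if "bounded (range u)" for u :: "int \<Rightarrow> complex"
    using that by (auto simp: bounded_iff)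
  show "0 < M" by (rule M(1))
  {
    fix u :: "int \<Rightarrow> complex" and B n
    assume u: "bounded (range u)" and B: "\<forall>n. cmod (lin_op (\<lambda>n. cnj (c n)) (cnj b) u n) \<le> B"
    have "cmod (lin_op c b (\<lambda>n. cnj (u n)) n) \<le> B" for n
      using spec[OF B, of n] by (simp flip: lin)
    then show "cmod (u n) \<le> M * B"
      using M(2)[OF bdd[OF u], of B n] by simp
  }
  fix g :: "int \<Rightarrow> complex" assume "bounded (range g)"
  then obtain u where u: "bounded (range u)" "lin_op c b u = (\<lambda>n. cnj (g n))"
    using M(3)[OF bdd] by blast
  have "cnj (lin_op (\<lambda>n. cnj (c n)) (cnj b) (\<lambda>n. cnj (u n)) n) = cnj (g n)" for n
    by (simp add: lin u(2))
  then have "lin_op (\<lambda>n. cnj (c n)) (cnj b) (\<lambda>n. cnj (u n)) = g"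
    by (simp add: fun_eq_iff)
  then show "\<exists>u. bounded (range u) \<and> lin_op (\<lambda>n. cnj (c n)) (cnj b) u = g"
    using bdd[OF u(1)] by blast
qed

text \<open>Hyperbolicity is transferred through the criterion on \<open>lin_op\<close>, where
  conjugation simply acts entrywise on sequences.\<close>

lemma cj_in_horseshoe_locus:
  assumes zH: "z \<in> horseshoe_locus"
  shows "cj z \<in> horseshoe_locus"
proof -
  note z = horseshoe_locusD[OF zH]
  have cz: "snd (cj z) \<noteq> 0" using z(1) by simp
  obtain M where M: "0 < M" "\<And>p. p \<in> henon_K z \<Longrightarrow> unif_inv M (orb z p) (snd z)"
    using z(2) hyperbolic_iff_unif_inv_on[OF z(1)] unfolding unif_inv_on_def by blast
  have "unif_inv M (orb (cj z) p) (snd (cj z))" if "p \<in> henon_K (cj z)" for p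
  proof -
    have "cj p \<in> henon_K z" using cj_in_henon_K[OF cz that] by simp
    moreover have "orb (cj z) p = (\<lambda>n. cnj (orb z (cj p) n))"
      using orb_cj[OF z(1), of "cj p"] by (simp add: fun_eq_iff)
    ultimately show ?thesis using unif_inv_cnj[OF M(2)] by simp
  qed
  then have "hyperbolic_set (henon (cj z)) (henon_K (cj z))"
    using hyperbolic_iff_unif_inv_on[OF cz] M(1) unfolding unif_inv_on_def by blast
  moreover have "top_conjugate (henon (cj z)) (henon_K (cj z)) (henon z) (henon_K z)"
    using conjugates_cj[OF cz] unfolding top_conjugate_def by auto
  then have "top_conjugate (henon (cj z)) (henon_K (cj z)) shift (UNIV :: sigma2 set)"
    using z(3) by (rule top_conjugate_trans)
  ultimately show ?thesis using cz by (simp add: horseshoe_locus_def)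
qed

lemma cj_HOV: "z \<in> HOV \<Longrightarrow> cj z \<in> HOV"
  by (auto simp: HOV_def cj_def)

text \<open>A point of \<open>H0\<close> shows that some component contains \<open>HOV\<close>, and
  a point of \<open>HOV\<close> that there is only one. That \<open>HOV\<close> lies in a single
  component is thus already implied by \<open>w \<in> H0\<close>.\<close>

lemma H0_component:
  assumes "z0 \<in> HOV" "w \<in> H0"
  shows "H0 \<in> components horseshoe_locus" "HOV \<subseteq> H0"
proof -
  obtain C where C: "C \<in> components horseshoe_locus" "HOV \<subseteq> C" using assms(2) by (auto simp: H0_def)
  have "C' = C" if "C' \<in> components horseshoe_locus" "HOV \<subseteq> C'" for C'
    using components_eq[OF that(1) C(1)] assms(1) that(2) C(2) by blast
  then have "{C \<in> components horseshoe_locus. HOV \<subseteq> C} = {C}" using C by blast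
  then have "H0 = C" by (simp add: H0_def)
  then show "H0 \<in> components horseshoe_locus" "HOV \<subseteq> H0" using C by simp_all
qed

lemma H0_subset: "H0 \<subseteq> horseshoe_locus"
  unfolding H0_def using in_components_subset by blast

lemma path_connected_H0:
  assumes "z0 \<in> HOV" "w \<in> H0"
  shows "path_connected H0"
  using H0_component(1)[OF assms] open_components[OF open_horseshoe_locus] in_components_connected
    connected_open_path_connected by blast

text \<open>The conjugate of \<open>H0\<close> is connected, lies in the locus, and meets
  \<open>H0\<close> because \<open>HOV\<close> is invariant under conjugation.\<close>

lemma cj_in_H0:
  assumes "z0 \<in> HOV" "w \<in> H0"
  shows "cj w \<in> H0"
proof -
  note C = H0_component[OF assms]
  have "cj ` H0 \<subseteq> horseshoe_locus" using cj_in_horseshoe_locus H0_subset by blast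
  moreover have "connected (cj ` H0)"
    using in_components_connected[OF C(1)]
    by (intro connected_continuous_image continuous_on_cj continuous_on_id)
  moreover have "cj (cj z0) \<in> cj ` H0" using cj_HOV[OF assms(1)] C(2) by (intro imageI) blast
  then have "H0 \<inter> cj ` H0 \<noteq> {}" using assms(1) C(2) by auto
  ultimately have "cj ` H0 \<subseteq> H0" using components_maximal[OF C(1)] by blast
  then show ?thesis using assms(2) by blast
qed

section \<open>Injectivity of the coding\<close>

text \<open>A bounded orbit with prescribed signs is a fixed point of
  \<open>(u n) \<mapsto> (\<plusminus> sqrt (- a + u (n + 1) + b u (n - 1)))\<close>.  With \<open>S\<^sup>2 = 2|a|\<close> this map sends the
  polydisc of radius \<open>S\<close> into itself and contracts the metric \<open>|du| / (S\<^sup>2 - |u|\<^sup>2)\<close>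
  by the factor \<open>sqrt (2 (1 + |b|) / S)\<close>.\<close>

lemma hov_contraction_normalized:
  fixes \<theta> \<mu> s :: real
  assumes \<theta>: "0 \<le> \<theta>" "\<theta> \<le> 1" and \<mu>: "0 \<le> \<mu>" "\<mu> \<le> 1" and s: "\<bar>s\<bar> \<le> \<theta> * \<mu>"
  shows "\<theta> * (1 - \<mu>\<^sup>2)\<^sup>2 \<le> 2 * (1 + s) * (1 - s)\<^sup>2"
proof -
  have tm: "0 \<le> \<theta> * \<mu>" "\<theta> * \<mu> \<le> \<mu>" "\<theta> * \<mu> \<le> 1"
    using \<theta> \<mu> by (simp_all add: mult_left_le_one_le mult_le_one)
  have "s\<^sup>2 \<le> (\<theta> * \<mu>)\<^sup>2" using s tm(1) by (simp add: abs_le_square_iff[symmetric])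
  also have "\<dots> \<le> \<mu>\<^sup>2" using tm by (intro power_mono)
  finally have s2: "1 - \<mu>\<^sup>2 \<le> 1 - s\<^sup>2" by simp
  have \<mu>2: "0 \<le> 1 - \<mu>\<^sup>2" using \<mu> by (simp add: power_le_one)
  have "\<theta> * (1 - \<mu>\<^sup>2 + 2 * \<mu>) \<le> 1 * 2"
  proof (rule mult_mono)
    have "0 \<le> (1 - \<mu>)\<^sup>2" by simp
    then show "1 - \<mu>\<^sup>2 + 2 * \<mu> \<le> 2" by (simp add: power2_eq_square algebra_simps)
  qed (use \<theta> \<mu> \<mu>2 in auto)
  then have "\<theta> * (1 - \<mu>\<^sup>2) \<le> 2 * (1 - \<theta> * \<mu>)" by (simp add: algebra_simps)
  then have "\<theta> * (1 - \<mu>\<^sup>2) * (1 - \<mu>\<^sup>2) \<le> 2 * (1 - \<theta> * \<mu>) * (1 - \<mu>\<^sup>2)"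
    using \<mu>2 by (rule mult_right_mono)
  also have "\<dots> \<le> 2 * (1 - s) * (1 - s\<^sup>2)"
    using s tm \<mu>2 s2 by (intro mult_mono) auto
  finally show ?thesis by (simp add: power2_eq_square algebra_simps)
qed

text \<open>Since \<open>y\<^sup>2 = u + b * v - a\<close>, tangent vectors satisfy
  \<open>2 * y * dy = du + b * dv\<close>, so the third claim is contraction by
  \<open>sqrt \<theta>\<close> in the metric of the disc. Here \<open>\<mu>\<close> is the weighted
  mean of \<open>cmod u\<close> and \<open>cmod v\<close> divided by \<open>S\<close>, and
  \<open>s\<close> is the relative deviation of \<open>cmod w\<close> from \<open>cmod a\<close>; in
  these variables the claim becomes \<open>hov_contraction_normalized\<close>.\<close>

lemma hov_contraction:
  fixes u v b y w a :: complex and S :: real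
  assumes S: "0 < S" "S\<^sup>2 = 2 * cmod a" and b: "2 * (1 + cmod b) < S"
    and u: "cmod u < S" "cmod v < S" and w: "w = u + b * v - a" and y: "y\<^sup>2 = w"
  defines "\<theta> \<equiv> 2 * (1 + cmod b) / S"
  shows "cmod (w + a) < cmod a" "cmod y < S"
    and "(S\<^sup>2 - (cmod u)\<^sup>2) + cmod b * (S\<^sup>2 - (cmod v)\<^sup>2) \<le> sqrt \<theta> * (2 * cmod y) * (S\<^sup>2 - (cmod y)\<^sup>2)"
proof -
  define \<beta> where "\<beta> = 1 + cmod b"
  have \<beta>: "0 < \<beta>" by (simp add: \<beta>_def add_pos_nonneg)
  have \<theta>S: "\<theta> * S = 2 * \<beta>" using S by (simp add: \<theta>_def \<beta>_def)
  have \<theta>: "0 < \<theta>" "\<theta> < 1" using S b \<beta> by (simp_all add: \<theta>_def \<beta>_def)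
  define \<mu> where "\<mu> = (cmod u + cmod b * cmod v) / (\<beta> * S)"
  have m: "cmod u + cmod b * cmod v = \<beta> * S * \<mu>" using \<beta> S by (simp add: \<mu>_def)
  have "cmod b * cmod v \<le> cmod b * S" using u by (intro mult_left_mono) auto
  then have "cmod u + cmod b * cmod v < \<beta> * S" using u by (simp add: \<beta>_def algebra_simps)
  then have \<mu>: "0 \<le> \<mu>" "\<mu> < 1" using \<beta> S by (simp_all add: \<mu>_def)
  have \<beta>S: "\<beta> * S = \<theta> * cmod a" using \<theta>S S by (simp add: power2_eq_square) (metis mult.assoc mult.commute mult_cancel_left mult_left_cancel zero_neq_numeral)
  have "cmod (w + a) \<le> cmod u + cmod b * cmod v"
    using norm_triangle_ineq[of u "b * v"] by (simp add: w norm_mult)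
  then have wa: "cmod (w + a) \<le> \<theta> * \<mu> * cmod a" using m unfolding \<beta>S by (simp add: mult_ac)
  have a: "0 < cmod a" using S by (metis mult_zero_right norm_eq_zero zero_less_norm_iff zero_less_power less_irrefl)
  have tm: "\<theta> * \<mu> < 1" using \<theta> \<mu> by (metis less_eq_real_def mult_le_one mult_less_cancel_left2 mult_zero_right order_less_le_trans zero_less_one)
  then have "\<theta> * \<mu> * cmod a < 1 * cmod a" using a by (intro mult_strict_right_mono)
  then show wa1: "cmod (w + a) < cmod a" using wa by linarith
  define Y where "Y = cmod y"
  have Y2: "Y\<^sup>2 = cmod w" unfolding Y_def using y by (simp flip: norm_power)
  have wle: "\<bar>cmod w - cmod a\<bar> \<le> \<theta> * \<mu> * cmod a"
    using norm_triangle_ineq3[of w "- a"] wa by simp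
  have "Y\<^sup>2 < S\<^sup>2" using wle wa1 norm_triangle_ineq4[of "w + a" a] S by (simp add: Y2)
  then show YS: "cmod y < S" using S(1) unfolding Y_def by (simp add: power2_less_imp_less)
  define s where "s = cmod w / cmod a - 1"
  have ws: "cmod w = cmod a * (1 + s)" using a by (simp add: s_def)
  have s: "\<bar>s\<bar> \<le> \<theta> * \<mu>"
  proof -
    have "cmod a * \<bar>s\<bar> \<le> cmod a * (\<theta> * \<mu>)" using wle ws a by (simp add: abs_mult algebra_simps)
    then show ?thesis using a by simp
  qed
  \<comment> \<open>Cauchy-Schwarz with weights 1 and \<open>cmod b\<close>: the square of the mean
    is at most the mean of the squares.\<close>
  have "(cmod u + cmod b * cmod v)\<^sup>2 \<le> \<beta> * ((cmod u)\<^sup>2 + cmod b * (cmod v)\<^sup>2)"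
  proof -
    have "0 \<le> cmod b * (cmod u - cmod v)\<^sup>2" by simp
    then show ?thesis by (simp add: \<beta>_def power2_eq_square algebra_simps)
  qed
  then have "\<beta> * (\<beta> * (S\<^sup>2 * \<mu>\<^sup>2)) \<le> \<beta> * ((cmod u)\<^sup>2 + cmod b * (cmod v)\<^sup>2)"
    unfolding m by (simp add: power2_eq_square mult_ac)
  then have "\<beta> * (S\<^sup>2 * \<mu>\<^sup>2) \<le> (cmod u)\<^sup>2 + cmod b * (cmod v)\<^sup>2" using \<beta> by simp
  then have "(S\<^sup>2 - (cmod u)\<^sup>2) + cmod b * (S\<^sup>2 - (cmod v)\<^sup>2) \<le> \<beta> * S\<^sup>2 * (1 - \<mu>\<^sup>2)"
    by (simp add: \<beta>_def algebra_simps)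
  also have "\<beta> * S\<^sup>2 * (1 - \<mu>\<^sup>2) \<le> sqrt \<theta> * (2 * Y) * (S\<^sup>2 - Y\<^sup>2)"
  \<comment> \<open>Squaring removes \<open>sqrt \<theta>\<close> and replaces \<open>Y\<close> by
    its square, which is \<open>cmod w\<close>.\<close>
  proof (rule power2_le_imp_le)
    have A: "S\<^sup>2 - Y\<^sup>2 = cmod a * (1 - s)" by (simp add: Y2 ws S(2) algebra_simps)
    show "0 \<le> sqrt \<theta> * (2 * Y) * (S\<^sup>2 - Y\<^sup>2)"
      using \<open>Y\<^sup>2 < S\<^sup>2\<close> \<theta> by (auto simp: Y_def)
    have "(\<beta> * S\<^sup>2 * (1 - \<mu>\<^sup>2))\<^sup>2 = (\<beta> * S)\<^sup>2 * S\<^sup>2 * (1 - \<mu>\<^sup>2)\<^sup>2"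
      by (simp add: power2_eq_square)
    also have "\<dots> = 2 * \<theta> * cmod a ^ 3 * (\<theta> * (1 - \<mu>\<^sup>2)\<^sup>2)"
      unfolding \<beta>S S(2) by (simp add: power2_eq_square power3_eq_cube)
    also have "\<dots> \<le> 2 * \<theta> * cmod a ^ 3 * (2 * (1 + s) * (1 - s)\<^sup>2)"
      using hov_contraction_normalized[of \<theta> \<mu> s] \<theta> \<mu> s by (intro mult_left_mono) auto
    also have "\<dots> = \<theta> * (4 * (cmod a * (1 + s))) * (cmod a * (1 - s))\<^sup>2"
      by (simp add: power2_eq_square power3_eq_cube)
    also have "\<dots> = (sqrt \<theta> * (2 * Y) * (S\<^sup>2 - Y\<^sup>2))\<^sup>2"
      unfolding A unfolding power_mult_distrib Y2 ws using \<theta> by simp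
    finally show "(\<beta> * S\<^sup>2 * (1 - \<mu>\<^sup>2))\<^sup>2 \<le> (sqrt \<theta> * (2 * Y) * (S\<^sup>2 - Y\<^sup>2))\<^sup>2" .
  qed
  finally show "(S\<^sup>2 - (cmod u)\<^sup>2) + cmod b * (S\<^sup>2 - (cmod v)\<^sup>2) \<le> sqrt \<theta> * (2 * cmod y) * (S\<^sup>2 - (cmod y)\<^sup>2)"
    by (simp add: Y_def)
qed

text \<open>If \<open>S \<le> T\<close>, both terms in the quadratic inequality for the supremum are
  at most half of its left side, the second one strictly. The gap below \<open>S\<close> keeps
  orbits in a region where the disc metric is bounded.\<close>

lemma hov_orbit_bound:
  fixes x :: "int \<Rightarrow> complex"
  assumes x: "\<And>n. x (n + 1) = (x n)\<^sup>2 + a - b * x (n - 1)" "bounded (range x)"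
    and S: "0 < S" "S\<^sup>2 = 2 * cmod a" and b: "2 * (1 + cmod b) < S"
  obtains T where "\<And>n. cmod (x n) \<le> T" "0 \<le> T" "T < S"
proof -
  obtain T where T: "\<And>n. cmod (x n) \<le> T" "T\<^sup>2 \<le> cmod a + (1 + cmod b) * T" "0 \<le> T"
    using bounded_recurrence_sup[OF x] by blast
  have "T < S"
  proof (rule ccontr)
    assume "\<not> T < S"
    then have TS: "S \<le> T" by simp
    have "2 * (1 + cmod b) * T < S * T" using b S TS by (intro mult_strict_right_mono) auto
    also have "S * T \<le> T\<^sup>2" using TS S by (simp add: power2_eq_square mult_right_mono)
    finally have "2 * ((1 + cmod b) * T) < T\<^sup>2" by (simp only: mult.assoc)
    moreover have "S\<^sup>2 \<le> T\<^sup>2" using TS S by (intro power_mono) auto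
    ultimately show False using T(2) S(2) by linarith
  qed
  then show ?thesis using that T by blast
qed

text \<open>The contraction is run on curves, without a distance function:
  \<open>good t \<gamma> D\<close> says that the curves \<open>\<gamma> n\<close> join
  \<open>x n\<close> to \<open>y n\<close> with metric speed at most \<open>t\<close>. Applying the
  inverse branches keeps the endpoints, which are fixed points, and multiplies the speed by
  \<open>\<kappa>\<close>; iteration forces the endpoints together.\<close>

lemma hov_same_signs_eq:
  fixes x y :: "int \<Rightarrow> complex" and a b S :: real
  assumes a: "a < 0" and S: "0 < S" "S\<^sup>2 = 2 * \<bar>a\<bar>" and b: "2 * (1 + \<bar>b\<bar>) < S"
    and x: "\<And>n. x (n + 1) = (x n)\<^sup>2 + of_real a - of_real b * x (n - 1)" "bounded (range x)"
    and y: "\<And>n. y (n + 1) = (y n)\<^sup>2 + of_real a - of_real b * y (n - 1)" "bounded (range y)"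
    and signs: "\<And>n. 0 < Re (x n) \<longleftrightarrow> 0 < Re (y n)"
  shows "x = y"
proof -
  let ?a = "complex_of_real a" and ?b = "complex_of_real b"
  have S': "S\<^sup>2 = 2 * cmod ?a" and b': "2 * (1 + cmod ?b) < S" using S b by simp_all
  note contr = hov_contraction[OF S(1) S' b' _ _ refl]
  define \<theta> where "\<theta> = 2 * (1 + cmod ?b) / S"
  have \<theta>: "0 \<le> \<theta>" "\<theta> < 1" using b S(1) by (auto simp: \<theta>_def)
  define \<kappa> where "\<kappa> = sqrt \<theta>"
  have \<kappa>: "0 \<le> \<kappa>" "\<kappa> < 1" using \<theta> by (simp_all add: \<kappa>_def)
  obtain Tx where Tx: "\<And>n. cmod (x n) \<le> Tx" "0 \<le> Tx" "Tx < S" using hov_orbit_bound[OF x S(1) S' b'] by blast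
  obtain Ty where Ty: "\<And>n. cmod (y n) \<le> Ty" "0 \<le> Ty" "Ty < S" using hov_orbit_bound[OF y S(1) S' b'] by blast
  define T where "T = max Tx Ty"
  have T: "cmod (x n) \<le> T" "cmod (y n) \<le> T" "0 \<le> T" "T < S" for n
    using Tx Ty by (auto simp: T_def le_max_iff_disj)
  define \<epsilon> :: "int \<Rightarrow> complex" where "\<epsilon> n = (if 0 < Re (x n) then 1 else - 1)" for n
  have \<epsilon>2: "\<epsilon> n * \<epsilon> n = 1" "cmod (\<epsilon> n) = 1" for n by (simp_all add: \<epsilon>_def)
  define W where "W u v = u + ?b * v - ?a" for u v
  have W_pos: "0 < Re (W u v)" if "cmod u < S" "cmod v < S" for u v
  proof -
    have "cmod (W u v + ?a) < cmod ?a"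
      unfolding W_def by (rule contr(1)[OF that power2_csqrt])
    then show ?thesis using abs_Re_le_cmod[of "W u v + ?a"] a by simp
  qed
  \<comment> \<open>\<open>W\<close> takes values in the right half-plane, where
    \<open>csqrt\<close> is smooth and picks the root with positive real part;
    \<open>\<epsilon> n\<close> restores the prescribed branch. Positivity of the square's real part
    also excludes \<open>Re (x' n) = 0\<close>, so a nonpositive sign means a negative one.\<close>
  have fixed: "\<epsilon> n * csqrt (W (x' (n + 1)) (x' (n - 1))) = x' n"
    if x': "\<And>n. x' (n + 1) = (x' n)\<^sup>2 + ?a - ?b * x' (n - 1)" and le: "\<And>n. cmod (x' n) < S"
      and sg: "\<And>n. 0 < Re (x n) \<longleftrightarrow> 0 < Re (x' n)" for x' n
  proof -
    have eq: "W (x' (n + 1)) (x' (n - 1)) = (\<epsilon> n * x' n)\<^sup>2"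
      using \<epsilon>2(1)[of n] unfolding W_def x' power2_eq_square
      by (simp add: algebra_simps)
    have "0 < Re ((\<epsilon> n * x' n)\<^sup>2)" using W_pos[OF le le] unfolding eq[symmetric] .
    then have "Re (\<epsilon> n * x' n) \<noteq> 0" by (auto simp: power2_eq_square)
    then have "0 < Re (\<epsilon> n * x' n)" using sg[of n] by (auto simp: \<epsilon>_def split: if_splits)
    then have "csqrt ((\<epsilon> n * x' n)\<^sup>2) = \<epsilon> n * x' n" by (intro csqrt_square) simp
    then show ?thesis unfolding eq using \<epsilon>2(1)[of n] by (simp flip: mult.assoc)
  qed
  have xS: "cmod (x n) < S" and yS: "cmod (y n) < S" for n using T by (meson le_less_trans)+
  define good where "good t \<gamma> D \<longleftrightarrow> (\<forall>n::int. \<gamma> n 0 = x n \<and> \<gamma> n 1 = y n \<and> (\<forall>\<tau>\<in>{0..1}.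
      (\<gamma> n has_vector_derivative D n \<tau>) (at \<tau> within {0..1}) \<and> cmod (\<gamma> n \<tau>) < S \<and>
      cmod (D n \<tau>) \<le> t * (S\<^sup>2 - (cmod (\<gamma> n \<tau>))\<^sup>2)))"
    for t :: real and \<gamma> D :: "int \<Rightarrow> real \<Rightarrow> complex"
  \<comment> \<open>Initial curves are straight segments: their Euclidean speed is at most
    \<open>2 * S\<close>, and they stay in the ball of radius \<open>T\<close>.\<close>
  define t0 where "t0 = 2 * S / (S\<^sup>2 - T\<^sup>2)"
  have ST: "0 < S\<^sup>2 - T\<^sup>2" using T by (simp add: power_strict_mono)
  have "good t0 (\<lambda>n \<tau>. x n + \<tau> *\<^sub>R (y n - x n)) (\<lambda>n \<tau>. y n - x n)"
    unfolding good_def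
  proof (intro allI conjI ballI)
    fix n :: int and \<tau> :: real assume \<tau>: "\<tau> \<in> {0..1}"
    show "((\<lambda>\<tau>. x n + \<tau> *\<^sub>R (y n - x n)) has_vector_derivative y n - x n) (at \<tau> within {0..1})"
      by (auto intro!: derivative_eq_intros)
    have "x n + \<tau> *\<^sub>R (y n - x n) = (1 - \<tau>) *\<^sub>R x n + \<tau> *\<^sub>R y n" by (simp add: algebra_simps)
    also have "cmod \<dots> \<le> (1 - \<tau>) * T + \<tau> * T"
      using \<tau> T by (intro order_trans[OF norm_triangle_ineq] add_mono) (auto intro: mult_left_mono)
    finally have le: "cmod (x n + \<tau> *\<^sub>R (y n - x n)) \<le> T" by (simp add: algebra_simps)
    then show "cmod (x n + \<tau> *\<^sub>R (y n - x n)) < S" using T(4) by linarith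
    have "cmod (y n - x n) \<le> 2 * S" using norm_triangle_ineq4[of "y n" "x n"] xS[of n] yS[of n] by linarith
    also have "\<dots> = t0 * (S\<^sup>2 - T\<^sup>2)" using ST by (simp add: t0_def)
    also have "\<dots> \<le> t0 * (S\<^sup>2 - (cmod (x n + \<tau> *\<^sub>R (y n - x n)))\<^sup>2)"
      using le ST S(1) by (intro mult_left_mono diff_left_mono power_mono) (auto simp: t0_def)
    finally show "cmod (y n - x n) \<le> t0 * (S\<^sup>2 - (cmod (x n + \<tau> *\<^sub>R (y n - x n)))\<^sup>2)" .
  qed auto
  then have base: "\<exists>\<gamma> D. good t0 \<gamma> D" by blast
  have t0: "0 \<le> t0" using ST S(1) by (simp add: t0_def)
  have step: "\<exists>\<gamma> D. good (\<kappa> * t) \<gamma> D" if ex: "\<exists>\<gamma> D. good t \<gamma> D" and t: "0 \<le> t" for t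
  proof -
    obtain \<gamma> D where g: "good t \<gamma> D" using ex by blast
    have g0: "\<gamma> n 0 = x n" "\<gamma> n 1 = y n" for n using g unfolding good_def by auto
    have gd: "(\<gamma> n has_vector_derivative D n \<tau>) (at \<tau> within {0..1})"
      and gS: "cmod (\<gamma> n \<tau>) < S" and gD: "cmod (D n \<tau>) \<le> t * (S\<^sup>2 - (cmod (\<gamma> n \<tau>))\<^sup>2)"
      if "\<tau> \<in> {0..1}" for n \<tau> using g that unfolding good_def by auto
    define w where "w n \<tau> = W (\<gamma> (n + 1) \<tau>) (\<gamma> (n - 1) \<tau>)" for n \<tau>
    define \<gamma>' where "\<gamma>' n \<tau> = \<epsilon> n * csqrt (w n \<tau>)" for n \<tau>
    define D' where "D' n \<tau> = \<epsilon> n * ((D (n + 1) \<tau> + ?b * D (n - 1) \<tau>) * inverse (2 * csqrt (w n \<tau>)))" for n \<tau>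
    have "good (\<kappa> * t) \<gamma>' D'"
      unfolding good_def
    proof (intro allI conjI ballI)
      fix n
      show "\<gamma>' n 0 = x n" unfolding \<gamma>'_def w_def g0 by (rule fixed[OF x(1) xS refl])
      show "\<gamma>' n 1 = y n" unfolding \<gamma>'_def w_def g0 by (rule fixed[OF y(1) yS signs])
      fix \<tau> :: real assume \<tau>: "\<tau> \<in> {0..1}"
      have wpos: "0 < Re (w n \<tau>)" unfolding w_def by (intro W_pos gS \<tau>)
      have y2: "(\<gamma>' n \<tau>)\<^sup>2 = w n \<tau>" using \<epsilon>2(1)[of n] by (simp add: \<gamma>'_def power_mult_distrib) (simp add: power2_eq_square)
      have "(w n has_vector_derivative (D (n + 1) \<tau> + ?b * D (n - 1) \<tau>)) (at \<tau> within {0..1})"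
        unfolding w_def[abs_def] W_def
        by (auto intro!: derivative_eq_intros gd \<tau>)
      moreover have "(csqrt has_field_derivative inverse (2 * csqrt (w n \<tau>))) (at (w n \<tau>) within w n ` {0..1})"
        using wpos by (intro has_field_derivative_at_within[OF has_field_derivative_csqrt])
          (auto simp: complex_nonpos_Reals_iff)
      ultimately have "(csqrt \<circ> w n has_vector_derivative (D (n + 1) \<tau> + ?b * D (n - 1) \<tau>) * inverse (2 * csqrt (w n \<tau>)))
          (at \<tau> within {0..1})"
        by (rule field_vector_diff_chain_within)
      then show "(\<gamma>' n has_vector_derivative D' n \<tau>) (at \<tau> within {0..1})"
        unfolding \<gamma>'_def[abs_def] D'_def comp_def
        by (rule has_vector_derivative_mult_right)
      note c = contr[OF gS[OF \<tau>, of "n + 1"] gS[OF \<tau>, of "n - 1"] y2[unfolded w_def W_def], folded \<theta>_def]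
      show "cmod (\<gamma>' n \<tau>) < S" by (rule c(2))
      have Y: "0 < cmod (\<gamma>' n \<tau>)" using wpos y2 by auto
      have YD: "cmod (csqrt (w n \<tau>)) = cmod (\<gamma>' n \<tau>)" by (simp add: \<gamma>'_def norm_mult \<epsilon>2)
      have "cmod (D (n + 1) \<tau> + ?b * D (n - 1) \<tau>) \<le> cmod (D (n + 1) \<tau>) + cmod ?b * cmod (D (n - 1) \<tau>)"
        using norm_triangle_ineq[of "D (n + 1) \<tau>" "?b * D (n - 1) \<tau>"] by (simp add: norm_mult)
      also have "\<dots> \<le> t * (S\<^sup>2 - (cmod (\<gamma> (n + 1) \<tau>))\<^sup>2) + cmod ?b * (t * (S\<^sup>2 - (cmod (\<gamma> (n - 1) \<tau>))\<^sup>2))"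
        by (intro add_mono mult_left_mono gD \<tau>) auto
      also have "\<dots> = t * ((S\<^sup>2 - (cmod (\<gamma> (n + 1) \<tau>))\<^sup>2) + cmod ?b * (S\<^sup>2 - (cmod (\<gamma> (n - 1) \<tau>))\<^sup>2))"
        by (simp add: algebra_simps)
      also have "\<dots> \<le> t * (\<kappa> * (2 * cmod (\<gamma>' n \<tau>)) * (S\<^sup>2 - (cmod (\<gamma>' n \<tau>))\<^sup>2))"
        using c(3) t unfolding \<kappa>_def by (intro mult_left_mono)
      finally have "cmod (D (n + 1) \<tau> + ?b * D (n - 1) \<tau>)
          \<le> 2 * cmod (\<gamma>' n \<tau>) * (\<kappa> * t * (S\<^sup>2 - (cmod (\<gamma>' n \<tau>))\<^sup>2))" by (simp add: mult_ac)
      then have "cmod (D (n + 1) \<tau> + ?b * D (n - 1) \<tau>) / (2 * cmod (\<gamma>' n \<tau>)) \<le> \<kappa> * t * (S\<^sup>2 - (cmod (\<gamma>' n \<tau>))\<^sup>2)"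
        using Y by (simp add: pos_divide_le_eq mult_ac)
      moreover have "cmod (D' n \<tau>) = cmod (D (n + 1) \<tau> + ?b * D (n - 1) \<tau>) / (2 * cmod (\<gamma>' n \<tau>))"
        by (simp only: D'_def norm_mult norm_inverse norm_numeral YD \<epsilon>2 mult_1 divide_inverse)
      ultimately show "cmod (D' n \<tau>) \<le> \<kappa> * t * (S\<^sup>2 - (cmod (\<gamma>' n \<tau>))\<^sup>2)" by simp
    qed
    then show ?thesis by blast
  qed
  have all: "\<exists>\<gamma> D. good (\<kappa> ^ k * t0) \<gamma> D" for k
  proof (induction k)
    case (Suc k)
    then show ?case using step[of "\<kappa> ^ k * t0"] \<kappa>(1) t0 by (simp add: mult_ac)
  qed (use base in simp)
  have "cmod (y n - x n) \<le> \<kappa> ^ k * t0 * S\<^sup>2" for n k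
  proof -
    obtain \<gamma> D where g: "good (\<kappa> ^ k * t0) \<gamma> D" using all by blast
    have "cmod (\<gamma> n 1 - \<gamma> n 0) \<le> \<kappa> ^ k * t0 * S\<^sup>2 * norm (1 - 0 :: real)"
    proof (rule differentiable_bound[of "{0..1}" "\<gamma> n" "\<lambda>\<tau> h. h *\<^sub>R D n \<tau>"])
      fix \<tau> :: real assume \<tau>: "\<tau> \<in> {0..1}"
      show "(\<gamma> n has_derivative (\<lambda>h. h *\<^sub>R D n \<tau>)) (at \<tau> within {0..1})"
        using g \<tau> unfolding good_def has_vector_derivative_def by blast
      have "cmod (D n \<tau>) \<le> \<kappa> ^ k * t0 * (S\<^sup>2 - (cmod (\<gamma> n \<tau>))\<^sup>2)" using g \<tau> unfolding good_def by blast
      also have "\<dots> \<le> \<kappa> ^ k * t0 * S\<^sup>2" using \<kappa>(1) t0 by (intro mult_left_mono) auto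
      finally have le: "cmod (D n \<tau>) \<le> \<kappa> ^ k * t0 * S\<^sup>2" .
      show "onorm (\<lambda>h. h *\<^sub>R D n \<tau>) \<le> \<kappa> ^ k * t0 * S\<^sup>2"
      proof (rule onorm_le)
        show "norm (h *\<^sub>R D n \<tau>) \<le> \<kappa> ^ k * t0 * S\<^sup>2 * norm h" for h :: real
          using mult_right_mono[OF le norm_ge_zero[of h]] by (simp only: norm_scaleR real_norm_def mult.commute[of "\<bar>h\<bar>"])
      qed
    qed auto
    then show ?thesis using g unfolding good_def by simp
  qed
  moreover have "(\<lambda>k. \<kappa> ^ k * t0 * S\<^sup>2) \<longlonglongrightarrow> 0 * t0 * S\<^sup>2"
    using \<kappa> by (intro tendsto_intros LIMSEQ_power_zero) auto
  ultimately have "cmod (y n - x n) \<le> 0" for n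
    using LIMSEQ_le_const[of "\<lambda>k. \<kappa> ^ k * t0 * S\<^sup>2" 0 "cmod (y n - x n)"] by auto
  then show ?thesis by (auto simp: fun_eq_iff)
qed

lemma inj_on_coding:
  assumes "(complex_of_real a, complex_of_real b) \<in> HOV" and a: "a < 0"
  shows "inj_on (coding (complex_of_real a, complex_of_real b)) (henon_K (complex_of_real a, complex_of_real b))"
proof (rule inj_onI)
  let ?z = "(complex_of_real a, complex_of_real b)"
  have z: "snd ?z \<noteq> 0" and ab: "2 * (1 + \<bar>b\<bar>)\<^sup>2 < \<bar>a\<bar>"
    using assms(1) by (auto simp: HOV_def add.commute)
  \<comment> \<open>With this \<open>S\<close> the inequality defining \<open>HOV\<close>, doubled,
    is the square of \<open>2 * (1 + \<bar>b\<bar>) < S\<close>.\<close>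
  define S where "S = sqrt (2 * \<bar>a\<bar>)"
  have S: "0 < S" "S\<^sup>2 = 2 * \<bar>a\<bar>" using a by (simp_all add: S_def)
  have "(2 * (1 + \<bar>b\<bar>))\<^sup>2 < S\<^sup>2" using ab unfolding power_mult_distrib S(2) by simp
  then have b: "2 * (1 + \<bar>b\<bar>) < S" using S(1) by (simp add: power2_less_imp_less)
  fix p q assume p: "p \<in> henon_K ?z" and q: "q \<in> henon_K ?z" and eq: "coding ?z p = coding ?z q"
  have "orb ?z p = orb ?z q"
  proof (rule hov_same_signs_eq[OF a S b])
    show "0 < Re (orb ?z p n) \<longleftrightarrow> 0 < Re (orb ?z q n)" for n
      using fun_cong[OF eq, of n] by (simp add: coding_def orb_def)
  qed (use p q in \<open>simp_all add: orb_rec[OF z] in_henon_K_iff_bounded[OF z]\<close>)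
  then show "p = q" by (metis orb_0[OF z])
qed

text \<open>For a real parameter, conjugating a point conjugates its orbit and keeps all real parts;
  the point and its conjugate have the same code and hence coincide.\<close>

lemma henon_K_subset_real_points:
  assumes "(complex_of_real a, complex_of_real b) \<in> HOV" and a: "a < 0"
    and p: "p \<in> henon_K (complex_of_real a, complex_of_real b)"
  shows "cj p = p"
proof -
  let ?z = "(complex_of_real a, complex_of_real b)"
  have z: "snd ?z \<noteq> 0" using assms(1) by (simp add: HOV_def)
  have cz: "cj ?z = ?z" by (simp add: cj_def)
  have "coding ?z (cj p) = coding ?z p"
    using orb_cj[OF z, of p] unfolding cz by (simp add: coding_def flip: orb_def)
  then show ?thesis using inj_on_coding[OF assms(1,2)] p cj_in_henon_K[OF z p] unfolding cz inj_on_def by blast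
qed

section \<open>The loop of a real parameter\<close>

lemma real_parameter_monodromy:
  fixes a0 b0 :: real
  defines "z0 \<equiv> (complex_of_real a0, complex_of_real b0)"
  assumes z0: "z0 \<in> HOV" "a0 < 0" and w: "w \<in> H0" "w \<in> real_points"
  obtains \<gamma> where "\<gamma> \<in> loops z0"
    "top_conjugate (henon w) (henon_KR w) (henon z0)
       {p \<in> henon_K z0. monodromy z0 \<gamma> (coding z0 p) = coding z0 p}"
proof -
  let ?K = "henon_K z0"
  have zH0: "z0 \<in> H0" using H0_component(2)[OF z0(1) w(1)] z0(1) by blast
  have real: "cj p = p" if "p \<in> ?K" for p using henon_K_subset_real_points z0 that unfolding z0_def by blast
  have cz0: "cj z0 = z0" by (simp add: z0_def cj_def)
  have cw: "cj w = w" using w(2) by (simp add: real_points_iff)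
  have zn: "snd z \<noteq> 0" if "z \<in> H0" for z using that H0_subset horseshoe_locusD(1) by blast
  note z0n = zn[OF zH0] and wn = zn[OF w(1)]
  obtain \<sigma> where \<sigma>: "path \<sigma>" "path_image \<sigma> \<subseteq> H0" "pathstart \<sigma> = z0" "pathfinish \<sigma> = w"
    using path_connected_H0[OF z0(1) w(1)] zH0 w(1) unfolding path_connected_def by blast
  have \<sigma>01: "\<sigma> 0 = z0" "\<sigma> 1 = w" using \<sigma>(3,4) by (simp_all add: pathstart_def pathfinish_def)
  have \<sigma>H: "\<sigma> t \<in> H0" if "t \<in> {0..1}" for t using \<sigma>(2) that by (auto simp: path_image_def)
  obtain g where g: "conjugacy_family \<sigma> g"
    using conjugacy_family_exists[OF \<sigma>(1)] \<sigma>(2) H0_subset by blast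
  note gD = conjugacy_familyD[OF g, unfolded \<sigma>01]
  have g1: "conjugates (g 1) (henon z0) ?K (henon w) (henon_K w)" using gD(2)[of 1] \<sigma>01 by simp
  obtain k where k: "conjugates k (henon w) (henon_K w) (henon z0) ?K"
    and kg: "\<And>p. p \<in> ?K \<Longrightarrow> k (g 1 p) = p" and gk: "\<And>q. q \<in> henon_K w \<Longrightarrow> g 1 (k q) = q"
  proof (rule conjugates_inverse[OF g1])
    show "henon z0 p \<in> ?K" if "p \<in> ?K" for p using henon_in_henon_K[OF z0n that] .
  qed (rule that)
  have cjw: "conjugates cj (henon w) (henon_K w) (henon w) (henon_K w)"
    using conjugates_cj[OF wn] unfolding cw .
  define \<phi> where "\<phi> p = k (cj (g 1 p))" for p
  have \<phi>: "conjugates \<phi> (henon z0) ?K (henon z0) ?K"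
    unfolding \<phi>_def[abs_def] using conjugates_compose[OF conjugates_compose[OF g1 cjw] k] .
  define \<gamma> where "\<gamma> = \<sigma> +++ reversepath (cj \<circ> \<sigma>)"
  have pc: "path (cj \<circ> \<sigma>)"
    by (intro path_continuous_image \<sigma> continuous_on_cj continuous_on_id)
  have \<gamma>: "path \<gamma>" "path_image \<gamma> \<subseteq> H0" "pathstart \<gamma> = z0" "pathfinish \<gamma> = z0"
  proof -
    have "pathfinish \<sigma> = pathstart (reversepath (cj \<circ> \<sigma>))"
      by (simp add: pathfinish_compose \<sigma> cw)
    then show "path \<gamma>" unfolding \<gamma>_def by (intro path_join_imp) (simp_all add: \<sigma> pc)
    have "path_image (cj \<circ> \<sigma>) \<subseteq> H0"
      using \<sigma>(2) cj_in_H0[OF z0(1)] by (auto simp: path_image_compose)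
    then show "path_image \<gamma> \<subseteq> H0" unfolding \<gamma>_def
      by (intro subset_path_image_join) (simp_all add: \<sigma>)
    show "pathstart \<gamma> = z0" "pathfinish \<gamma> = z0"
      unfolding \<gamma>_def by (simp_all add: \<sigma> pathstart_compose cz0)
  qed
  have \<gamma>0: "\<gamma> 0 = z0" using \<gamma>(3) by (simp add: pathstart_def)
  have \<gamma>1: "\<gamma> t = \<sigma> (2 * t)" if "t \<le> 1/2" for t using that by (simp add: \<gamma>_def joinpaths_def)
  have \<gamma>2: "\<gamma> t = cj (\<sigma> (2 - 2 * t))" if "1/2 \<le> t" for t
  proof (cases "t = 1/2")
    case True
    show ?thesis unfolding True using \<gamma>1[of "1/2"] \<sigma>01 cw by simp
  next
    case False
    then have "\<gamma> t = cj (\<sigma> (1 - (2 * t - 1)))" using that by (simp add: \<gamma>_def joinpaths_def reversepath_def)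
    then show ?thesis by (simp add: algebra_simps)
  qed
  \<comment> \<open>The second half runs the conjugated family backwards. Precomposition with
    \<open>\<phi>\<close> makes the halves match at \<open>t = 1/2\<close>, where
    \<open>cj (g 1 (\<phi> p)) = g 1 p\<close>.\<close>
  define G where "G t p = (if t \<le> 1/2 then g (2 * t) p else cj (g (2 - 2 * t) (\<phi> p)))" for t p
  have "conjugacy_family \<gamma> G"
    unfolding conjugacy_family_def \<gamma>0
  proof (intro conjI ballI)
    have "continuous_on ({0..1/2::real} \<times> ?K \<union> {1/2..1::real} \<times> ?K)
      (\<lambda>x. if fst x \<le> 1/2 then (\<lambda>(t, p). g t p) (2 * fst x, snd x) else cj ((\<lambda>(t, p). g t p) (2 - 2 * fst x, \<phi> (snd x))))"
    proof (rule continuous_on_cases)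
      have "closed ?K" by (intro compact_imp_closed compact_henon_K z0n)
      then show "closed ({0..1/2::real} \<times> ?K)" "closed ({1/2..1::real} \<times> ?K)"
        by (simp_all add: closed_Times)
      show "continuous_on ({0..1/2::real} \<times> ?K) (\<lambda>x. (\<lambda>(t, p). g t p) (2 * fst x, snd x))"
        by (rule continuous_on_compose2[OF gD(1)]) (auto intro!: continuous_intros)
      have "continuous_on ({1/2..1::real} \<times> ?K) (\<lambda>x. \<phi> (snd x))"
        by (rule continuous_on_compose2[OF conjugatesD(1)[OF \<phi>]]) (auto intro!: continuous_intros)
      then have "continuous_on ({1/2..1::real} \<times> ?K) (\<lambda>x. (2 - 2 * fst x, \<phi> (snd x)))"
        by (intro continuous_intros)
      then have "continuous_on ({1/2..1::real} \<times> ?K) (\<lambda>x. (\<lambda>(t, p). g t p) (2 - 2 * fst x, \<phi> (snd x)))"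
      proof (rule continuous_on_compose2[OF gD(1)])
        show "(\<lambda>x. (2 - 2 * fst x, \<phi> (snd x))) ` ({1/2..1::real} \<times> ?K) \<subseteq> {0..1} \<times> ?K"
          using conjugatesD(5)[OF \<phi>] by (intro image_subsetI) (simp add: mem_Times_iff)
      qed
      then show "continuous_on ({1/2..1::real} \<times> ?K) (\<lambda>x. cj ((\<lambda>(t, p). g t p) (2 - 2 * fst x, \<phi> (snd x))))"
        by (rule continuous_on_cj)
      show "\<forall>x. x \<in> {0..1/2::real} \<times> ?K \<and> \<not> fst x \<le> 1/2 \<or> x \<in> {1/2..1::real} \<times> ?K \<and> fst x \<le> 1/2 \<longrightarrow>
          (\<lambda>(t, p). g t p) (2 * fst x, snd x) = cj ((\<lambda>(t, p). g t p) (2 - 2 * fst x, \<phi> (snd x)))"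
      proof (intro allI impI)
        fix x :: "real \<times> complex \<times> complex"
        assume x: "x \<in> {0..1/2::real} \<times> ?K \<and> \<not> fst x \<le> 1/2 \<or> x \<in> {1/2..1::real} \<times> ?K \<and> fst x \<le> 1/2"
        then have eq: "2 * fst x = 1" "(2::real) - 1 = 1" and K: "snd x \<in> ?K" by (auto simp: mem_Times_iff)
        show "(\<lambda>(t, p). g t p) (2 * fst x, snd x) = cj ((\<lambda>(t, p). g t p) (2 - 2 * fst x, \<phi> (snd x)))"
          by (simp only: split_conv eq \<phi>_def gk[OF conjugatesD(5)[OF cjw conjugatesD(5)[OF g1 K]]] cj_cj)
      qed
    qed
    moreover have "{0..1/2::real} \<times> ?K \<union> {1/2..1::real} \<times> ?K = {0..1::real} \<times> ?K" by auto
    moreover have "(\<lambda>x. if fst x \<le> 1/2 then (\<lambda>(t, p). g t p) (2 * fst x, snd x)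
        else cj ((\<lambda>(t, p). g t p) (2 - 2 * fst x, \<phi> (snd x)))) = (\<lambda>(t, p). G t p)"
      by (auto simp: G_def fun_eq_iff)
    ultimately show "continuous_on ({0..1} \<times> ?K) (\<lambda>(t, p). G t p)" by (simp only:)
    show "G 0 p = p" if "p \<in> ?K" for p using gD(3)[OF that] by (simp add: G_def)
    fix t :: real assume t: "t \<in> {0..1}"
    show "conjugates (G t) (henon z0) ?K (henon (\<gamma> t)) (henon_K (\<gamma> t))"
    proof (cases "t \<le> 1/2")
      case True
      then have "G t = g (2 * t)" by (simp add: G_def fun_eq_iff)
      then show ?thesis using gD(2)[of "2 * t"] t True by (simp add: \<gamma>1)
    next
      case False
      then have G: "G t = (\<lambda>p. cj (g (2 - 2 * t) (\<phi> p)))" by (simp add: G_def fun_eq_iff)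
      have t': "2 - 2 * t \<in> {0..1}" using t False by simp
      have "conjugates (\<lambda>p. cj (g (2 - 2 * t) (\<phi> p))) (henon z0) ?K
          (henon (cj (\<sigma> (2 - 2 * t)))) (henon_K (cj (\<sigma> (2 - 2 * t))))"
        by (rule conjugates_compose[OF conjugates_compose[OF \<phi> gD(2)[OF t']] conjugates_cj[OF zn[OF \<sigma>H[OF t']]]])
      then show ?thesis using False by (simp add: G \<gamma>2)
    qed
  qed
  then have tr: "transport \<gamma> = restrict (G 1) ?K"
    using transport_eq[OF \<gamma>(1)] \<gamma>(2) H0_subset \<gamma>0 by (metis order_trans)
  \<comment> \<open>At \<open>t = 1\<close> the formula gives \<open>cj (\<phi> p)\<close>; the
    outer conjugation disappears because \<open>henon_K z0\<close> is real.\<close>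
  have G1: "G 1 p = \<phi> p" if p: "p \<in> ?K" for p
  proof -
    have "\<phi> p \<in> ?K" using conjugatesD(5)[OF \<phi> p] .
    then show ?thesis using gD(3) real by (simp add: G_def)
  qed
  have inj: "inj_on (coding z0) ?K" using inj_on_coding z0 unfolding z0_def by blast
  have mono: "monodromy z0 \<gamma> (coding z0 p) = coding z0 p \<longleftrightarrow> g 1 p \<in> real_points" if p: "p \<in> ?K" for p
  proof -
    have "monodromy z0 \<gamma> (coding z0 p) = coding z0 (\<phi> p)"
      using p inv_into_f_f[OF inj p] by (simp add: monodromy_def tr G1)
    moreover have "coding z0 (\<phi> p) = coding z0 p \<longleftrightarrow> \<phi> p = p"
      using inj conjugatesD(5)[OF \<phi> p] p by (auto simp: inj_on_def)
    moreover have "\<phi> p = p \<longleftrightarrow> cj (g 1 p) = g 1 p"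
    proof
      assume "\<phi> p = p"
      then show "cj (g 1 p) = g 1 p"
        using gk[OF conjugatesD(5)[OF cjw conjugatesD(5)[OF g1 p]]] by (simp add: \<phi>_def)
    next
      assume "cj (g 1 p) = g 1 p"
      then show "\<phi> p = p" using kg[OF p] by (simp add: \<phi>_def)
    qed
    ultimately show ?thesis by (simp add: real_points_iff)
  qed
  have "conjugates k (henon w) (henon_KR w) (henon z0) {p \<in> ?K. monodromy z0 \<gamma> (coding z0 p) = coding z0 p}"
  proof (rule conjugates_subset[OF k])
    show "henon_KR w \<subseteq> henon_K w" by (auto simp: henon_KR_def)
    show "k ` henon_KR w = {p \<in> ?K. monodromy z0 \<gamma> (coding z0 p) = coding z0 p}"
    proof (intro equalityI image_subsetI subsetI)
      fix q assume "q \<in> henon_KR w"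
      then have q: "q \<in> henon_K w" "q \<in> real_points" by (auto simp: henon_KR_def)
      then show "k q \<in> {p \<in> ?K. monodromy z0 \<gamma> (coding z0 p) = coding z0 p}"
        using mono[of "k q"] conjugatesD(5)[OF k] gk by simp
    next
      fix p assume "p \<in> {p \<in> ?K. monodromy z0 \<gamma> (coding z0 p) = coding z0 p}"
      then have p: "p \<in> ?K" "g 1 p \<in> real_points" using mono[of p] by simp_all
      then have "g 1 p \<in> henon_KR w" using conjugatesD(5)[OF g1] by (simp add: henon_KR_def)
      then show "p \<in> k ` henon_KR w" using kg[OF p(1)] by (metis image_eqI)
    qed
  qed
  then show ?thesis using that[of \<gamma>] \<gamma> unfolding loops_def top_conjugate_def by blast
qed

lemma henon_in_henon_KR:
  assumes "z \<in> real_points" "snd z \<noteq> 0" "p \<in> henon_KR z"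
  shows "henon z p \<in> henon_KR z"
  using assms henon_in_henon_K[OF assms(2)] cj_henon[of z p]
  by (simp add: henon_KR_def real_points_iff)

lemma equiv_real_conj_rel: "equiv (real_points \<inter> H0) real_conj_rel"
proof (rule equivI)
  have inv: "henon z p \<in> henon_KR z" if "z \<in> real_points \<inter> H0" "p \<in> henon_KR z" for z p
    using that henon_in_henon_KR horseshoe_locusD(1) H0_subset by blast
  show "real_conj_rel \<subseteq> (real_points \<inter> H0) \<times> (real_points \<inter> H0)"
    by (auto simp: real_conj_rel_def)
  show "refl_on (real_points \<inter> H0) real_conj_rel"
    by (auto simp: refl_on_def real_conj_rel_def top_conjugate_refl)
  show "sym real_conj_rel"
    unfolding sym_def real_conj_rel_def using top_conjugate_sym inv by blast
  show "trans real_conj_rel"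
    unfolding trans_def real_conj_rel_def using top_conjugate_trans by blast
qed

theorem theorem1:
  fixes a0 b0 :: real
  assumes "(complex_of_real a0, complex_of_real b0) \<in> HOV"
    and "a0 < 0"
  shows "real_conj_classes \<lesssim> monodromy_group (complex_of_real a0, complex_of_real b0)"
proof -
  let ?z0 = "(complex_of_real a0, complex_of_real b0)"
  let ?Fix = "\<lambda>m. {p \<in> henon_K ?z0. m (coding ?z0 p) = coding ?z0 p}"
  \<comment> \<open>A representative and a monodromy are chosen for each class; the assignment
    depends on these choices, but the class can be recovered from the monodromy.\<close>
  define P where "P X w m \<longleftrightarrow> w \<in> real_points \<inter> H0 \<and> X = real_conj_rel `` {w} \<and> m \<in> monodromy_group ?z0 \<and>
      top_conjugate (henon w) (henon_KR w) (henon ?z0) (?Fix m)" for X w m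
  have "\<exists>w m. P X w m" if X: "X \<in> real_conj_classes" for X
  proof -
    obtain w where w: "w \<in> real_points \<inter> H0" "X = real_conj_rel `` {w}"
      using X unfolding real_conj_classes_def by (rule quotientE)
    then obtain \<gamma> where "\<gamma> \<in> loops ?z0"
      "top_conjugate (henon w) (henon_KR w) (henon ?z0) (?Fix (monodromy ?z0 \<gamma>))"
      using real_parameter_monodromy[OF assms, of w] by blast
    then have "P X w (monodromy ?z0 \<gamma>)" using w unfolding P_def monodromy_group_def by blast
    then show ?thesis by blast
  qed
  then obtain w m where P: "\<And>X. X \<in> real_conj_classes \<Longrightarrow> P X (w X) (m X)" by metis
  have w: "w X \<in> real_points \<inter> H0" "X = real_conj_rel `` {w X}"
    and m: "m X \<in> monodromy_group ?z0"
    and conj: "top_conjugate (henon (w X)) (henon_KR (w X)) (henon ?z0) (?Fix (m X))"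
    if "X \<in> real_conj_classes" for X
    using P[OF that] unfolding P_def by blast+
  \<comment> \<open>Equal monodromies have the same fixed set in the base \<open>henon_K\<close>,
    and both real maps are conjugate to the base map on that set.\<close>
  have "inj_on m real_conj_classes"
  proof (rule inj_onI)
    fix X Y assume X: "X \<in> real_conj_classes" and Y: "Y \<in> real_conj_classes" and eq: "m X = m Y"
    have "henon (w Y) p \<in> henon_KR (w Y)" if "p \<in> henon_KR (w Y)" for p
      using that w(1)[OF Y] henon_in_henon_KR horseshoe_locusD(1) H0_subset by blast
    then have "top_conjugate (henon ?z0) (?Fix (m X)) (henon (w Y)) (henon_KR (w Y))"
      using top_conjugate_sym[OF conj[OF Y]] eq by simp
    then have "(w X, w Y) \<in> real_conj_rel"
      using top_conjugate_trans[OF conj[OF X]] w(1)[OF X] w(1)[OF Y] unfolding real_conj_rel_def by blast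
    then have "real_conj_rel `` {w X} = real_conj_rel `` {w Y}" by (rule equiv_class_eq[OF equiv_real_conj_rel])
    then show "X = Y" using w(2)[OF X] w(2)[OF Y] by simp
  qed
  then show ?thesis unfolding lepoll_def using m by blast
qed

end
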